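(* Suppose that $\diamondsuit^*(\omega_1)$ holds. Then there is an $\mathbb R$-embeddable almost-Souslin $\aleph_1$-tree $T$ such that $X_T$ is perfectly normal, but $(X_T)^2$ is not cmc.
   Context: A tree is a subset $T$ of ${}^{<\omega_1}w$ (for some countable set $w$) that is downward closed: for every $t\in T$ and every $\alpha<\mathrm{dom}(t)$, $t\restriction\alpha\in T$; its levels are $T_\alpha:=T\cap{}^\alpha w$. $T$ is an $\aleph_1$-tree iff its height (the least $\alpha$ with $T_\alpha=\emptyset$) is $\omega_1$ and every level is countable. $T$ is almost-Souslin iff for every antichain $A\subseteq T$ (set of pairwise $\subseteq$-incomparable nodes) the set $\{\mathrm{dom}(x)\mid x\in A\}$ is nonstationary in $\omega_1$. $T$ is $\mathbb R$-embeddable iff there is $c:T\to\mathbb R$ with $c(x)<c(y)$ whenever $x\subsetneq y$. $X_T$ is $T$ with the interval topology, whose basic open sets are the intervals $(x,y]:=\{z\in T\mid x\subsetneq z\subseteq y\}$ for $x\subsetneq y$ in $T$, together with $\{\emptyset\}$; $(X_T)^2$ is the product space $X_T\times X_T$. A space is countably metacompact (cmc) iff every countable open cover has a point-finite open refinement; perfectly normal means normal and every closed set is $G_\delta$. *)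

theory Defs
  imports "HOL-Analysis.Analysis" "HOL-Library.Countable_Set_Type"
begin

section \<open>The ordinal \<open>\<omega>\<^sub>1\<close>\<close>

text \<open>The elements of the type \<open>omega1\<close> are the ordinals below \<open>\<omega>\<^sub>1\<close>, the successor cardinal of
  \<open>\<omega>\<close>. The ordinal \<open>\<alpha>\<close>, as the von Neumann set of smaller ordinals, is \<open>{..<\<alpha>}\<close>.\<close>

typedef omega1 = "Field (cardSuc natLeq)"
  using Field_cardSuc_not_empty[OF natLeq_Card_order] by blast

lemma cardSuc_natLeq_wo: "well_order_on (Field (cardSuc natLeq)) (cardSuc natLeq)"
  using cardSuc_Well_order[OF natLeq_Card_order] by simp

instantiation omega1 :: wellorder
begin

definition less_eq_omega1 :: "omega1 \<Rightarrow> omega1 \<Rightarrow> bool" where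
  "a \<le> b \<longleftrightarrow> (Rep_omega1 a, Rep_omega1 b) \<in> cardSuc natLeq"

definition less_omega1 :: "omega1 \<Rightarrow> omega1 \<Rightarrow> bool" where
  "a < b \<longleftrightarrow> a \<le> b \<and> \<not> b \<le> a" for a b :: omega1

instance
proof
  have lin: "linear_order_on (Field (cardSuc natLeq)) (cardSuc natLeq)"
    and wf: "wf (cardSuc natLeq - Id)"
    using cardSuc_natLeq_wo by (auto simp: well_order_on_def)
  have refl: "refl_on (Field (cardSuc natLeq)) (cardSuc natLeq)"
    and trans: "trans (cardSuc natLeq)" and antisym: "antisym (cardSuc natLeq)"
    and total: "total_on (Field (cardSuc natLeq)) (cardSuc natLeq)"
    using lin by (auto simp: linear_order_on_def partial_order_on_def preorder_on_def)
  fix x y z :: omega1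
  show "(x < y) = (x \<le> y \<and> \<not> y \<le> x)" by (rule less_omega1_def)
  show le_refl: "x \<le> x" for x :: omega1
    unfolding less_eq_omega1_def using refl Rep_omega1 by (auto simp: refl_on_def)
  show "x \<le> y \<Longrightarrow> y \<le> z \<Longrightarrow> x \<le> z"
    unfolding less_eq_omega1_def using trans by (meson transD)
  show anti: "x \<le> y \<Longrightarrow> y \<le> x \<Longrightarrow> x = y" for x y :: omega1
    unfolding less_eq_omega1_def using antisym by (metis antisymD Rep_omega1_inject)
  show tot: "x \<le> y \<or> y \<le> x"
    using le_refl[of x] total Rep_omega1[of x] Rep_omega1[of y]
    unfolding less_eq_omega1_def total_on_def by (metis)
  fix P :: "omega1 \<Rightarrow> bool" and a
  assume step: "\<And>x. (\<And>y. y < x \<Longrightarrow> P y) \<Longrightarrow> P x"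
  have "wf (inv_image (cardSuc natLeq - Id) Rep_omega1)" using wf by (rule wf_inv_image)
  then show "P a"
  proof (induction a rule: wf_induct_rule)
    case (less x)
    show ?case
    proof (rule step)
      fix y :: omega1 assume "y < x"
      then show "P y" by (intro less) (auto simp: less_omega1_def less_eq_omega1_def in_inv_image)
    qed
  qed
qed

end

lemma countable_below_omega1:
  includes cardinal_syntax
  shows "countable {..<a :: omega1}"
proof -
  let ?r = "cardSuc natLeq"
  have "|underS ?r (Rep_omega1 a)| <o ?r"
    using card_of_underS[OF cardSuc_Card_order[OF natLeq_Card_order] Rep_omega1] .
  then have "|underS ?r (Rep_omega1 a)| \<le>o natLeq"
    using cardSuc_ordLeq_ordLess[OF natLeq_Card_order card_of_Card_order] by blast
  then have "countable (underS ?r (Rep_omega1 a))"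
    by (simp add: countable_card_le_natLeq)
  moreover have "Rep_omega1 ` {..<a} \<subseteq> underS ?r (Rep_omega1 a)"
    by (auto simp: underS_def less_omega1_def less_eq_omega1_def Rep_omega1_inject)
  ultimately have "countable (Rep_omega1 ` {..<a})" by (rule countable_subset[rotated])
  then show ?thesis
    by (rule countable_image_inj_on) (auto simp: inj_on_def Rep_omega1_inject)
qed

lemma uncountable_omega1:
  includes cardinal_syntax
  shows "uncountable (UNIV :: omega1 set)"
proof
  assume "countable (UNIV :: omega1 set)"
  then have "countable (range Rep_omega1)" by simp
  then have "countable (Field (cardSuc natLeq))"
    using type_definition.Rep_range[OF type_definition_omega1] by simp
  then have "|Field (cardSuc natLeq)| \<le>o natLeq" by (simp add: countable_card_le_natLeq)
  then have "cardSuc natLeq \<le>o natLeq"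
    using card_of_Field_ordIso[OF cardSuc_Card_order[OF natLeq_Card_order]]
      ordIso_ordLeq_trans ordIso_symmetric by blast
  then show False
    using cardSuc_greater[OF natLeq_Card_order] not_ordLess_ordLeq by blast
qed


section \<open>Stationary sets and \<open>\<diamondsuit>\<^sup>*(\<omega>\<^sub>1)\<close>\<close>

text \<open>A nonzero \<open>\<delta>\<close> in which \<open>C \<inter> \<delta>\<close> is unbounded is automatically a limit ordinal.\<close>

definition club :: "omega1 set \<Rightarrow> bool" where
  "club C \<longleftrightarrow>
     (\<forall>\<alpha>. \<exists>\<beta>\<in>C. \<alpha> < \<beta>) \<and>
     (\<forall>\<delta>. {..<\<delta>} \<noteq> {} \<and> (\<forall>\<alpha><\<delta>. \<exists>\<beta>\<in>C. \<alpha> < \<beta> \<and> \<beta> < \<delta>) \<longrightarrow> \<delta> \<in> C)"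

definition stationary :: "omega1 set \<Rightarrow> bool" where
  "stationary S \<longleftrightarrow> (\<forall>C. club C \<longrightarrow> S \<inter> C \<noteq> {})"

definition diamond_star :: bool where
  "diamond_star \<longleftrightarrow>
     (\<exists>\<S> :: omega1 \<Rightarrow> omega1 set set.
        (\<forall>\<alpha>. countable (\<S> \<alpha>) \<and> \<S> \<alpha> \<subseteq> Pow {..<\<alpha>}) \<and>
        (\<forall>X. \<exists>C. club C \<and> (\<forall>\<alpha>\<in>C. X \<inter> {..<\<alpha>} \<in> \<S> \<alpha>)))"


section \<open>Trees of countable sequences\<close>

text \<open>A sequence of length \<open>\<alpha> < \<omega>\<^sub>1\<close> is a partial map with domain \<open>{..<\<alpha>}\<close>. Inclusion of
  sequences is \<open>\<subseteq>\<^sub>m\<close>, and \<open>t \<restriction> \<alpha>\<close> is \<open>t |` {..<\<alpha>}\<close>.\<close>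

definition countable_seqs :: "'w set \<Rightarrow> (omega1 \<rightharpoonup> 'w) set" where
  "countable_seqs w = {t. (\<exists>\<alpha>. dom t = {..<\<alpha>}) \<and> ran t \<subseteq> w}"

definition seq_tree :: "(omega1 \<rightharpoonup> 'w) set \<Rightarrow> bool" where
  "seq_tree T \<longleftrightarrow>
     (\<exists>w. countable w \<and> T \<subseteq> countable_seqs w) \<and>
     (\<forall>t\<in>T. \<forall>\<alpha>\<in>dom t. t |` {..<\<alpha>} \<in> T)"

definition level :: "(omega1 \<rightharpoonup> 'w) set \<Rightarrow> omega1 \<Rightarrow> (omega1 \<rightharpoonup> 'w) set" where
  "level T \<alpha> = {t \<in> T. dom t = {..<\<alpha>}}"

text \<open>Level \<open>\<omega>\<^sub>1\<close> is empty for every tree, so the height is \<open>\<omega>\<^sub>1\<close> iff no level below \<open>\<omega>\<^sub>1\<close> is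
  empty.\<close>

definition aleph1_tree :: "(omega1 \<rightharpoonup> 'w) set \<Rightarrow> bool" where
  "aleph1_tree T \<longleftrightarrow>
     seq_tree T \<and> (\<forall>\<alpha>. level T \<alpha> \<noteq> {}) \<and> (\<forall>\<alpha>. countable (level T \<alpha>))"

definition tree_antichain :: "(omega1 \<rightharpoonup> 'w) set \<Rightarrow> bool" where
  "tree_antichain A \<longleftrightarrow> (\<forall>x\<in>A. \<forall>y\<in>A. x \<noteq> y \<longrightarrow> \<not> x \<subseteq>\<^sub>m y \<and> \<not> y \<subseteq>\<^sub>m x)"

definition almost_Souslin :: "(omega1 \<rightharpoonup> 'w) set \<Rightarrow> bool" where
  "almost_Souslin T \<longleftrightarrow>
     (\<forall>A\<subseteq>T. tree_antichain A \<longrightarrow> \<not> stationary {\<alpha>. \<exists>x\<in>A. dom x = {..<\<alpha>}})"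

definition strict_map_le :: "('a \<rightharpoonup> 'b) \<Rightarrow> ('a \<rightharpoonup> 'b) \<Rightarrow> bool" (infix "\<subset>\<^sub>m" 50) where
  "x \<subset>\<^sub>m y \<longleftrightarrow> x \<subseteq>\<^sub>m y \<and> x \<noteq> y"

definition real_embeddable :: "(omega1 \<rightharpoonup> 'w) set \<Rightarrow> bool" where
  "real_embeddable T \<longleftrightarrow>
     (\<exists>c :: (omega1 \<rightharpoonup> 'w) \<Rightarrow> real. \<forall>x\<in>T. \<forall>y\<in>T. x \<subset>\<^sub>m y \<longrightarrow> c x < c y)"


section \<open>The interval topology\<close>

definition tree_interval ::
  "(omega1 \<rightharpoonup> 'w) set \<Rightarrow> (omega1 \<rightharpoonup> 'w) \<Rightarrow> (omega1 \<rightharpoonup> 'w) \<Rightarrow> (omega1 \<rightharpoonup> 'w) set" where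
  "tree_interval T x y = {z \<in> T. x \<subset>\<^sub>m z \<and> z \<subseteq>\<^sub>m y}"

definition tree_basis :: "(omega1 \<rightharpoonup> 'w) set \<Rightarrow> (omega1 \<rightharpoonup> 'w) set set" where
  "tree_basis T =
     insert {Map.empty} {tree_interval T x y | x y. x \<in> T \<and> y \<in> T \<and> x \<subset>\<^sub>m y}"

definition tree_topology :: "(omega1 \<rightharpoonup> 'w) set \<Rightarrow> (omega1 \<rightharpoonup> 'w) topology" where
  "tree_topology T = topology_generated_by (tree_basis T)"

text \<open>\<open>topology_generated_by\<close> takes a subbase; the next two lemmas confirm that the given sets form
  a base of a topology on the whole tree.\<close>

lemma seq_tree_dom:
  assumes "seq_tree T" "t \<in> T" obtains a where "dom t = {..<a}"
  using assms unfolding seq_tree_def countable_seqs_def by blast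

lemma map_le_dom_subset_eq:
  assumes "x \<subseteq>\<^sub>m z" "y \<subseteq>\<^sub>m z" "dom x \<subseteq> dom y" shows "x \<subseteq>\<^sub>m y"
  using assms unfolding map_le_def by (metis subsetD)

lemma seq_tree_comparable:
  assumes "seq_tree T" "x \<in> T" "y \<in> T" "x \<subseteq>\<^sub>m z" "y \<subseteq>\<^sub>m z"
  shows "x \<subseteq>\<^sub>m y \<or> y \<subseteq>\<^sub>m x"
proof -
  obtain a b where "dom x = {..<a}" "dom y = {..<b}"
    using assms seq_tree_dom by metis
  then have "dom x \<subseteq> dom y \<or> dom y \<subseteq> dom x"
    using linear[of a b] by (auto intro: less_le_trans)
  then show ?thesis using assms map_le_dom_subset_eq by blast
qed

lemma topspace_tree_topology:
  assumes "seq_tree T" "T \<noteq> {}"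
  shows "topspace (tree_topology T) = T"
proof -
  have root: "Map.empty \<in> T"
  proof -
    obtain t a where t: "t \<in> T" "dom t = {..<a}"
      using assms seq_tree_dom by (metis equals0I)
    show ?thesis
    proof (cases "dom t = {}")
      case False
      define b :: omega1 where "b = (LEAST b. True)"
      have b: "b \<le> c" for c unfolding b_def by (rule Least_le) simp
      obtain c where "c < a" using False t by auto
      with b[of c] have "b \<in> dom t" unfolding t by simp
      moreover have "{..<b} = {}" using b by (simp add: lessThan_def not_less)
      ultimately have "b \<in> dom t" "{..<b} = {}" .
      then have "t |` {} \<in> T" using assms t(1) unfolding seq_tree_def by metis
      then show ?thesis by simp
    qed (use t in auto)
  qed
  have "y \<in> \<Union> (tree_basis T)" if "y \<in> T" for y
  proof (cases "y = Map.empty")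
    case False
    then have "y \<in> tree_interval T Map.empty y" "Map.empty \<subset>\<^sub>m y"
      using that by (auto simp: tree_interval_def strict_map_le_def)
    then show ?thesis using that root unfolding tree_basis_def by blast
  qed (simp add: tree_basis_def)
  moreover have "\<Union> (tree_basis T) \<subseteq> T"
    using root by (auto simp: tree_basis_def tree_interval_def)
  ultimately show ?thesis by (auto simp: tree_topology_def)
qed

lemma openin_tree_topology:
  assumes "seq_tree T" "T \<noteq> {}"
  shows "openin (tree_topology T) U \<longleftrightarrow> (\<exists>\<B>\<subseteq>tree_basis T. U = \<Union>\<B>)"
proof
  assume "openin (tree_topology T) U"
  then have "generate_topology_on (tree_basis T) U"
    by (simp add: tree_topology_def openin_topology_generated_by_iff)
  then have "\<forall>z\<in>U. \<exists>W\<in>tree_basis T. z \<in> W \<and> W \<subseteq> U"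
  proof (induction)
    case (Int U V)
    show ?case
    proof
      fix z assume z: "z \<in> U \<inter> V"
      obtain W W' where W: "W \<in> tree_basis T" "z \<in> W" "W \<subseteq> U"
        and W': "W' \<in> tree_basis T" "z \<in> W'" "W' \<subseteq> V" using Int z by blast
      show "\<exists>W\<in>tree_basis T. z \<in> W \<and> W \<subseteq> U \<inter> V"
      proof (cases "z = Map.empty")
        case True
        then show ?thesis using z by (auto simp: tree_basis_def)
      next
        case False
        then obtain x y x' y' where xy: "x \<in> T" "x' \<in> T" "W = tree_interval T x y"
            "W' = tree_interval T x' y'"
          using W W' by (auto simp: tree_basis_def)
        then have zz: "z \<in> T" "x \<subset>\<^sub>m z" "z \<subseteq>\<^sub>m y" "x' \<subset>\<^sub>m z" "z \<subseteq>\<^sub>m y'"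
          using W W' by (auto simp: tree_interval_def)
        have "x \<subseteq>\<^sub>m x' \<or> x' \<subseteq>\<^sub>m x"
          using seq_tree_comparable[OF assms(1) xy(1,2)] zz by (auto simp: strict_map_le_def)
        then obtain m where m: "m \<in> {x, x'}" "x \<subseteq>\<^sub>m m" "x' \<subseteq>\<^sub>m m"
          by (metis insertCI map_le_refl)
        have "m \<in> T" "m \<subset>\<^sub>m z" using m zz xy by auto
        then have "tree_interval T m z \<in> tree_basis T" "z \<in> tree_interval T m z"
          using zz by (auto simp: tree_basis_def tree_interval_def)
        moreover have "tree_interval T m z \<subseteq> W \<inter> W'"
        proof -
          have "x \<subset>\<^sub>m v \<and> x' \<subset>\<^sub>m v \<and> v \<subseteq>\<^sub>m y \<and> v \<subseteq>\<^sub>m y'" if "m \<subset>\<^sub>m v" "v \<subseteq>\<^sub>m z" for v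
            using that m zz unfolding strict_map_le_def by (metis map_le_trans map_le_antisym)
          then show ?thesis unfolding xy tree_interval_def by blast
        qed
        ultimately show ?thesis using W W' by blast
      qed
    qed
  next
    case (UN K)
    show ?case
    proof
      fix z assume "z \<in> \<Union>K"
      then obtain k where "k \<in> K" "z \<in> k" by blast
      with UN.IH[of k] obtain W where "W \<in> tree_basis T" "z \<in> W" "W \<subseteq> k" by blast
      with \<open>k \<in> K\<close> show "\<exists>W\<in>tree_basis T. z \<in> W \<and> W \<subseteq> \<Union>K" by blast
    qed
  qed auto
  then have "U = \<Union> {W \<in> tree_basis T. W \<subseteq> U}" by blast
  then show "\<exists>\<B>\<subseteq>tree_basis T. U = \<Union>\<B>" by (metis (no_types, lifting) mem_Collect_eq subsetI)
next
  assume "\<exists>\<B>\<subseteq>tree_basis T. U = \<Union>\<B>"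
  then show "openin (tree_topology T) U"
    unfolding tree_topology_def by (metis openin_Union topology_generated_by_Basis subsetD)
qed


section \<open>Topological properties\<close>

definition perfectly_normal_space :: "'a topology \<Rightarrow> bool" where
  "perfectly_normal_space X \<longleftrightarrow> normal_space X \<and> (\<forall>C. closedin X C \<longrightarrow> gdelta_in X C)"

definition open_cover :: "'a topology \<Rightarrow> 'a set set \<Rightarrow> bool" where
  "open_cover X \<U> \<longleftrightarrow> (\<forall>U\<in>\<U>. openin X U) \<and> \<Union>\<U> = topspace X"

definition countably_metacompact_space :: "'a topology \<Rightarrow> bool" where
  "countably_metacompact_space X \<longleftrightarrow>
     (\<forall>\<U>. countable \<U> \<and> open_cover X \<U> \<longrightarrow>
        (\<exists>\<V>. open_cover X \<V> \<and> (\<forall>V\<in>\<V>. \<exists>U\<in>\<U>. V \<subseteq> U) \<and>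
             (\<forall>x\<in>topspace X. finite {V \<in> \<V>. x \<in> V})))"

end

theory Submission
  imports Defs
begin

text \<open>
  The nodes are sequences of naturals with \<open>\<Sum> 2 ^ (- t \<xi>) < \<infinity>\<close>; this sum, the weight of \<open>t\<close>, is strictly
  increasing and continuous at limits, so it embeds the tree into the reals. At each limit \<open>\<delta>\<close> two
  branches of height \<open>\<delta>\<close> are chosen, and level \<open>\<delta>\<close> consists of all sequences that agree from some point
  on with one of them. The two branches are chosen mutually generic with respect to countably many
  sets guessed by \<open>\<diamondsuit>\<^sup>*\<close>: for every set \<open>A\<close> of nodes there is a club of levels at which each node
  \<open>v\<close> either has members of \<open>A\<close> cofinally below it, or some \<open>u\<close> below \<open>v\<close> has no extension in \<open>A\<close> of
  weight less than a bound exceeding the weight of \<open>v\<close>. Applied to an antichain this gives the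
  almost-Souslin property. Applied to the complement of an open set \<open>G\<close>, and using that nodes off a
  club of levels split into countably many antichains, it writes \<open>G\<close> as a countable union of open sets
  whose closures lie in \<open>G\<close>, which is perfect normality.

  For the square, a sequence of sets \<open>G n\<close> of pairs is guessed as well (here \<open>\<diamondsuit>\<^sup>*\<close>
  yields \<open>\<diamondsuit>\<close>). The pair chosen at \<open>\<delta>\<close> decides each \<open>n\<close>: either some initial part captures \<open>G n\<close>, or
  the pair is a limit of pairs outside \<open>G n\<close>. In the latter case the pair is declared, with the least
  such \<open>n\<close> as its label. The declared pairs form an antichain of pairs, so those with label at least
  \<open>n\<close> form a closed set \<open>D n\<close>, and the \<open>D n\<close> have empty intersection. If \<open>G n\<close> is open and contains
  \<open>D n\<close> for all \<open>n\<close>, then the pair at a correctly guessed \<open>\<delta>\<close> cannot be declared, so it lies in every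
  \<open>G n\<close>.
\<close>

section \<open>The ordinal \<open>\<omega>\<^sub>1\<close>, clubs and diamonds\<close>

lemma countable_bounded_omega1:
  fixes A :: "omega1 set"
  assumes "countable A"
  shows "\<exists>b. \<forall>a\<in>A. a < b"
proof (rule ccontr)
  assume "\<not> ?thesis"
  then have "UNIV = (\<Union>a\<in>A. insert a {..<a})"
    by (auto simp: not_less) (metis le_less)
  moreover have "countable (\<Union>a\<in>A. insert a {..<a})"
    using assms countable_below_omega1 by auto
  ultimately show False using uncountable_omega1 by simp
qed

lemma ex_greater_omega1: "\<exists>b::omega1. a < b"
  using countable_bounded_omega1[of "{a}"] by auto

lemma countable_atMost_omega1: "countable {..a :: omega1}"
  using countable_below_omega1[of a] by (simp flip: ivl_disj_un_singleton(2))

definition islim :: "omega1 \<Rightarrow> bool" where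
  "islim d \<longleftrightarrow> {..<d} \<noteq> {} \<and> (\<forall>a<d. \<exists>b. a < b \<and> b < d)"

text \<open>No successor operation is defined on \<open>omega1\<close>: zero and successors are
  recognised by their sets of predecessors. Inductions on levels split along this
  trichotomy.\<close>

lemma omega1_cases:
  obtains (zero) "{..<d :: omega1} = {}" | (suc) a where "{..<d} = {..a}" | (lim) "islim d"
proof -
  consider "islim d" | "{..<d} = {}" | a where "a < d" "\<forall>b. a < b \<longrightarrow> \<not> b < d"
    unfolding islim_def by blast
  then show thesis
  proof cases
    case 3
    then have "{..<d} = {..a}" by (auto simp: not_less)
    then show thesis by (rule suc)
  qed (use zero lim in auto)
qed

lemma islim_not_suc: "islim d \<Longrightarrow> {..<d} \<noteq> {..a}"
  unfolding islim_def by (metis atMost_iff leD lessThan_iff order_refl)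

lemma ex_suc_omega1: "\<exists>b. {..<b} = {..a :: omega1}"
proof -
  have "a < (LEAST b. a < b)" using ex_greater_omega1 by (rule LeastI_ex)
  then have "{..<LEAST b. a < b} = {..a}"
    by (auto dest: not_less_Least simp: not_less)
  then show ?thesis by blast
qed

lemma ex_zero_omega1: "\<exists>z :: omega1. {..<z} = {}"
proof -
  have "\<not> b < (LEAST z::omega1. True)" for b by (auto dest: not_less_Least)
  then show ?thesis by auto
qed

text \<open>Unboundedness: iterate a function \<open>f\<close> that exceeds every earlier value of
  \<open>h\<close>; the supremum of the iterates is closed under \<open>h\<close>.\<close>

lemma club_closure_points:
  fixes h :: "omega1 \<Rightarrow> omega1"
  shows "club {d. islim d \<and> (\<forall>b<d. h b < d)}"
  unfolding club_def
proof (intro conjI allI impI)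
  fix a0 :: omega1
  have "\<exists>b. a < b \<and> (\<forall>x\<le>a. h x < b)" for a
  proof -
    have "countable (insert a (h ` {..a}))" using countable_atMost_omega1 by simp
    from countable_bounded_omega1[OF this] show ?thesis by auto
  qed
  then obtain f where f: "\<And>a. a < f a" "\<And>a x. x \<le> a \<Longrightarrow> h x < f a" by metis
  define s where "s n = (f ^^ n) a0" for n
  have s: "s n < s (Suc n)" "x \<le> s n \<Longrightarrow> h x < s (Suc n)" for n x
    unfolding s_def using f by auto
  \<comment> \<open>The supremum of the strictly increasing sequence \<open>s\<close>, written as
    its least strict upper bound.\<close>
  define t where "t = (LEAST b. \<forall>n. s n < b)"
  have "\<exists>b. \<forall>n. s n < b" using countable_bounded_omega1[of "range s"] by auto
  then have t: "s n < t" for n unfolding t_def using LeastI_ex[of "\<lambda>b. \<forall>n. s n < b"] by blast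
  have below: "\<exists>n. x \<le> s n" if "x < t" for x
    using not_less_Least[OF that[unfolded t_def]] by (auto simp: not_less)
  have "islim t" unfolding islim_def
    using t below s(1) by (metis empty_iff lessThan_iff le_less_trans)
  moreover have "h x < t" if "x < t" for x
    using below[OF that] s(2) t by (meson less_trans)
  moreover have "a0 < t" using t[of 0] by (simp add: s_def)
  ultimately show "\<exists>b\<in>{d. islim d \<and> (\<forall>b<d. h b < d)}. a0 < b" by blast
next
  fix d :: omega1
  assume d: "{..<d} \<noteq> {} \<and> (\<forall>a<d. \<exists>b\<in>{d. islim d \<and> (\<forall>b<d. h b < d)}. a < b \<and> b < d)"
  have "h b < d" if "b < d" for b using d that by (fastforce intro: less_trans)
  with d show "d \<in> {d. islim d \<and> (\<forall>b<d. h b < d)}" unfolding islim_def by fast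
qed

text \<open>Let \<open>h a\<close> exceed, for every \<open>i\<close>, a point of \<open>C i\<close>
  above \<open>a\<close>. A limit closed under \<open>h\<close> is then a limit of points of each
  \<open>C i\<close>, hence lies in all of them.\<close>

lemma club_INT:
  fixes C :: "nat \<Rightarrow> omega1 set"
  assumes "\<And>i. club (C i)"
  shows "club (\<Inter>i. C i)"
proof -
  have "\<forall>i a. \<exists>b\<in>C i. a < b" using assms unfolding club_def by blast
  then obtain f where f: "\<And>i a. f i a \<in> C i" "\<And>i a. a < f i a" by metis
  have "\<exists>b. \<forall>i. f i a < b" for a using countable_bounded_omega1[of "range (\<lambda>i. f i a)"] by auto
  then obtain h where h: "\<And>i a. f i a < h a" by metis
  have "d \<in> C i" if "islim d" "\<forall>b<d. h b < d" for d i
  proof -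
    have "\<forall>a<d. \<exists>b\<in>C i. a < b \<and> b < d" using f h that by (meson less_trans)
    then show ?thesis using assms[of i] that(1) unfolding club_def islim_def by blast
  qed
  then have "\<exists>b\<in>\<Inter>i. C i. a < b" for a
    using club_closure_points[of h] unfolding club_def by blast
  moreover have "d \<in> (\<Inter>i. C i)"
    if "{..<d} \<noteq> {}" "\<forall>a<d. \<exists>b\<in>\<Inter>i. C i. a < b \<and> b < d" for d
  proof
    fix i
    have "\<forall>a<d. \<exists>b\<in>C i. a < b \<and> b < d" using that(2) by blast
    then show "d \<in> C i" using assms[of i] that(1) unfolding club_def by blast
  qed
  ultimately show ?thesis unfolding club_def by blast
qed

lemma club_Int:
  assumes "club C" "club D"
  shows "club (C \<inter> D)"
proof -
  have "(\<Inter>i::nat. if i = 0 then C else D) = C \<inter> D"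
    by (auto split: if_splits)
  then show ?thesis using club_INT[of "\<lambda>i. if i = 0 then C else D"] assms by simp
qed

text \<open>A Loewenheim-Skolem argument: take the ordinals closed under a bound for the witnesses
  that belong to parameters in the countable sets \<open>I b\<close>. It is used to pull
  counterexamples found anywhere in the tree down below the level under consideration.\<close>

lemma club_reflect:
  fixes Q :: "'i \<Rightarrow> omega1 \<Rightarrow> bool"
  assumes "\<And>b. countable (I b)"
  shows "\<exists>C. club C \<and> (\<forall>d\<in>C. islim d \<and>
    (\<forall>b<d. \<forall>i\<in>I b. (\<exists>a. Q i a) \<longrightarrow> (\<exists>a<d. Q i a)))"
proof -
  have "\<exists>h. \<forall>i\<in>I b. (\<exists>a. Q i a) \<longrightarrow> (\<exists>a<h. Q i a)" for b
  proof -
    have "countable ((\<lambda>i. SOME a. Q i a) ` I b)" using assms by simp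
    from countable_bounded_omega1[OF this] obtain h where "\<forall>i\<in>I b. (SOME a. Q i a) < h" by auto
    then show ?thesis by (metis someI_ex)
  qed
  then obtain h where h: "\<And>b i. i \<in> I b \<Longrightarrow> \<exists>a. Q i a \<Longrightarrow> \<exists>a<h b. Q i a" by metis
  show ?thesis
  proof (intro exI conjI)
    show "club {d. islim d \<and> (\<forall>b<d. h b < d)}" by (rule club_closure_points)
    show "\<forall>d\<in>{d. islim d \<and> (\<forall>b<d. h b < d)}. islim d \<and>
      (\<forall>b<d. \<forall>i\<in>I b. (\<exists>a. Q i a) \<longrightarrow> (\<exists>a<d. Q i a))"
      using h by (simp) (meson less_trans)
  qed
qed

lemma club_not_empty: "club C \<Longrightarrow> \<exists>d. d \<in> C"
  unfolding club_def by blast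

section \<open>Guessing subsets of \<open>omega1 \<times> nat\<close>\<close>

lemma ex_inj_omega1_nat: "\<exists>b :: omega1 \<times> nat \<Rightarrow> omega1. inj b"
proof -
  have inf: "infinite (UNIV :: omega1 set)" using uncountable_omega1 countable_finite by blast
  have "(card_of (UNIV :: nat set), card_of (UNIV :: omega1 set)) \<in> ordLeq"
    using inf infinite_iff_card_of_nat by blast
  then have "(card_of ((UNIV :: omega1 set) \<times> (UNIV :: nat set)), card_of (UNIV :: omega1 set)) \<in> ordLeq"
    using card_of_Times_infinite[OF inf UNIV_not_empty] ordIso_iff_ordLeq by blast
  then have "\<exists>f. inj_on f ((UNIV :: omega1 set) \<times> (UNIV :: nat set)) \<and> f ` (UNIV \<times> UNIV) \<subseteq> (UNIV :: omega1 set)"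
    using card_of_ordLeq by blast
  then show ?thesis by auto
qed

text \<open>Guesses are pulled back along an injection \<open>f\<close> of pairs into
  \<open>omega1\<close>. If \<open>a\<close> is closed under \<open>h\<close>, then \<open>f\<close>
  maps \<open>{..<a} \<times> UNIV\<close> into \<open>{..<a}\<close>, so the guessing club is
  intersected with the club of such \<open>a\<close>.\<close>

lemma diamond_star_times_nat:
  assumes diamond_star
  shows "\<exists>S :: omega1 \<Rightarrow> (omega1 \<times> nat) set set. (\<forall>a. countable (S a)) \<and>
    (\<forall>X. \<exists>C. club C \<and> (\<forall>a\<in>C. X \<inter> {..<a} \<times> UNIV \<in> S a))"
proof -
  obtain S :: "omega1 \<Rightarrow> omega1 set set"
    where S0: "\<forall>a. countable (S a) \<and> S a \<subseteq> Pow {..<a}"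
      and S1: "\<forall>X. \<exists>C. club C \<and> (\<forall>a\<in>C. X \<inter> {..<a} \<in> S a)"
    using assms unfolding diamond_star_def by (elim exE conjE)
  have S: "countable (S a)" "\<exists>C. club C \<and> (\<forall>a\<in>C. X \<inter> {..<a} \<in> S a)" for a X
    using S0 S1 by simp_all
  obtain f :: "omega1 \<times> nat \<Rightarrow> omega1" where f: "inj f" using ex_inj_omega1_nat by blast
  define S' where "S' a = (\<lambda>Y. {p \<in> {..<a} \<times> UNIV. f p \<in> Y}) ` S a" for a
  have "\<exists>h. \<forall>k. f (a, k) < h" for a
    using countable_bounded_omega1[of "range (\<lambda>k. f (a, k))"] by auto
  then have "\<exists>h. \<forall>a k. f (a, k) < h a" by (intro choice allI)
  then obtain h where h: "\<And>a k. f (a, k) < h a" by blast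
  show ?thesis
  proof (intro exI[of _ S'] conjI allI)
    show "countable (S' a)" for a unfolding S'_def using S(1) by simp
    fix X
    obtain C where C: "club C" "\<And>a. a \<in> C \<Longrightarrow> f ` X \<inter> {..<a} \<in> S a"
      using S(2)[of "f ` X"] by blast
    let ?D = "C \<inter> {d. islim d \<and> (\<forall>b<d. h b < d)}"
    have "X \<inter> {..<a} \<times> UNIV \<in> S' a" if "a \<in> ?D" for a
    proof -
      have "f p < a" if "p \<in> {..<a} \<times> UNIV" for p
        using that \<open>a \<in> ?D\<close> h[of "fst p" "snd p"] by (auto intro: less_trans)
      then have "X \<inter> {..<a} \<times> UNIV = {p \<in> {..<a} \<times> UNIV. f p \<in> f ` X \<inter> {..<a}}"
        using f by (auto simp: inj_image_mem_iff)
      then show ?thesis unfolding S'_def using C(2) that by blast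
    qed
    then show "\<exists>C. club C \<and> (\<forall>a\<in>C. X \<inter> {..<a} \<times> UNIV \<in> S' a)"
      using club_Int[OF C(1) club_closure_points[of h]] by blast
  qed
qed

text \<open>Diagonalisation: the candidate \<open>g k\<close> reads the \<open>k\<close>-th column
  of the \<open>k\<close>-th set in \<open>S a\<close>. If every candidate failed, with witnesses
  \<open>X k\<close> and \<open>C k\<close>, the \<open>X k\<close> could be merged as columns into
  one set \<open>Y\<close>. At a level in all the clubs the trace of \<open>Y\<close> is the
  \<open>k\<close>-th guess for some \<open>k\<close>, so \<open>g k\<close> guesses
  \<open>X k\<close> there after all.\<close>

lemma diamond_from_diamond_star:
  assumes diamond_star
  shows "\<exists>g :: omega1 \<Rightarrow> (omega1 \<times> nat) set. \<forall>X C. club C \<longrightarrow> (\<exists>a\<in>C. X \<inter> {..<a} \<times> UNIV = g a)"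
proof -
  obtain S :: "omega1 \<Rightarrow> (omega1 \<times> nat) set set"
    where S0: "\<forall>a. countable (S a)"
      and S1: "\<forall>X. \<exists>C. club C \<and> (\<forall>a\<in>C. X \<inter> {..<a} \<times> UNIV \<in> S a)"
    using diamond_star_times_nat[OF assms] by (elim exE conjE)
  have S: "countable (S a)" "\<exists>C. club C \<and> (\<forall>a\<in>C. X \<inter> {..<a} \<times> UNIV \<in> S a)" for a X
    using S0 S1 by simp_all
  define g where "g k a = {(b, m). (b, prod_encode (k, m)) \<in> from_nat_into (S a) k}" for k a
  have "\<exists>k. \<forall>X C. club C \<longrightarrow> (\<exists>a\<in>C. X \<inter> {..<a} \<times> UNIV = g k a)"
  proof (rule ccontr)
    assume "\<not> ?thesis"
    then obtain X C where XC: "\<And>k. club (C k)" "\<And>k a. a \<in> C k \<Longrightarrow> X k \<inter> {..<a} \<times> UNIV \<noteq> g k a"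
      by metis
    define Y where "Y = {(b, prod_encode (k, m)) | b k m. (b, m) \<in> X k}"
    obtain D where D: "club D" "\<And>a. a \<in> D \<Longrightarrow> Y \<inter> {..<a} \<times> UNIV \<in> S a"
      using S(2)[of Y] by blast
    obtain a where a: "a \<in> D" "\<And>k. a \<in> C k"
      using club_not_empty[OF club_Int[OF D(1) club_INT[of C, OF XC(1)]]] by blast
    obtain k where k: "Y \<inter> {..<a} \<times> UNIV = from_nat_into (S a) k"
      using from_nat_into_surj[OF S(1) D(2)[OF a(1)]] by metis
    have "X k \<inter> {..<a} \<times> UNIV = g k a"
      unfolding g_def k[symmetric] by (auto simp: Y_def)
    then show False using XC(2) a by blast
  qed
  then show ?thesis by blast
qed

section \<open>Weights of sequences\<close>

type_synonym node = "omega1 \<rightharpoonup> nat"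

definition lev :: "node \<Rightarrow> omega1" where "lev t = (THE a. dom t = {..<a})"

lemma lev_eq: "dom t = {..<a} \<Longrightarrow> lev t = a"
  unfolding lev_def by (rule the_equality) auto

abbreviation cut :: "node \<Rightarrow> omega1 \<Rightarrow> node" where "cut t a \<equiv> t |` {..<a}"

lemma dom_cut: "dom t = {..<a} \<Longrightarrow> dom (cut t b) = {..<min a b}"
  by auto

lemma cut_map_le: "cut t a \<subseteq>\<^sub>m t"
  by (auto simp: map_le_def)

lemma cut_mono: "a \<le> b \<Longrightarrow> cut t a \<subseteq>\<^sub>m cut t b"
  by (auto simp: map_le_def)

lemma map_le_eq_cut: "u \<subseteq>\<^sub>m t \<Longrightarrow> dom u = {..<a} \<Longrightarrow> u = cut t a"
  unfolding map_le_def by (rule ext) (metis domIff lessThan_iff restrict_in restrict_out)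

lemma map_le_dom_eq: "u \<subseteq>\<^sub>m t \<Longrightarrow> dom u = dom t \<Longrightarrow> u = t"
  by (metis map_le_antisym map_le_def)

lemma cut_cut: "cut (cut t a) b = cut t (min a b)"
  by (rule ext) (auto simp: restrict_map_def)

lemma cut_self: "dom t = {..<a} \<Longrightarrow> a \<le> b \<Longrightarrow> cut t b = t"
  using map_le_eq_cut[OF map_le_refl[of t]] by (simp add: map_le_dom_eq[OF cut_map_le] Int_absorb2)

definition wt :: "node \<Rightarrow> omega1 \<Rightarrow> real" where "wt t x = (1/2) ^ the (t x)"
definition wsummable :: "node \<Rightarrow> bool" where "wsummable t \<longleftrightarrow> wt t summable_on dom t"
definition weight :: "node \<Rightarrow> real" where "weight t = infsum (wt t) (dom t)"

lemma wt_pos: "0 < wt t x" unfolding wt_def by simp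
lemma wt_nonneg: "0 \<le> wt t x" unfolding wt_def by simp

lemma wt_cong: "u \<subseteq>\<^sub>m t \<Longrightarrow> x \<in> dom u \<Longrightarrow> wt u x = wt t x"
  unfolding wt_def map_le_def by simp

lemma wsummable_map_le: assumes "wsummable t" "u \<subseteq>\<^sub>m t" shows "wsummable u"
proof -
  have "wt t summable_on dom u"
    using assms unfolding wsummable_def
    by (meson map_le_implies_dom_le summable_on_subset)
  then show ?thesis unfolding wsummable_def
    using summable_on_cong[of "dom u" "wt u" "wt t"] wt_cong[OF assms(2)] by blast
qed

lemma weight_map_le_eq: "u \<subseteq>\<^sub>m t \<Longrightarrow> weight u = infsum (wt t) (dom u)"
  unfolding weight_def by (rule infsum_cong) (rule wt_cong)

lemma wsummable_on: "wsummable t \<Longrightarrow> A \<subseteq> dom t \<Longrightarrow> wt t summable_on A"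
  unfolding wsummable_def by (rule summable_on_subset)

lemma weight_diff: assumes "wsummable t" "u \<subseteq>\<^sub>m t"
  shows "weight t = weight u + infsum (wt t) (dom t - dom u)"
proof -
  have "weight t = infsum (wt t) (dom u \<union> (dom t - dom u))"
    unfolding weight_def using map_le_implies_dom_le[OF assms(2)] by (simp add: Un_absorb1)
  also have "\<dots> = infsum (wt t) (dom u) + infsum (wt t) (dom t - dom u)"
    by (rule infsum_Un_disjoint)
      (use assms map_le_implies_dom_le[OF assms(2)] in \<open>auto intro: wsummable_on\<close>)
  finally show ?thesis using weight_map_le_eq[OF assms(2)] by simp
qed

lemma weight_mono: "wsummable t \<Longrightarrow> u \<subseteq>\<^sub>m t \<Longrightarrow> weight u \<le> weight t"
  using weight_diff[of t u] infsum_nonneg[of "dom t - dom u" "wt t"] wt_nonneg by simp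

lemma sum_wt_le: assumes "wsummable t" "finite F" "F \<subseteq> dom t" shows "sum (wt t) F \<le> weight t"
proof -
  have "infsum (wt t) F \<le> infsum (wt t) (dom t)"
    by (rule infsum_mono2) (use assms wt_nonneg in \<open>auto intro: wsummable_on\<close>)
  then show ?thesis using assms(2) unfolding weight_def by simp
qed

lemma weight_strict: assumes "wsummable t" "u \<subset>\<^sub>m t" shows "weight u < weight t"
proof -
  have le: "u \<subseteq>\<^sub>m t" and ne: "dom u \<noteq> dom t"
    using assms(2) map_le_dom_eq unfolding strict_map_le_def by auto
  then obtain x where x: "x \<in> dom t - dom u" using map_le_implies_dom_le by blast
  have "infsum (wt t) {x} \<le> infsum (wt t) (dom t - dom u)"
    by (rule infsum_mono2) (use assms wt_nonneg x in \<open>auto intro: wsummable_on\<close>)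
  then have "0 < infsum (wt t) (dom t - dom u)" using wt_pos[of t x] by simp
  then show ?thesis using weight_diff[OF assms(1) le] by simp
qed

text \<open>Only coordinates below \<open>b\<close> change, so the weight changes by the difference
  of the two initial parts. Estimates for a branch thus carry over to every node obtained by
  replacing an initial part of it.\<close>

lemma weight_graft:
  assumes "wsummable v" "wsummable u" "dom u = {..<b}" "{..<b} \<subseteq> dom v"
  shows "wsummable (v ++ u)" "weight (v ++ u) = weight u + (weight v - weight (cut v b))"
proof -
  let ?g = "v ++ u"
  have dom: "dom ?g = {..<b} \<union> (dom v - {..<b})" using assms by auto
  have eq: "wt ?g x = wt v x" if "x \<in> dom v - {..<b}" for x
    using that assms(3) unfolding wt_def by (metis Diff_iff map_add_dom_app_simps(3))
  have "wt v summable_on (dom v - {..<b})" using assms(1) by (rule wsummable_on) blast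
  then have s2: "wt ?g summable_on (dom v - {..<b})"
    using summable_on_cong[of "dom v - {..<b}" "wt ?g" "wt v"] eq by blast
  have le: "u \<subseteq>\<^sub>m ?g" by simp
  have eq1: "wt u x = wt ?g x" if "x \<in> {..<b}" for x using wt_cong[OF le] that assms(3) by simp
  then have s1: "wt ?g summable_on {..<b}"
    using assms(2,3) summable_on_cong[of "{..<b}" "wt u" "wt ?g"] unfolding wsummable_def by metis
  show w: "wsummable ?g" unfolding wsummable_def dom
    by (rule summable_on_Un_disjoint[OF s1 s2]) auto
  have "weight ?g = weight u + infsum (wt ?g) (dom v - {..<b})"
  proof -
    have "dom ?g - dom u = dom v - {..<b}" using dom assms(3) by auto
    then show ?thesis using weight_diff[OF w le] by simp
  qed
  also have "infsum (wt ?g) (dom v - {..<b}) = infsum (wt v) (dom v - {..<b})"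
    by (rule infsum_cong) (rule eq)
  also have "\<dots> = weight v - weight (cut v b)"
  proof -
    have "dom v - dom (cut v b) = dom v - {..<b}" by auto
    then show ?thesis using weight_diff[OF assms(1) cut_map_le[of v b]] by simp
  qed
  finally show "weight ?g = weight u + (weight v - weight (cut v b))" by simp
qed

lemma weight_append:
  assumes "wsummable t" "dom t = {..<a}"
  shows "wsummable (t(a \<mapsto> k))" "weight (t(a \<mapsto> k)) = weight t + (1/2) ^ k"
proof -
  let ?g = "t(a \<mapsto> k)"
  have le: "t \<subseteq>\<^sub>m ?g" using assms(2) by (auto simp: map_le_def)
  have dom: "dom ?g = insert a (dom t)" by simp
  have "wt ?g summable_on dom t"
    using assms(1) wt_cong[OF le] summable_on_cong[of "dom t" "wt t" "wt ?g"] unfolding wsummable_def by metis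
  then show w: "wsummable ?g" unfolding wsummable_def dom by (simp add: summable_on_insert_iff)
  have "dom ?g - dom t = {a}" using assms(2) by auto
  then show "weight ?g = weight t + (1/2) ^ k" using weight_diff[OF w le] by (simp add: wt_def)
qed

lemma weight_empty: "weight Map.empty = 0" "wsummable Map.empty"
  unfolding weight_def wsummable_def by auto

text \<open>A finite set \<open>F\<close> of coordinates already contributes more than
  \<open>q\<close>, and any part of \<open>t\<close> long enough to contain \<open>F\<close>
  inherits this.\<close>

lemma weight_lower_semicontinuous:
  assumes "wsummable t" "dom t = {..<a}" "{..<a} \<noteq> {}" "q < weight t"
  shows "\<exists>b<a. \<forall>w. cut t b \<subset>\<^sub>m w \<longrightarrow> w \<subseteq>\<^sub>m t \<longrightarrow> (\<exists>b'. dom w = {..<b'}) \<longrightarrow> q < weight w"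
proof -
  obtain F where F: "finite F" "F \<subseteq> dom t" "dist (sum (wt t) F) (infsum (wt t) (dom t)) \<le> (weight t - q) / 2"
    using infsum_finite_approximation[of "wt t" "dom t" "(weight t - q)/2"] assms(1,4)
    unfolding wsummable_def by auto
  then have "weight t - sum (wt t) F \<le> (weight t - q) / 2"
    using abs_ge_minus_self[of "sum (wt t) F - weight t"] unfolding weight_def[symmetric] dist_real_def
    by (simp only: minus_diff_eq)
  moreover have "(weight t - q) / 2 < weight t - q" using assms(4) by simp
  ultimately have Fq: "q < sum (wt t) F" by linarith
  obtain z where "z < a" using assms(3) by auto
  \<comment> \<open>Inserting \<open>z\<close> keeps the maximum meaningful when \<open>F\<close> is
    empty.\<close>
  define b where "b = Max (insert z F)"
  have b: "b < a" using F(1,2) \<open>z < a\<close> assms(2) unfolding b_def by (auto simp: Max_in)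
  have Fb: "x \<le> b" if "x \<in> F" for x using F(1) that unfolding b_def by simp
  have "q < weight w" if w: "cut t b \<subset>\<^sub>m w" "w \<subseteq>\<^sub>m t" "dom w = {..<b'}" for w b'
  proof -
    have "dom (cut t b) = {..<b}" using dom_cut[OF assms(2), of b] b by (simp only: min.absorb4)
    then have "{..<b} \<subset> {..<b'}"
      using w map_le_dom_eq map_le_implies_dom_le unfolding strict_map_le_def by (metis psubsetI)
    then have "b < b'" by (metis lessThan_strict_subset_iff)
    then have "F \<subseteq> dom w" using w(3) Fb by (auto intro: le_less_trans)
    then have "sum (wt w) F \<le> weight w" using sum_wt_le wsummable_map_le assms(1) w(2) F(1) by blast
    moreover have "sum (wt w) F = sum (wt t) F"
      by (rule sum.cong) (use \<open>F \<subseteq> dom w\<close> wt_cong[OF w(2)] in auto)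
    ultimately show ?thesis using Fq by simp
  qed
  then show ?thesis using b by blast
qed

lemma weight_limit_approx:
  assumes "wsummable t" "dom t = {..<a}" "islim a" "q < weight t" "b0 < a"
  shows "\<exists>b<a. b0 \<le> b \<and> q < weight (cut t b)"
proof -
  obtain b where b: "b < a"
    "\<And>w b'. cut t b \<subset>\<^sub>m w \<Longrightarrow> w \<subseteq>\<^sub>m t \<Longrightarrow> dom w = {..<b'} \<Longrightarrow> q < weight w"
    using weight_lower_semicontinuous[OF assms(1,2) _ assms(4)] assms(3) unfolding islim_def by blast
  \<comment> \<open>Semicontinuity speaks only of parts strictly longer than \<open>cut t b\<close>,
    so the cut is made at some \<open>d\<close> above both \<open>b\<close> and
    \<open>b0\<close>.\<close>
  obtain d where d: "max b b0 < d" "d < a" using assms(3,5) b(1) unfolding islim_def by (metis max_def)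
  have "cut t b \<noteq> cut t d"
  proof -
    have "b \<in> dom (cut t d)" "b \<notin> dom (cut t b)" using d b(1) assms(2) by auto
    then show ?thesis by metis
  qed
  then have "cut t b \<subset>\<^sub>m cut t d" using d(1) cut_mono[OF less_imp_le, of b d t] unfolding strict_map_le_def by simp
  then have "q < weight (cut t d)" using b(2) cut_map_le dom_cut[OF assms(2)] by blast
  then show ?thesis using d by (metis less_imp_le max_less_iff_conj)
qed

text \<open>At a limit every finite set of coordinates lies in a proper initial part, so a common
  bound on the weights of these parts bounds all finite sums.\<close>

lemma wsummable_limit:
  assumes "dom t = {..<a}" "islim a" "\<And>b. b < a \<Longrightarrow> wsummable (cut t b) \<and> weight (cut t b) \<le> M"
  shows "wsummable t" "weight t \<le> M"
proof -
  have bd: "sum (wt t) F \<le> M" if F: "finite F" "F \<subseteq> dom t" for F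
  proof -
    obtain z where "z < a" using assms(2) unfolding islim_def by auto
    have "Max (insert z F) < a" using F \<open>z < a\<close> assms(1) by (auto simp: Max_in)
    then obtain b where b: "Max (insert z F) < b" "b < a" using assms(2) unfolding islim_def by blast
    have sub: "F \<subseteq> dom (cut t b)" using F b assms(1) by (auto simp: dom_cut) 
    have "sum (wt t) F = sum (wt (cut t b)) F"
      using sub by (intro sum.cong refl wt_cong[OF cut_map_le, symmetric]) blast
    then show ?thesis using sum_wt_le[OF _ F(1) sub] assms(3)[OF b(2)] by linarith
  qed
  show w: "wsummable t" unfolding wsummable_def
    by (rule nonneg_bdd_above_summable_on) (auto intro!: wt_nonneg bdd_aboveI2 bd)
  show "weight t \<le> M" unfolding weight_def
    by (rule infsum_le_finite_sums) (use w bd in \<open>auto simp: wsummable_def\<close>)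
qed

section \<open>Trees determined by branches at limit levels\<close>

definition upto_map :: "omega1 \<Rightarrow> (omega1 \<Rightarrow> nat) \<Rightarrow> node" where
  "upto_map d f = (\<lambda>x. if x < d then Some (f x) else None)"

lemma dom_upto_map [simp]: "dom (upto_map d f) = {..<d}"
  unfolding upto_map_def by (auto split: if_splits)

text \<open>The chosen branches are a parameter: \<open>X d s\<close> is the branch of height
  \<open>d\<close> with index \<open>s\<close>, read only at limit \<open>d\<close>. Asking for
  agreement at every limit up to the length of \<open>t\<close> makes the set closed under cuts and
  under replacing initial parts.\<close>

definition Tree :: "(omega1 \<Rightarrow> bool \<Rightarrow> omega1 \<Rightarrow> nat) \<Rightarrow> node set" where
  "Tree X = {t. \<exists>a. dom t = {..<a} \<and>
     (\<forall>d\<le>a. islim d \<longrightarrow> (\<exists>b<d. \<exists>s. \<forall>x. b \<le> x \<and> x < d \<longrightarrow> t x = Some (X d s x)))}"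

lemma Tree_dom: assumes "t \<in> Tree X" shows "dom t = {..<lev t}"
  using assms lev_eq unfolding Tree_def by blast

lemma Tree_limit:
  assumes "t \<in> Tree X" "islim d" "d \<le> lev t"
  shows "\<exists>b<d. \<exists>s. \<forall>x. b \<le> x \<and> x < d \<longrightarrow> t x = Some (X d s x)"
proof -
  obtain a where a: "dom t = {..<a}"
    "\<forall>d\<le>a. islim d \<longrightarrow> (\<exists>b<d. \<exists>s. \<forall>x. b \<le> x \<and> x < d \<longrightarrow> t x = Some (X d s x))"
    using assms(1) unfolding Tree_def by blast
  then show ?thesis using assms lev_eq by metis
qed

lemma TreeI:
  assumes "dom t = {..<a}"
    "\<And>d. d \<le> a \<Longrightarrow> islim d \<Longrightarrow> \<exists>b<d. \<exists>s. \<forall>x. b \<le> x \<and> x < d \<longrightarrow> t x = Some (X d s x)"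
  shows "t \<in> Tree X"
  using assms unfolding Tree_def by blast

lemma lev_cut: "t \<in> Tree X \<Longrightarrow> lev (cut t b) = min (lev t) b"
  using dom_cut[OF Tree_dom] lev_eq by blast

lemma Tree_cut: assumes "t \<in> Tree X" shows "cut t b \<in> Tree X"
proof (rule TreeI)
  show "dom (cut t b) = {..<min (lev t) b}" using dom_cut[OF Tree_dom[OF assms]] .
  fix d assume d: "d \<le> min (lev t) b" "islim d"
  then obtain e s where "e < d" "\<forall>x. e \<le> x \<and> x < d \<longrightarrow> t x = Some (X d s x)"
    using Tree_limit[OF assms, of d] by auto
  then show "\<exists>e<d. \<exists>s. \<forall>x. e \<le> x \<and> x < d \<longrightarrow> cut t b x = Some (X d s x)"
    using d by (metis lessThan_iff less_le_trans min.boundedE restrict_in)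
qed

lemma islim_zero: "islim d \<Longrightarrow> \<exists>z<d. {..<z} = {}"
proof -
  assume d: "islim d"
  obtain z :: omega1 where z: "{..<z} = {}" using ex_zero_omega1 by blast
  obtain y where "y < d" using d unfolding islim_def by auto
  moreover have "z \<le> y" using z by (metis empty_iff lessThan_iff not_less)
  ultimately show ?thesis using z by (metis le_less_trans)
qed

lemma Tree_empty: "Map.empty \<in> Tree X"
proof -
  obtain z :: omega1 where z: "{..<z} = {}" using ex_zero_omega1 by blast
  show ?thesis
  proof (rule TreeI)
    show "dom Map.empty = {..<z}" using z by simp
    fix d assume "d \<le> z" "islim d"
    then have "{..<d} \<subseteq> {..<z}" by auto
    then show "\<exists>b<d. \<exists>s. \<forall>x. b \<le> x \<and> x < d \<longrightarrow> None = Some (X d s x)"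
      using \<open>islim d\<close> z unfolding islim_def by simp
  qed
qed

text \<open>Limits up to \<open>lev u\<close> are controlled by \<open>u\<close>. At later limits
  agreement with a branch is a matter of tails, and there the tail is that of
  \<open>v\<close>.\<close>

lemma Tree_graft:
  assumes "u \<in> Tree X" "v \<in> Tree X" "lev u \<le> lev v"
  shows "v ++ u \<in> Tree X" "lev (v ++ u) = lev v"
proof -
  note du = Tree_dom[OF assms(1)] and dv = Tree_dom[OF assms(2)]
  have dom: "dom (v ++ u) = {..<lev v}" using du dv assms(3) by auto
  then show "lev (v ++ u) = lev v" by (rule lev_eq)
  show "v ++ u \<in> Tree X"
  proof (rule TreeI[OF dom])
    fix d assume d: "d \<le> lev v" "islim d"
    show "\<exists>b<d. \<exists>s. \<forall>x. b \<le> x \<and> x < d \<longrightarrow> (v ++ u) x = Some (X d s x)"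
    proof (cases "d \<le> lev u")
      case True
      then obtain b s where b: "b < d" "\<forall>x. b \<le> x \<and> x < d \<longrightarrow> u x = Some (X d s x)"
        using Tree_limit[OF assms(1) d(2)] by blast
      then have "\<forall>x. b \<le> x \<and> x < d \<longrightarrow> (v ++ u) x = Some (X d s x)" by simp
      then show ?thesis using b(1) by blast
    next
      case False
      obtain b s where b: "b < d" "\<forall>x. b \<le> x \<and> x < d \<longrightarrow> v x = Some (X d s x)"
        using Tree_limit[OF assms(2) d(2,1)] by blast
      have "(v ++ u) x = v x" if "lev u \<le> x" for x
        using that du by (metis lessThan_iff map_add_dom_app_simps(3) not_less)
      then have "\<forall>x. max b (lev u) \<le> x \<and> x < d \<longrightarrow> (v ++ u) x = Some (X d s x)" using b(2) by simp
      then show ?thesis using b(1) False by (metis max_less_iff_conj not_less)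
    qed
  qed
qed

text \<open>The new level \<open>b\<close> is a successor, so every limit to be checked is already
  at most \<open>lev t\<close>.\<close>

lemma Tree_append:
  assumes "t \<in> Tree X" "{..<b} = {..lev t}"
  shows "t(lev t \<mapsto> k) \<in> Tree X" "lev (t(lev t \<mapsto> k)) = b"
proof -
  have dom: "dom (t(lev t \<mapsto> k)) = {..<b}"
    using Tree_dom[OF assms(1)] assms(2) by (auto simp: ivl_disj_un_singleton(2)[symmetric])
  then show "lev (t(lev t \<mapsto> k)) = b" by (rule lev_eq)
  show "t(lev t \<mapsto> k) \<in> Tree X"
  proof (rule TreeI[OF dom])
    fix d assume d: "d \<le> b" "islim d"
    have "d \<noteq> b" using islim_not_suc[OF d(2)] assms(2) by blast
    with d(1) have "d \<in> {..<b}" by simp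
    then have "d \<le> lev t" using assms(2) by auto
    then obtain e s where e: "e < d" "\<forall>x. e \<le> x \<and> x < d \<longrightarrow> t x = Some (X d s x)"
      using Tree_limit[OF assms(1) d(2)] by blast
    then have "\<forall>x. e \<le> x \<and> x < d \<longrightarrow> (t(lev t \<mapsto> k)) x = Some (X d s x)"
      using \<open>d \<le> lev t\<close> by auto
    then show "\<exists>e<d. \<exists>s. \<forall>x. e \<le> x \<and> x < d \<longrightarrow> (t(lev t \<mapsto> k)) x = Some (X d s x)"
      using e(1) by blast
  qed
qed

lemma Tree_cong:
  assumes "\<And>d. d \<le> a \<Longrightarrow> X d = Y d" "dom t = {..<a}"
  shows "t \<in> Tree X \<longleftrightarrow> t \<in> Tree Y"
proof -
  have "t \<in> Tree Y" if "\<And>d. d \<le> a \<Longrightarrow> X d = Y d" "t \<in> Tree X" for X Y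
  proof (rule TreeI[OF assms(2)])
    fix d assume "d \<le> a" "islim d"
    then show "\<exists>b<d. \<exists>s. \<forall>x. b \<le> x \<and> x < d \<longrightarrow> t x = Some (Y d s x)"
      using Tree_limit[OF that(2)] lev_eq[OF assms(2)] that(1) by metis
  qed
  then show ?thesis using assms(1) by metis
qed

text \<open>The invariant that the recursion maintains. Only proper cuts are required to be nodes,
  since the condition at \<open>d\<close> itself holds automatically.\<close>

definition branch_ok :: "(omega1 \<Rightarrow> bool \<Rightarrow> omega1 \<Rightarrow> nat) \<Rightarrow> omega1 \<Rightarrow> bool" where
  "branch_ok X d \<longleftrightarrow> (islim d \<longrightarrow>
     (\<forall>s. (\<forall>b<d. cut (upto_map d (X d s)) b \<in> Tree X) \<and> wsummable (upto_map d (X d s))))"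

text \<open>Eventual agreement means that a node on a limit level is a chosen branch with an initial
  part replaced. Summability, countability of levels and the transfer of genericity to all nodes
  rest on this form.\<close>

lemma Tree_level_lim:
  assumes "t \<in> Tree X" "islim (lev t)"
  shows "\<exists>s. \<exists>b<lev t. t = upto_map (lev t) (X (lev t) s) ++ cut t b"
proof -
  obtain b s where b: "b < lev t" "\<forall>x. b \<le> x \<and> x < lev t \<longrightarrow> t x = Some (X (lev t) s x)"
    using Tree_limit[OF assms(1,2)] by blast
  have "t x = (upto_map (lev t) (X (lev t) s) ++ cut t b) x" for x
  proof (cases "x < b")
    case True
    then have "cut t b x = t x" "x \<in> dom t" using b(1) Tree_dom[OF assms(1)] by auto
    then show ?thesis by (metis domD map_add_find_right)
  next
    case False
    then have "cut t b x = None" by simp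
    moreover have "t x = upto_map (lev t) (X (lev t) s) x"
      using False b(2) Tree_dom[OF assms(1)] unfolding upto_map_def by (auto simp: dom_def)
    ultimately show ?thesis by (simp add: map_add_def)
  qed
  then show ?thesis using b(1) by blast
qed

lemma branch_ok_Tree:
  assumes "branch_ok X d" "islim d" shows "upto_map d (X d s) \<in> Tree X"
proof (rule TreeI)
  show "dom (upto_map d (X d s)) = {..<d}" by simp
  fix e assume e: "e \<le> d" "islim e"
  show "\<exists>b<e. \<exists>s'. \<forall>x. b \<le> x \<and> x < e \<longrightarrow> upto_map d (X d s) x = Some (X e s' x)"
  proof (cases "e = d")
    case True
    obtain z where "z < d" using assms(2) unfolding islim_def by auto
    then show ?thesis using True unfolding upto_map_def by auto
  next
    case False
    then have "e < d" using e by simp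
    have t: "cut (upto_map d (X d s)) e \<in> Tree X" using assms \<open>e < d\<close> unfolding branch_ok_def by blast
    have "lev (cut (upto_map d (X d s)) e) = e"
      by (rule lev_eq) (use \<open>e < d\<close> in auto)
    then obtain b s' where b: "b < e" "\<forall>x. b \<le> x \<and> x < e \<longrightarrow> cut (upto_map d (X d s)) e x = Some (X e s' x)"
      using Tree_limit[OF t e(2)] by auto
    then show ?thesis by (metis lessThan_iff restrict_in)
  qed
qed

lemma Tree_suc:
  assumes "t \<in> Tree X" "{..<lev t} = {..a}"
  shows "\<exists>k. t = (cut t a)(a \<mapsto> k) \<and> lev (cut t a) = a"
proof -
  have "a < lev t" using assms(2) by auto
  then obtain k where k: "t a = Some k" using Tree_dom[OF assms(1)] by blast
  have "t x = ((cut t a)(a \<mapsto> k)) x" for x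
  proof -
    consider "x < a" | "x = a" | "a < x" by fastforce
    then show ?thesis
    proof cases
      case 3
      then have "x \<notin> dom t" using Tree_dom[OF assms(1)] assms(2) by auto
      then show ?thesis using 3 by (simp add: domIff)
    qed (use k in auto)
  qed
  moreover have "lev (cut t a) = a" using lev_cut[OF assms(1)] \<open>a < lev t\<close> by simp
  ultimately show ?thesis by blast
qed

text \<open>Induction on the level: a successor adds one term, and at a limit the node is a graft of
  a summable initial part onto a summable branch.\<close>

lemma Tree_wsummable:
  assumes "t \<in> Tree X" "\<And>d. d \<le> lev t \<Longrightarrow> branch_ok X d"
  shows "wsummable t"
  using assms
proof (induction "lev t" arbitrary: t rule: less_induct)
  case less
  have cut: "wsummable (cut t b)" if "b < lev t" for b
  proof (rule less.hyps)
    show "lev (cut t b) < lev t" using lev_cut[OF less.prems(1)] that by simp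
    show "cut t b \<in> Tree X" using Tree_cut[OF less.prems(1)] .
    show "branch_ok X d" if "d \<le> lev (cut t b)" for d
      using less.prems(2) that lev_cut[OF less.prems(1)] by simp
  qed
  consider "{..<lev t} = {}" | a where "{..<lev t} = {..a}" | "islim (lev t)"
    using omega1_cases by blast
  then show ?case
  proof cases
    case 1
    then have "t = Map.empty" using Tree_dom[OF less.prems(1)] by simp
    then show ?thesis using weight_empty by simp
  next
    case (2 a)
    then have "a < lev t" by auto
    obtain k where k: "t = (cut t a)(a \<mapsto> k)" "lev (cut t a) = a" using Tree_suc[OF less.prems(1) 2] by blast
    have "dom (cut t a) = {..<a}" using Tree_dom[OF Tree_cut[OF less.prems(1)]] k(2) by metis
    then show ?thesis using weight_append(1)[OF cut[OF \<open>a < lev t\<close>]] k(1) by metis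
  next
    case 3
    obtain s b where b: "b < lev t" "t = upto_map (lev t) (X (lev t) s) ++ cut t b"
      using Tree_level_lim[OF less.prems(1) 3] by blast
    have "wsummable (upto_map (lev t) (X (lev t) s))" using less.prems(2) 3 unfolding branch_ok_def by blast
    moreover have "dom (cut t b) = {..<b}" using b(1) Tree_dom[OF less.prems(1)] by auto
    ultimately have "wsummable (upto_map (lev t) (X (lev t) s) ++ cut t b)"
      using weight_graft(1)[OF _ cut[OF b(1)]] b(1) by auto
    then show ?thesis using b(2) by simp
  qed
qed

lemma level_eq_lev: "level (Tree X) a = {t \<in> Tree X. lev t = a}"
  unfolding level_def using Tree_dom lev_eq by blast

text \<open>A node on a limit level is determined by one of two branches and an initial part from
  the countably many lower levels.\<close>

lemma Tree_countable_level: "countable (level (Tree X) a)"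
proof (induction a rule: less_induct)
  case (less a)
  consider "{..<a} = {}" | b where "{..<a} = {..b}" | "islim a"
    using omega1_cases by blast
  then show ?case
  proof cases
    case 1
    then have "level (Tree X) a \<subseteq> {Map.empty}" unfolding level_def by auto
    then show ?thesis by (rule countable_subset) simp
  next
    case (2 b)
    then have "b < a" by auto
    have "level (Tree X) a \<subseteq> (\<lambda>(t, k). t(b \<mapsto> k)) ` (level (Tree X) b \<times> UNIV)"
    proof
      fix t assume "t \<in> level (Tree X) a"
      then have t: "t \<in> Tree X" "lev t = a" by (simp_all add: level_eq_lev)
      then obtain k where "t = (cut t b)(b \<mapsto> k)" "lev (cut t b) = b" using Tree_suc 2 by blast
      then show "t \<in> (\<lambda>(t, k). t(b \<mapsto> k)) ` (level (Tree X) b \<times> UNIV)"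
        using Tree_cut[OF t(1), of b] by (intro image_eqI[of _ _ "(cut t b, k)"]) (auto simp: level_eq_lev)
    qed
    then show ?thesis by (rule countable_subset) (simp add: less[OF \<open>b < a\<close>])
  next
    case 3
    have "level (Tree X) a \<subseteq> (\<lambda>(t, s). upto_map a (X a s) ++ t) ` ((\<Union>b\<in>{..<a}. level (Tree X) b) \<times> UNIV)"
    proof
      fix t assume "t \<in> level (Tree X) a"
      then have t: "t \<in> Tree X" "lev t = a" by (simp_all add: level_eq_lev)
      then obtain s b where b: "b < a" "t = upto_map a (X a s) ++ cut t b" using Tree_level_lim 3 by blast
      have "cut t b \<in> level (Tree X) b"
        using Tree_cut[OF t(1)] lev_cut[OF t(1)] t(2) b(1) by (simp add: level_eq_lev)
      then show "t \<in> (\<lambda>(t, s). upto_map a (X a s) ++ t) ` ((\<Union>b\<in>{..<a}. level (Tree X) b) \<times> UNIV)"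
        using b by (intro image_eqI[of _ _ "(cut t b, s)"]) auto
    qed
    moreover have "countable ((\<Union>b\<in>{..<a}. level (Tree X) b) \<times> (UNIV :: bool set))"
      using less countable_below_omega1 by (intro countable_SIGMA countable_UN) auto
    ultimately show ?thesis by (meson countable_image countable_subset)
  qed
qed

text \<open>Extensions can be made arbitrarily cheap. At a successor a large number is appended; at
  a limit the tail of a chosen branch is used, starting so high that less than \<open>e/2\<close> of
  its weight remains.\<close>

lemma Tree_extend:
  assumes "u \<in> Tree X" "lev u \<le> a" "\<And>d. d \<le> a \<Longrightarrow> branch_ok X d" "0 < (e :: real)"
  shows "\<exists>v\<in>Tree X. lev v = a \<and> u \<subseteq>\<^sub>m v \<and> weight v < weight u + e"
  using assms(2-4)
proof (induction a arbitrary: e rule: less_induct)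
  case (less a)
  show ?case
  proof (cases "lev u = a")
    case True
    then show ?thesis using assms(1) less.prems by auto
  next
    case False
    then have ua: "lev u < a" using less.prems by simp
    consider "{..<a} = {}" | b where "{..<a} = {..b}" | "islim a"
      using omega1_cases by blast
    then show ?thesis
    proof cases
      case 1
      then show ?thesis using ua by auto
    next
      case (2 b)
      then have ub: "lev u \<le> b" and ba: "b < a" using ua by auto
      obtain v where v: "v \<in> Tree X" "lev v = b" "u \<subseteq>\<^sub>m v" "weight v < weight u + e/2"
        using less.IH[OF ba ub, of "e/2"] less.prems ba by (meson half_gt_zero less_imp_le order_trans)
      obtain k :: nat where k: "(1/2 :: real) ^ k < e/2"
        using real_arch_pow_inv[of "e/2" "1/2"] less.prems by auto
      have dv: "dom v = {..<b}" using Tree_dom[OF v(1)] v(2) by simp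
      have "wsummable v" using Tree_wsummable[OF v(1)] v(2) less.prems(2) ba by simp
      then have "weight (v(b \<mapsto> k)) < weight u + e" using weight_append(2)[OF _ dv, of k] k v(4) by simp
      moreover have "v(b \<mapsto> k) \<in> Tree X" "lev (v(b \<mapsto> k)) = a"
        using Tree_append[OF v(1)] v(2) 2 by metis+
      moreover have "u \<subseteq>\<^sub>m v(b \<mapsto> k)" using v(3) dv by (auto simp: map_le_def dom_def)
      ultimately show ?thesis by blast
    next
      case 3
      let ?B = "upto_map a (X a True)"
      have g: "branch_ok X a" using less.prems by simp
      have B: "?B \<in> Tree X" "wsummable ?B" using branch_ok_Tree[OF g 3] g 3 unfolding branch_ok_def by blast+
      have lB: "lev ?B = a" by (rule lev_eq) simp
      obtain b where b: "b < a" "lev u \<le> b" "weight ?B - e/2 < weight (cut ?B b)"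
        using weight_limit_approx[OF B(2) dom_upto_map 3 _ ua, of "weight ?B - e/2"] less.prems(3) by auto
      obtain v where v: "v \<in> Tree X" "lev v = b" "u \<subseteq>\<^sub>m v" "weight v < weight u + e/2"
        using less.IH[OF b(1,2), of "e/2"] less.prems b(1) by (meson half_gt_zero less_imp_le order_trans)
      have dv: "dom v = {..<b}" using Tree_dom[OF v(1)] v(2) by simp
      have "wsummable v" using Tree_wsummable[OF v(1)] v(2) less.prems(2) b(1) by simp
      then have "weight (?B ++ v) = weight v + (weight ?B - weight (cut ?B b))"
        using weight_graft(2)[OF B(2) _ dv] b(1) by auto
      then have "weight (?B ++ v) < weight u + e" using v(4) b(3) by simp
      moreover have "?B ++ v \<in> Tree X" "lev (?B ++ v) = a"
        using Tree_graft[OF v(1) B(1)] v(2) b(1) lB by simp_all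
      moreover have "u \<subseteq>\<^sub>m ?B ++ v" using v(3) map_le_trans by force
      ultimately show ?thesis by blast
    qed
  qed
qed

section \<open>Generic pairs of branches\<close>

text \<open>The Rasiowa-Sikorski construction for countably many dense sets. The empty family is
  separated because the enumeration \<open>from_nat_into\<close> needs a nonempty set.\<close>

lemma generic_sequence:
  assumes "countable \<D>" "cond q0"
    "\<And>D q. D \<in> \<D> \<Longrightarrow> cond q \<Longrightarrow> \<exists>q'. cond q' \<and> extends q' q \<and> q' \<in> D"
  shows "\<D> = {} \<or> (\<exists>f :: nat \<Rightarrow> 'q. (\<forall>i. cond (f i) \<and> extends (f (Suc i)) (f i)) \<and> (\<forall>D\<in>\<D>. \<exists>i. f i \<in> D))"
proof (cases "\<D> = {}")
  case False
  have "\<exists>f. \<forall>n. cond (f n) \<and> (extends (f (Suc n)) (f n) \<and> f (Suc n) \<in> from_nat_into \<D> n)"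
  proof (rule dependent_nat_choice)
    show "\<exists>x. cond x" using assms(2) by blast
    fix x n assume "cond x"
    then show "\<exists>y. cond y \<and> (extends y x \<and> y \<in> from_nat_into \<D> n)"
      using assms(3)[OF from_nat_into[OF False]] by blast
  qed
  then obtain f where f: "\<And>n. cond (f n)" "\<And>n. extends (f (Suc n)) (f n)" "\<And>n. f (Suc n) \<in> from_nat_into \<D> n"
    by blast
  have "\<exists>i. f i \<in> D" if "D \<in> \<D>" for D
    using from_nat_into_surj[OF assms(1) that] f(3) by metis
  then show ?thesis using f by blast
qed simp

type_synonym npair = "bool \<Rightarrow> node"

abbreviation pcut :: "npair \<Rightarrow> omega1 \<Rightarrow> npair" where "pcut p b \<equiv> (\<lambda>s. cut (p s) b)"

text \<open>A pair of nodes on the same level is a function on \<^typ>\<open>bool\<close>. \<open>E\<close> will consist of the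
  declared pairs, which make up the closed discrete set that witnesses the failure of countable
  metacompactness; the generic pairs are built so that they extend no member of \<open>E\<close>.\<close>

definition avoids :: "npair set \<Rightarrow> npair \<Rightarrow> bool" where
  "avoids E p \<longleftrightarrow> (\<forall>b. pcut p b \<notin> E)"

text \<open>A forcing statement: the condition \<open>(p, e)\<close> puts every strictly longer
  admissible pair of nodes of \<open>T\<close> into \<open>G\<close>.\<close>

definition captured :: "node set \<Rightarrow> npair set \<Rightarrow> npair set \<Rightarrow> npair \<Rightarrow> real \<Rightarrow> bool" where
  "captured T E G p e \<longleftrightarrow> (\<forall>p'. (\<forall>s. p' s \<in> T \<and> p s \<subset>\<^sub>m p' s \<and> weight (p' s) < weight (p s) + e) \<longrightarrow>
     (\<exists>a. \<forall>s. lev (p' s) = a) \<longrightarrow> avoids E p' \<longrightarrow> p' \<in> G)"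

definition split_pair :: "npair \<Rightarrow> bool" where
  "split_pair p \<longleftrightarrow> (\<exists>d. islim d \<and> (\<forall>s. dom (p s) = {..<d}) \<and>
     (\<forall>b<d. \<exists>x. b \<le> x \<and> x < d \<and> p True x \<noteq> p False x))"

definition below :: "node set \<Rightarrow> omega1 \<Rightarrow> node set" where
  "below T d = {t \<in> T. lev t < d}"

definition decided :: "omega1 \<Rightarrow> node set \<Rightarrow> node set \<Rightarrow> node \<Rightarrow> bool" where
  "decided d T A v \<longleftrightarrow> (\<forall>b<d. \<exists>x. b < x \<and> x < d \<and> cut v x \<in> A) \<or>
     (\<exists>b<d. \<exists>e>0. weight v < weight (cut v b) + e \<and> (\<forall>w\<in>A \<inter> T. cut v b \<subset>\<^sub>m w \<longrightarrow> weight (cut v b) + e \<le> weight w))"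

definition outside :: "omega1 \<Rightarrow> npair set \<Rightarrow> npair \<Rightarrow> bool" where
  "outside d G p \<longleftrightarrow> (\<forall>b<d. \<exists>x. b < x \<and> x < d \<and> pcut p x \<notin> G)"

text \<open>The specification of the branches chosen at \<open>d\<close>. Decisions are demanded for
  all grafts \<open>B s ++ u\<close>, because the nodes on level \<open>d\<close> are of this
  form.\<close>

definition stage_ok ::
  "omega1 \<Rightarrow> node set \<Rightarrow> npair set \<Rightarrow> node set set \<Rightarrow> (nat \<Rightarrow> npair set) \<Rightarrow> npair \<Rightarrow> bool" where
  "stage_ok d T E \<A> G B \<longleftrightarrow>
     (\<forall>s. \<forall>b<d. cut (B s) b \<in> T) \<and> (\<forall>s. wsummable (B s)) \<and>
     (\<forall>A\<in>\<A>. \<forall>s. \<forall>u\<in>T. decided d T A (B s ++ u)) \<and>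
     split_pair B \<and> (\<forall>b<d. pcut B b \<notin> E) \<and>
     (\<forall>n. outside d (G n) B \<or>
       (\<exists>b<d. \<exists>e>0. (\<forall>s. weight (B s) < weight (cut (B s) b) + e) \<and> captured T E (G n) (pcut B b) e))"

lemma graft_cut:
  assumes "dom u = {..<b}" "b \<le> a" shows "cut (v ++ u) a = cut v a ++ u"
proof
  fix x show "cut (v ++ u) a x = (cut v a ++ u) x"
  proof (cases "x \<in> dom u")
    case True
    moreover have "x < a" using True assms by auto
    ultimately show ?thesis by auto
  next
    case False
    then show ?thesis by (auto simp: restrict_map_def map_add_def domIff)
  qed
qed

lemma map_add_absorb: "u \<subseteq>\<^sub>m w \<Longrightarrow> w ++ u = w"
  by (rule ext) (auto simp: map_add_def map_le_def dom_def split: option.split)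

lemma graft_cut_less:
  assumes "dom u = {..<b}" "a \<le> b" shows "cut (v ++ u) a = cut u a"
proof
  fix x show "cut (v ++ u) a x = cut u a x"
  proof (cases "x < a")
    case True
    then have "x \<in> dom u" using assms by auto
    then show ?thesis using True by (auto simp: map_add_def)
  qed simp
qed

lemma cut_eq_of_le: "u \<subseteq>\<^sub>m v \<Longrightarrow> dom u = {..<b} \<Longrightarrow> a \<le> b \<Longrightarrow> cut v a = cut u a"
  using map_le_eq_cut[of u v b] cut_cut[of v b a] by (simp add: min_absorb2)

text \<open>Forcing conditions are pairs of nodes together with a bound on the weight that may still be
  added to them.\<close>

locale stage =
  fixes X :: "omega1 \<Rightarrow> bool \<Rightarrow> omega1 \<Rightarrow> nat" and d :: omega1 and E :: "npair set"
  assumes lim: "islim d" and branch_ok: "\<And>b. b < d \<Longrightarrow> branch_ok X b"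
    and split: "\<And>p. p \<in> E \<Longrightarrow> split_pair p"
begin

definition cond :: "npair \<times> real \<Rightarrow> bool" where
  "cond q \<longleftrightarrow> 0 < snd q \<and> (\<exists>a<d. \<forall>s. fst q s \<in> Tree X \<and> lev (fst q s) = a) \<and> avoids E (fst q)"

text \<open>The total of weight and budget drops strictly, so the weight of the limit branch ends up
  strictly below every bound along a generic sequence.\<close>

definition extends :: "npair \<times> real \<Rightarrow> npair \<times> real \<Rightarrow> bool" where
  "extends q' q \<longleftrightarrow> (\<forall>s. fst q s \<subseteq>\<^sub>m fst q' s \<and> weight (fst q' s) + snd q' < weight (fst q s) + snd q)"

lemma summ: "t \<in> Tree X \<Longrightarrow> lev t < d \<Longrightarrow> wsummable t"
  using Tree_wsummable branch_ok by (meson le_less_trans)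

lemma extends_trans: "extends q'' q' \<Longrightarrow> extends q' q \<Longrightarrow> extends q'' q"
  unfolding extends_def by (meson less_trans map_le_trans)

text \<open>The cut may be made beyond the ends of the nodes. The true length \<open>l\<close> is a
  limit, and the nodes differ cofinally below it, because members of \<open>E\<close> are split
  pairs.\<close>

lemma split_cut:
  assumes "pcut p b \<in> E"
  obtains l where "islim l" "pcut p b = pcut p l" "\<And>s. {..<l} \<subseteq> dom (p s)"
    "\<And>a. a < l \<Longrightarrow> \<exists>x. a \<le> x \<and> x < l \<and> p True x \<noteq> p False x"
proof -
  obtain l where l: "islim l" "\<And>s. dom (cut (p s) b) = {..<l}"
    "\<And>a. a < l \<Longrightarrow> \<exists>x. a \<le> x \<and> x < l \<and> cut (p True) b x \<noteq> cut (p False) b x"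
    using split[OF assms] unfolding split_pair_def by auto
  have eq: "cut (p s) b = cut (p s) l" for s
    using map_le_eq_cut[OF cut_map_le l(2)] .
  then have "cut (p s) b x = p s x" if "x < l" for s x using that by simp
  then have "\<And>a. a < l \<Longrightarrow> \<exists>x. a \<le> x \<and> x < l \<and> p True x \<noteq> p False x" using l(3) by metis
  moreover have "{..<l} \<subseteq> dom (p s)" for s using l(2)[of s] by auto
  ultimately show thesis using that[of l] l(1) eq by auto
qed

text \<open>Lengthening both nodes of a pair by the same tail keeps it off \<open>E\<close>, because the members of
  \<open>E\<close> differ cofinally.\<close>

lemma extend_by_tail:
  assumes q: "cond (p, e)" and p0: "lev p0 = lev (p s0)" "p0 \<subseteq>\<^sub>m w" "p0 \<in> Tree X"
    and w: "w \<in> Tree X" "lev w < d" "weight w < weight p0 + e"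
  shows "\<exists>e'. cond (\<lambda>s. w ++ p s, e') \<and> extends (\<lambda>s. w ++ p s, e') (p, e) \<and> (\<forall>s. lev (w ++ p s) = lev w)"
proof -
  obtain a where a: "a < d" "\<And>s. p s \<in> Tree X" "\<And>s. lev (p s) = a" and om: "avoids E p" and e: "0 < e"
    using q unfolding cond_def by auto
  have domp: "dom (p s) = {..<a}" for s using Tree_dom[OF a(2)] a(3) by simp
  have dom0: "dom p0 = {..<a}" using Tree_dom[OF p0(3)] p0(1) a(3) by simp
  have domw: "dom w = {..<lev w}" using Tree_dom[OF w(1)] .
  have sub: "{..<a} \<subseteq> dom w" using map_le_implies_dom_le[OF p0(2)] dom0 by simp
  then have aw: "a \<le> lev w" using domw by simp
  \<comment> \<open>The node \<open>p0\<close> need not belong to the pair. Only the part of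
    \<open>w\<close> above level \<open>a\<close> is copied, and it costs both members the
    same.\<close>
  have cw: "weight (w ++ p s) = weight (p s) + (weight w - weight p0)" for s
    using weight_graft(2)[OF summ[OF w(1,2)] _ domp sub] summ[OF a(2)] a map_le_eq_cut[OF p0(2) dom0] by simp
  \<comment> \<open>Half of what the copied tail leaves of the budget, so that the total drops
    strictly.\<close>
  define e' where "e' = (weight p0 + e - weight w) / 2"
  have e': "0 < e'" "weight w - weight p0 + e' < e" using w(3) unfolding e'_def by (simp_all add: field_simps)
  have tree: "w ++ p s \<in> Tree X" "lev (w ++ p s) = lev w" for s
    using Tree_graft[OF a(2) w(1)] a(3) aw by simp_all
  have "avoids E (\<lambda>s. w ++ p s)" unfolding avoids_def
  proof (intro allI notI)
    fix b assume "pcut (\<lambda>s. w ++ p s) b \<in> E"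
    then obtain l where l: "islim l" "pcut (\<lambda>s. w ++ p s) b = pcut (\<lambda>s. w ++ p s) l"
      "\<And>a. a < l \<Longrightarrow> \<exists>x. a \<le> x \<and> x < l \<and> (w ++ p True) x \<noteq> (w ++ p False) x"
      by (rule split_cut[of "\<lambda>s. w ++ p s" b]) blast
    show False
    proof (cases "l \<le> a")
      case True
      then have "pcut (\<lambda>s. w ++ p s) l = pcut p l" using graft_cut_less[OF domp] by simp
      then show False using l(2) \<open>pcut (\<lambda>s. w ++ p s) b \<in> E\<close> om unfolding avoids_def by metis
    next
      case False
      then obtain x where "a \<le> x" "(w ++ p True) x \<noteq> (w ++ p False) x" using l(3)[of a] by (metis not_less)
      moreover have "(w ++ p s) x = w x" for s
        using \<open>a \<le> x\<close> domp[of s] by (metis lessThan_iff map_add_dom_app_simps(3) not_less)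
      ultimately show False by simp
    qed
  qed
  then have "cond (\<lambda>s. w ++ p s, e')" unfolding cond_def using e' tree w(2) by auto
  moreover have "extends (\<lambda>s. w ++ p s, e') (p, e)" 
    unfolding extends_def fst_conv snd_conv
  proof (intro allI conjI)
    fix s
    show "p s \<subseteq>\<^sub>m w ++ p s" by simp
    show "weight (w ++ p s) + e' < weight (p s) + e" using cw[of s] e'(2) by linarith
  qed
  ultimately show ?thesis using tree by blast
qed

lemma dense_lev:
  assumes "cond q" "g < d"
  shows "\<exists>q'. cond q' \<and> extends q' q \<and> (\<forall>s. g < lev (fst q' s))"
proof -
  obtain p e where q: "q = (p, e)" by fastforce
  obtain a where a: "a < d" "\<And>s. p s \<in> Tree X" "\<And>s. lev (p s) = a" and e: "0 < e"
    using assms(1) unfolding cond_def q by auto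
  obtain b where b: "max a g < b" "b < d" using lim a(1) assms(2) unfolding islim_def by (metis max_def)
  have le: "lev (p True) \<le> b" using a(3) b(1) by (metis less_imp_le max_less_iff_conj)
  have "branch_ok X y" if "y \<le> b" for y using branch_ok that b(2) le_less_trans by blast
  then obtain w where w: "w \<in> Tree X" "lev w = b" "p True \<subseteq>\<^sub>m w" "weight w < weight (p True) + e"
    using Tree_extend[OF a(2) le _ e] by blast
  obtain e' where "cond (\<lambda>s. w ++ p s, e')" "extends (\<lambda>s. w ++ p s, e') (p, e)" "\<forall>s. lev (w ++ p s) = lev w"
    using extend_by_tail[OF assms(1)[unfolded q] refl w(3) a(2) w(1) _ w(4)] w(2) b(2) by auto
  then show ?thesis using w(2) b(1) unfolding q by (intro exI[of _ "(\<lambda>s. w ++ p s, e')"]) simp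
qed

text \<open>If some extension \<open>w\<close> of \<open>fst q s ++ u\<close> in \<open>A\<close>
  fits the budget (after lengthening \<open>q\<close>), its tail is copied onto both members of the
  pair; grafting \<open>u\<close> back then yields a node above \<open>w\<close>. If none fits, the
  condition itself meets the second alternative.\<close>

lemma dense_decide:
  assumes "cond q" "g < d" "u \<in> Tree X" "lev u < d"
  shows "\<exists>q'. cond q' \<and> extends q' q \<and> g < lev (fst q' s) \<and> lev u \<le> lev (fst q' s) \<and>
    ((\<exists>w\<in>A. w \<subseteq>\<^sub>m fst q' s ++ u \<and> dom w = {..<lev w} \<and> g < lev w) \<or>
     (\<forall>w\<in>A \<inter> below (Tree X) d. fst q' s ++ u \<subset>\<^sub>m w \<longrightarrow> weight (fst q' s ++ u) + snd q' \<le> weight w))"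
proof -
  obtain q1 where q1: "cond q1" "extends q1 q" "\<And>s. max g (lev u) < lev (fst q1 s)"
    using dense_lev[OF assms(1), of "max g (lev u)"] assms(2,4) by auto
  obtain p e where p: "q1 = (p, e)" by fastforce
  obtain a where a: "a < d" "\<And>s. p s \<in> Tree X" "\<And>s. lev (p s) = a"
    using q1(1) unfolding cond_def p by auto
  have ga: "g < a" "lev u < a" using q1(3)[of s] unfolding p by (simp_all add: a)
  let ?v = "p s ++ u"
  have v: "?v \<in> Tree X" "lev ?v = a" using Tree_graft[OF assms(3) a(2)[of s]] a(3) ga by simp_all
  show ?thesis
  proof (cases "\<exists>w\<in>A \<inter> below (Tree X) d. ?v \<subset>\<^sub>m w \<and> weight w < weight ?v + e")
    case False
    then show ?thesis using q1 ga p a(3) by (intro exI[of _ q1]) (auto simp: not_less)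
  next
    case True
    then obtain w where w: "w \<in> A" "w \<in> Tree X" "lev w < d" "?v \<subset>\<^sub>m w" "weight w < weight ?v + e"
      unfolding below_def by auto
    have vw: "?v \<subseteq>\<^sub>m w" "?v \<noteq> w" using w(4) unfolding strict_map_le_def by auto
    obtain e' where e': "cond (\<lambda>s. w ++ p s, e')" "extends (\<lambda>s. w ++ p s, e') (p, e)"
      "\<And>s. lev (w ++ p s) = lev w"
      using extend_by_tail[OF q1(1)[unfolded p] _ vw(1) v(1) w(2,3,5), of s] v(2) a(3) by auto
    have "{..<a} \<subseteq> dom w"
      using map_le_implies_dom_le[OF vw(1)] Tree_dom[OF v(1)] v(2) by (simp only:)
    moreover have "dom w \<noteq> {..<a}" using map_le_dom_eq[OF vw(1)] vw(2) Tree_dom[OF v(1)] v(2) by metis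
    ultimately have "{..<a} \<subset> dom w" by blast
    then have aw: "a < lev w" using Tree_dom[OF w(2)] by (metis lessThan_strict_subset_iff)
    \<comment> \<open>Since \<open>p s ++ u\<close> is an initial part of \<open>w\<close>, grafting
      it onto \<open>w\<close> changes nothing.\<close>
    have "w = (w ++ p s) ++ u" using map_add_absorb[OF vw(1)] by (simp add: map_add_assoc)
    then have "w \<subseteq>\<^sub>m (w ++ p s) ++ u" by simp
    then show ?thesis
      using w(1) aw ga e' extends_trans[OF e'(2)] q1(2) Tree_dom[OF w(2)] unfolding p
      by (intro exI[of _ "(\<lambda>s. w ++ p s, e')"]) (auto intro: less_trans less_imp_le)
  qed
qed

text \<open>Two different large numbers are appended, at a cost below \<open>e/2\<close> each. The
  new level is a successor, so no new cut can belong to \<open>E\<close>, whose members have limit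
  length.\<close>

lemma dense_split:
  assumes "cond q" "g < d"
  shows "\<exists>q'. cond q' \<and> extends q' q \<and> (\<exists>x\<ge>g. (\<forall>s. x < lev (fst q' s)) \<and> fst q' True x \<noteq> fst q' False x)"
proof -
  obtain q1 where q1: "cond q1" "extends q1 q" "\<And>s. g < lev (fst q1 s)"
    using dense_lev[OF assms] by auto
  obtain p e where p: "q1 = (p, e)" by fastforce
  obtain a where a: "a < d" "\<And>s. p s \<in> Tree X" "\<And>s. lev (p s) = a" and e: "0 < e" and om: "avoids E p"
    using q1(1) unfolding cond_def p by auto
  have ga: "g < a" using q1(3)[of True] unfolding p by (simp add: a)
  have domp: "dom (p s) = {..<a}" for s using Tree_dom[OF a(2)] a(3) by simp
  from ex_suc_omega1[of a] obtain b where b: "{..<b} = {..a}" ..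
  have bd: "b < d"
  proof (rule ccontr)
    assume "\<not> b < d"
    then have "{..<d} \<subseteq> {..a}" unfolding b[symmetric] by (simp only: not_less lessThan_subset_iff)
    moreover obtain y where "a < y" "y < d" using lim a(1) unfolding islim_def by blast
    ultimately show False by (meson atMost_iff lessThan_iff not_less subsetD)
  qed
  obtain K :: nat where K: "(1/2 :: real) ^ K < e/2"
    using real_arch_pow_inv[of "e/2" "1/2"] e by auto
  define k where "k s = (if s then K else Suc K)" for s
  have k: "(1/2 :: real) ^ k s < e/2" for s using K unfolding k_def by (auto intro: le_less_trans[rotated])
  define p' where "p' s = (p s)(a \<mapsto> k s)" for s
  have p': "p' s \<in> Tree X" "lev (p' s) = b" for s
    using Tree_append[OF a(2)[of s], of b "k s"] b a(3) unfolding p'_def by simp_all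
  have cp: "weight (p' s) = weight (p s) + (1/2) ^ k s" for s
    using weight_append(2)[OF summ[OF a(2)] domp] a unfolding p'_def by simp
  have le: "p s \<subseteq>\<^sub>m p' s" for s unfolding p'_def using domp[of s] by (auto simp: map_le_def)
  have "avoids E p'" unfolding avoids_def
  proof (intro allI notI)
    fix y assume y: "pcut p' y \<in> E"
    then obtain l where l: "islim l" "pcut p' y = pcut p' l" "\<And>s. {..<l} \<subseteq> dom (p' s)"
      by (rule split_cut) blast
    have "l \<le> b" using l(3)[of True] Tree_dom[OF p'(1)] p'(2) by simp
    moreover have "l \<noteq> b" using islim_not_suc[OF l(1)] b by blast
    ultimately have "l \<in> {..<b}" by simp
    then have "l \<le> a" using b by simp
    then have "pcut p' l = pcut p l" using cut_eq_of_le[OF le domp] by simp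
    then show False using l(2) y om unfolding avoids_def by metis
  qed
  then have "cond (p', e/2)" unfolding cond_def using e p' bd by auto
  moreover have "extends (p', e/2) (p, e)"
    unfolding extends_def fst_conv snd_conv
  proof (intro allI conjI)
    fix s
    show "p s \<subseteq>\<^sub>m p' s" by (rule le)
    show "weight (p' s) + e/2 < weight (p s) + e" using cp[of s] k[of s] by linarith
  qed
  moreover have "a < b" using b by auto
  moreover have "p' True a \<noteq> p' False a" unfolding p'_def k_def by simp
  ultimately show ?thesis
    using ga p' extends_trans[of "(p', e/2)" q1 q] q1(2) unfolding p
    by (intro exI[of _ "(p', e/2)"]) (auto intro!: exI[of _ a])
qed

text \<open>If a condition does not capture \<open>G\<close>, a pair refuting this is itself a
  legitimate extension outside \<open>G\<close>.\<close>

lemma dense_capture: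
  assumes "cond q" "g < d"
  shows "\<exists>q'. cond q' \<and> extends q' q \<and> (\<forall>s. g < lev (fst q' s)) \<and>
    (captured (below (Tree X) d) E G (fst q') (snd q') \<or> fst q' \<notin> G)"
proof -
  obtain q1 where q1: "cond q1" "extends q1 q" "\<And>s. g < lev (fst q1 s)"
    using dense_lev[OF assms] by auto
  obtain p e where p: "q1 = (p, e)" by fastforce
  obtain a where a: "a < d" "\<And>s. p s \<in> Tree X" "\<And>s. lev (p s) = a" and e: "0 < e" and om: "avoids E p"
    using q1(1) unfolding cond_def p by auto
  have ga: "g < a" using q1(3)[of True] unfolding p by (simp add: a)
  show ?thesis
  proof (cases "captured (below (Tree X) d) E G p e")
    case True
    then show ?thesis using q1 p by (intro exI[of _ q1]) auto
  next
    case False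
    then obtain p' b where
      "\<forall>s. p' s \<in> below (Tree X) d \<and> p s \<subset>\<^sub>m p' s \<and> weight (p' s) < weight (p s) + e"
      "\<forall>s. lev (p' s) = b" "avoids E p'" "p' \<notin> G"
      unfolding captured_def by blast
    then have p': "p' s \<in> Tree X" "lev (p' s) < d" "p s \<subset>\<^sub>m p' s"
      "weight (p' s) < weight (p s) + e" "lev (p' s) = b" "avoids E p'" "p' \<notin> G" for s
      unfolding below_def by simp_all
    \<comment> \<open>Half of the smaller remaining budget serves both members.\<close>
    define e' where "e' = min (weight (p True) + e - weight (p' True)) (weight (p False) + e - weight (p' False)) / 2"
    have e': "0 < e'" unfolding e'_def using p'(4)[of True] p'(4)[of False] by simp
    have e'2: "weight (p' s) + e' < weight (p s) + e" for s
    proof (cases s)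
      case True
      have "e' \<le> (weight (p True) + e - weight (p' True)) / 2" unfolding e'_def by simp
      then show ?thesis using p'(4)[of True] True by (simp add: field_simps)
    next
      case False
      have "e' \<le> (weight (p False) + e - weight (p' False)) / 2" unfolding e'_def by simp
      then show ?thesis using p'(4)[of False] False by (simp add: field_simps)
    qed
    have le: "p s \<subseteq>\<^sub>m p' s" for s using p'(3) unfolding strict_map_le_def by blast
    have "{..<a} \<subseteq> {..<b}"
      using map_le_implies_dom_le[OF le[of True]] Tree_dom[OF a(2)[of True]] Tree_dom[OF p'(1)[of True]] a(3) p'(5) by simp
    then have "g < b" using ga by auto
    have "b < d" using p'(2,5) by metis
    have "cond (p', e')" unfolding cond_def using p' e' \<open>b < d\<close> by auto
    moreover have "extends (p', e') (p, e)" unfolding extends_def using le e'2 by simp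
    ultimately show ?thesis
      using p'(5,7) \<open>g < b\<close> extends_trans[of "(p', e')" q1 q] q1(2) unfolding p
      by (intro exI[of _ "(p', e')"]) auto
  qed
qed

lemma root: "cond (\<lambda>s. Map.empty, 1)"
proof -
  obtain z where z: "z < d" "{..<z} = {}" using islim_zero[OF lim] by blast
  have "lev Map.empty = z" by (rule lev_eq) (simp add: z)
  moreover have "avoids E (\<lambda>s. Map.empty)" unfolding avoids_def
  proof (intro allI notI)
    fix b assume "pcut (\<lambda>s. Map.empty) b \<in> E"
    then obtain l where "islim l" "\<And>s. {..<l} \<subseteq> dom (Map.empty :: node)"
      by (rule split_cut[of "\<lambda>s. Map.empty" b]) simp
    then show False unfolding islim_def by simp
  qed
  ultimately show ?thesis unfolding cond_def using z Tree_empty by auto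
qed


text \<open>The branches are the unions of a generic sequence for countably many dense sets:
  \<open>Dl\<close> for length, \<open>Ds\<close> for splitting, \<open>Dc\<close> for capturing and
  \<open>Dd\<close> for deciding.\<close>

lemma stage_exists:
  assumes A: "countable \<A>"
  shows "\<exists>r. stage_ok d (below (Tree X) d) E \<A> G (\<lambda>s. upto_map d (r s))"
proof -
  let ?T = "below (Tree X) d"
  have T: "t \<in> ?T \<longleftrightarrow> t \<in> Tree X \<and> lev t < d" for t unfolding below_def by simp
  define Dl where "Dl g = {q :: npair \<times> real. \<forall>s. g < lev (fst q s)}" for g
  define Ds where "Ds g = {q :: npair \<times> real. \<exists>x\<ge>g. (\<forall>s. x < lev (fst q s)) \<and> fst q True x \<noteq> fst q False x}" for g
  define Dc where "Dc = (\<lambda>(g, n). {q :: npair \<times> real. (\<forall>s. g < lev (fst q s)) \<and>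
    (captured ?T E (G n) (fst q) (snd q) \<or> fst q \<notin> G n)})"
  define Dd where "Dd = (\<lambda>(A, s, u, g). {q :: npair \<times> real. g < lev (fst q s) \<and> lev u \<le> lev (fst q s) \<and>
    ((\<exists>w\<in>A. w \<subseteq>\<^sub>m fst q s ++ u \<and> dom w = {..<lev w} \<and> g < lev w) \<or>
     (\<forall>w\<in>A \<inter> ?T. fst q s ++ u \<subset>\<^sub>m w \<longrightarrow> weight (fst q s ++ u) + snd q \<le> weight w))})"
  define \<D> where "\<D> = Dl ` {..<d} \<union> Ds ` {..<d} \<union> Dc ` ({..<d} \<times> UNIV) \<union>
    Dd ` (\<A> \<times> UNIV \<times> ?T \<times> {..<d})"
  have "?T = (\<Union>a<d. level (Tree X) a)"
    unfolding below_def level_eq_lev by auto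
  then have cT: "countable ?T" using Tree_countable_level countable_below_omega1 by simp
  have "countable \<D>"
    unfolding \<D>_def using A cT countable_below_omega1
    by (intro countable_Un countable_image countable_SIGMA) auto
  moreover have "\<exists>q'. cond q' \<and> extends q' q \<and> q' \<in> D" if "D \<in> \<D>" "cond q" for D q
  proof -
    consider g where "g < d" "D = Dl g" | g where "g < d" "D = Ds g"
      | g n where "g < d" "D = Dc (g, n)"
      | g u A s where "g < d" "u \<in> Tree X" "lev u < d" "D = Dd (A, s, u, g)"
      using \<open>D \<in> \<D>\<close> unfolding \<D>_def by (elim UnE imageE) (auto simp: T)
    then show ?thesis
    proof cases
      case 1
      then show ?thesis using dense_lev[OF that(2)] unfolding Dl_def by simp
    next
      case 2
      then show ?thesis using dense_split[OF that(2)] unfolding Ds_def by simp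
    next
      case 3
      then show ?thesis using dense_capture[OF that(2), of g "G n"] unfolding Dc_def by simp
    next
      case (4 g u A s)
      then show ?thesis using dense_decide[OF that(2), of g u s A] unfolding Dd_def by simp
    qed
  qed
  ultimately have "\<D> = {} \<or> (\<exists>f :: nat \<Rightarrow> npair \<times> real. (\<forall>i. cond (f i) \<and> extends (f (Suc i)) (f i)) \<and> (\<forall>D\<in>\<D>. \<exists>i. f i \<in> D))"
    by (intro generic_sequence[of \<D> cond "(\<lambda>s. Map.empty, 1)" extends] root)
  moreover have "\<D> \<noteq> {}" using lim unfolding \<D>_def islim_def by blast
  ultimately obtain f :: "nat \<Rightarrow> npair \<times> real"
    where f: "\<And>i. cond (f i)" "\<And>i. extends (f (Suc i)) (f i)" "\<And>D. D \<in> \<D> \<Longrightarrow> \<exists>i. f i \<in> D"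
    by blast
  define p where "p i = fst (f i)" for i
  define e where "e i = snd (f i)" for i
  define l where "l i = lev (p i True)" for i
  have p: "p i s \<in> Tree X" "lev (p i s) = l i" "l i < d" "0 < e i" "avoids E (p i)" for i s
    using f(1)[of i] unfolding cond_def p_def l_def e_def by auto
  have domp: "dom (p i s) = {..<l i}" for i s using Tree_dom[OF p(1)] p(2) by simp
  have succ_step: "p i s \<subseteq>\<^sub>m p (Suc i) s" "weight (p (Suc i) s) + e (Suc i) < weight (p i s) + e i" for i s
    using f(2)[of i] unfolding extends_def p_def e_def by auto
  have mono: "p i s \<subseteq>\<^sub>m p j s \<and> weight (p j s) + e j \<le> weight (p i s) + e i" if "i \<le> j" for i j s
    using that
  proof (induction rule: dec_induct)
    case (step n)
    then show ?case using succ_step[of n s] by (auto intro: map_le_trans)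
  qed simp
  have high: "\<exists>i. g < l i" if "g < d" for g
  proof -
    have "Dl g \<in> \<D>" using that unfolding \<D>_def by blast
    from f(3)[OF this] show ?thesis unfolding Dl_def l_def p_def by blast
  qed
  have lmono: "l i \<le> l j" if "i \<le> j" for i j
    using map_le_implies_dom_le[of "p i True" "p j True"] mono[OF that] domp by simp
  \<comment> \<open>Any condition reaching beyond \<open>x\<close> gives the same value there, as
    conditions of the sequence are nested.\<close>
  define r where "r s x = the (p (SOME i. x < l i) s x)" for s x
  define B where "B s = upto_map d (r s)" for s
  have domB: "dom (B s) = {..<d}" for s unfolding B_def by simp
  have pB: "p i s \<subseteq>\<^sub>m B s" for i s
    unfolding map_le_def
  proof
    fix x assume "x \<in> dom (p i s)"
    then have x: "x < l i" using domp by simp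
    define j where "j = (SOME i. x < l i)"
    have j: "x < l j" unfolding j_def using x by (rule someI)
    have "p i s x = p j s x"
      using mono[of i j s] mono[of j i s] x j domp unfolding map_le_def by (metis lessThan_iff nle_le)
    moreover have "p j s x \<noteq> None" using domp[of j s] j by blast
    ultimately show "p i s x = B s x"
      using x p(3)[of i] unfolding B_def upto_map_def r_def j_def[symmetric] by auto
  qed
  have pcut: "cut (B s) a = cut (p i s) a" if "a \<le> l i" for s a i
    using cut_eq_of_le[OF pB domp that] .
  have cutl: "cut (B s) (l i) = p i s" for s i using map_le_eq_cut[OF pB domp] by simp
  \<comment> \<open>Each initial part of \<open>B s\<close> lies below some \<open>p k s\<close>, so
    its weight respects the bound of every condition \<open>i\<close>. Using the bound of
    \<open>Suc i\<close> makes the inequality for \<open>i\<close> strict.\<close>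
  have summB: "wsummable (B s)" and cB: "weight (B s) < weight (p i s) + e i" for s i
  proof -
    have *: "wsummable (cut (B s) b) \<and> weight (cut (B s) b) \<le> weight (p i s) + e i" if b: "b < d" for b i
    proof -
      obtain j where "b < l j" using high[OF b] by blast
      define k where "k = max i j"
      have bk: "b \<le> l k" using \<open>b < l j\<close> lmono[of j k] unfolding k_def by simp
      have w: "wsummable (p k s)" using summ[OF p(1)] p(2,3) by simp
      have "weight (cut (B s) b) \<le> weight (p k s)" unfolding pcut[OF bk] using weight_mono[OF w cut_map_le] .
      also have "\<dots> \<le> weight (p i s) + e i"
        using mono[of i k s] p(4)[of k] unfolding k_def by simp
      finally show ?thesis using wsummable_map_le[OF w cut_map_le] pcut[OF bk] by simp
    qed
    show "wsummable (B s)" using wsummable_limit(1)[OF domB lim *] by blast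
    have "weight (B s) \<le> weight (p (Suc i) s) + e (Suc i)" using wsummable_limit(2)[OF domB lim *] .
    then show "weight (B s) < weight (p i s) + e i" using succ_step(2)[of i s] by simp
  qed
  have 1: "cut (B s) b \<in> ?T" if "b < d" for s b
  proof -
    obtain i where "b < l i" using high[OF \<open>b < d\<close>] by blast
    then have "cut (B s) b = cut (p i s) b" "lev (cut (p i s) b) = b"
      using pcut[of b i s] lev_cut[OF p(1)] p(2) by auto
    then show ?thesis using Tree_cut[OF p(1)] that unfolding T by metis
  qed
  have 2: "decided d ?T A (B s ++ u)" if "A \<in> \<A>" "u \<in> ?T" for A s u
    unfolding decided_def
  proof (rule disjCI)
    let ?v = "B s ++ u"
    have u: "u \<in> Tree X" "lev u < d" using that(2) T by auto
    note domu = Tree_dom[OF u(1)]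
    have domv: "dom ?v = {..<d}" using domB[of s] domu u(2) by auto
    assume nav: "\<not> (\<exists>b<d. \<exists>e>0. weight ?v < weight (cut ?v b) + e \<and> (\<forall>w\<in>A \<inter> ?T. cut ?v b \<subset>\<^sub>m w \<longrightarrow> weight (cut ?v b) + e \<le> weight w))"
    show "\<forall>b<d. \<exists>x. b < x \<and> x < d \<and> cut ?v x \<in> A"
    proof (intro allI impI)
      fix g assume g: "g < d"
      have "Dd (A, s, u, g) \<in> \<D>" using g that unfolding \<D>_def by blast
      then obtain i where "f i \<in> Dd (A, s, u, g)" using f(3) by blast
      then have i: "g < l i" "lev u \<le> l i"
        "(\<exists>w\<in>A. w \<subseteq>\<^sub>m p i s ++ u \<and> dom w = {..<lev w} \<and> g < lev w) \<or>
         (\<forall>w\<in>A \<inter> ?T. p i s ++ u \<subset>\<^sub>m w \<longrightarrow> weight (p i s ++ u) + e i \<le> weight w)"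
        unfolding Dd_def by (simp_all add: p_def[symmetric] e_def[symmetric] p(2))
      have cv: "cut ?v (l i) = p i s ++ u" using graft_cut[OF domu i(2)] cutl by simp
      have sub: "{..<lev u} \<subseteq> dom (B s)" "{..<lev u} \<subseteq> dom (p i s)"
        using domB[of s] domp[of i s] u(2) i(2) by auto
      have wu: "wsummable u" using summ[OF u] .
      have wp: "wsummable (p i s)" using summ[OF p(1)] p(2,3) by simp
      have "weight ?v = weight u + (weight (B s) - weight (cut (B s) (lev u)))" using weight_graft(2)[OF summB wu domu sub(1)] .
      moreover have "weight (p i s ++ u) = weight u + (weight (p i s) - weight (cut (p i s) (lev u)))"
        using weight_graft(2)[OF wp wu domu sub(2)] .
      \<comment> \<open>\<open>B s\<close> and \<open>p i s\<close> agree below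
        \<open>lev u\<close>, so grafting \<open>u\<close> shifts both weights equally.\<close>
      ultimately have "weight ?v < weight (p i s ++ u) + e i" using cB[of s i] pcut[OF i(2)] by simp
      \<comment> \<open>Otherwise the level \<open>l i\<close> and the budget \<open>e i\<close>
        would witness the alternative excluded by \<open>nav\<close>.\<close>
      then have "\<not> (\<forall>w\<in>A \<inter> ?T. p i s ++ u \<subset>\<^sub>m w \<longrightarrow> weight (p i s ++ u) + e i \<le> weight w)"
        using nav p(3,4)[of i] cv by metis
      then obtain w where w: "w \<in> A" "w \<subseteq>\<^sub>m p i s ++ u" "dom w = {..<lev w}" "g < lev w"
        using i(3) by blast
      have "w \<subseteq>\<^sub>m ?v" using w(2) cut_map_le[of ?v "l i"] cv map_le_trans by metis
      then have "w = cut ?v (lev w)" using map_le_eq_cut w(3) by blast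
      moreover have "lev w < d"
      proof -
        have "{..<lev w} \<subseteq> {..<l i}"
        proof -
          have "dom (p i s ++ u) = {..<l i}" using domp[of i s] domu i(2) by auto
          then show ?thesis using map_le_implies_dom_le[OF w(2)] w(3) by (simp only:)
        qed
        then show ?thesis using p(3)[of i] by auto
      qed
      ultimately show "\<exists>x. g < x \<and> x < d \<and> cut ?v x \<in> A" using w(1,4) by metis
    qed
  qed
  have 3: "split_pair B" unfolding split_pair_def
  proof (rule exI[of _ d], intro conjI allI impI lim domB)
    fix g assume g: "g < d"
    have "Ds g \<in> \<D>" using g unfolding \<D>_def by blast
    then obtain i where "f i \<in> Ds g" using f(3) by blast
    then obtain x where x: "g \<le> x" "x < l i" "p i True x \<noteq> p i False x"
      unfolding Ds_def by (auto simp: p_def[symmetric] p(2))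
    have "B s x = p i s x" for s using pB[of i s] x(2) domp[of i s] unfolding map_le_def by (metis lessThan_iff)
    then show "\<exists>x\<ge>g. x < d \<and> B True x \<noteq> B False x"
      using x p(3)[of i] by (intro exI[of _ x]) auto
  qed
  have 4: "pcut B b \<notin> E" if "b < d" for b
  proof -
    obtain i where "b < l i" using high[OF \<open>b < d\<close>] by blast
    then have "pcut B b = pcut (p i) b" using pcut[of b i] by auto
    then show ?thesis using p(5)[of i] unfolding avoids_def by metis
  qed
  have 5: "outside d (G n) B \<or>
       (\<exists>b<d. \<exists>e>0. (\<forall>s. weight (B s) < weight (cut (B s) b) + e) \<and> captured ?T E (G n) (pcut B b) e)" for n
  proof (cases "\<exists>i. captured ?T E (G n) (p i) (e i)")
    case True
    then obtain i where i: "captured ?T E (G n) (p i) (e i)" by blast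
    have "pcut B (l i) = p i" using cutl by auto
    then show ?thesis using i cB[of _ i] p(3,4)[of i] cutl by (intro disjI2 exI[of _ "l i"] conjI exI[of _ "e i"]) auto
  next
    case False
    \<comment> \<open>No condition of the sequence captures \<open>G n\<close>, so the one meeting
      \<open>Dc (g, n)\<close> is a cut of \<open>B\<close> outside \<open>G n\<close>.\<close>
    have "\<exists>x. g < x \<and> x < d \<and> pcut B x \<notin> G n" if g: "g < d" for g
    proof -
      have "Dc (g, n) \<in> \<D>" using g unfolding \<D>_def by blast
      then obtain i where "f i \<in> Dc (g, n)" using f(3) by blast
      then have "g < l i" "p i \<notin> G n"
        using False unfolding Dc_def by (auto simp: p_def[symmetric] e_def[symmetric] p(2))
      moreover have "pcut B (l i) = p i" using cutl by auto
      ultimately show ?thesis using p(3)[of i] by (intro exI[of _ "l i"]) auto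
    qed
    then show ?thesis unfolding outside_def by blast
  qed
  have "stage_ok d ?T E \<A> G B" unfolding stage_ok_def using 1 2 3 4 5 summB by blast
  then show ?thesis unfolding B_def by blast
qed

end

section \<open>The recursion\<close>

text \<open>A node is coded by its level and its number in an enumeration of that countable level,
  so codes of nodes below \<open>d\<close> always lie in
  \<open>{..<d} \<times> UNIV\<close>.\<close>

definition decode_nodes :: "node set \<Rightarrow> (omega1 \<times> nat) set \<Rightarrow> node set" where
  "decode_nodes T Y = {v \<in> T. (lev v, to_nat_on (level T (lev v)) v) \<in> Y}"

text \<open>The index \<open>n\<close> is part of the code, so that one set of codes represents a
  whole sequence of sets of pairs.\<close>

definition pair_code :: "node set \<Rightarrow> nat \<Rightarrow> npair \<Rightarrow> omega1 \<times> nat" where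
  "pair_code T n p = (let L = level T (lev (p True)) in
     (lev (p True), prod_encode (n, prod_encode (to_nat_on L (p True), to_nat_on L (p False)))))"

text \<open>Membership in \<open>T\<close> is not demanded; decoded and true sets are compared only
  on pairs of nodes of \<open>T\<close> on one level.\<close>

definition decode_pairs :: "node set \<Rightarrow> (omega1 \<times> nat) set \<Rightarrow> nat \<Rightarrow> npair set" where
  "decode_pairs T Y n = {p. pair_code T n p \<in> Y}"

abbreviation branches :: "(omega1 \<Rightarrow> bool \<Rightarrow> omega1 \<Rightarrow> nat) \<Rightarrow> omega1 \<Rightarrow> npair" where
  "branches X d \<equiv> (\<lambda>s. upto_map d (X d s))"

text \<open>The branches chosen at \<open>d\<close> form a declared pair if they leave some guessed set \<open>G n\<close>
  cofinally often. Otherwise every \<open>G n\<close> is captured, hence contains the pair if the guess was right.\<close>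

definition declared ::
  "(omega1 \<Rightarrow> (omega1 \<times> nat) set) \<Rightarrow> (omega1 \<Rightarrow> bool \<Rightarrow> omega1 \<Rightarrow> nat) \<Rightarrow> omega1 \<Rightarrow> bool" where
  "declared g X d \<longleftrightarrow> islim d \<and> (\<exists>n. outside d (decode_pairs (below (Tree X) d) (g d) n) (branches X d))"

definition declared_below ::
  "(omega1 \<Rightarrow> (omega1 \<times> nat) set) \<Rightarrow> (omega1 \<Rightarrow> bool \<Rightarrow> omega1 \<Rightarrow> nat) \<Rightarrow> omega1 \<Rightarrow> npair set" where
  "declared_below g X d = {branches X b | b. b < d \<and> declared g X b}"

text \<open>A relation, because the branches at \<open>d\<close> are chosen rather than computed. It
  depends on \<open>X\<close> only below \<open>d\<close>, as a choice along a well-founded relation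
  requires.\<close>

definition stage_rel ::
  "(omega1 \<Rightarrow> (omega1 \<times> nat) set set) \<Rightarrow> (omega1 \<Rightarrow> (omega1 \<times> nat) set) \<Rightarrow>
   (omega1 \<Rightarrow> bool \<Rightarrow> omega1 \<Rightarrow> nat) \<Rightarrow> omega1 \<Rightarrow> (bool \<Rightarrow> omega1 \<Rightarrow> nat) \<Rightarrow> bool" where
  "stage_rel S g X d r \<longleftrightarrow> (islim d \<longrightarrow>
     stage_ok d (below (Tree X) d) (declared_below g X d) (decode_nodes (below (Tree X) d) ` S d)
       (decode_pairs (below (Tree X) d) (g d)) (\<lambda>s. upto_map d (r s)))"

lemma below_cong:
  assumes "\<And>b. b < d \<Longrightarrow> X b = Y b" shows "below (Tree X) d = below (Tree Y) d"
proof -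
  have "t \<in> below (Tree Y) d" if "\<And>b. b < d \<Longrightarrow> X b = Y b" "t \<in> below (Tree X) d" for X Y t
  proof -
    have t: "t \<in> Tree X" "lev t < d" using that(2) unfolding below_def by auto
    have "t \<in> Tree Y"
      using Tree_cong[OF _ Tree_dom[OF t(1)], of X Y] t that(1) by (meson le_less_trans)
    then show ?thesis using t(2) unfolding below_def by simp
  qed
  then show ?thesis using assms by (metis subsetI subset_antisym)
qed

lemma declared_below_cong:
  assumes "\<And>b. b < d \<Longrightarrow> X b = Y b" shows "declared_below g X d = declared_below g Y d"
proof -
  have "declared g X b = declared g Y b" if "b < d" for b
  proof -
    have "below (Tree X) b = below (Tree Y) b" using assms that by (intro below_cong) (meson less_trans)
    then show ?thesis using assms[OF that] unfolding declared_def by simp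
  qed
  then show ?thesis unfolding declared_below_def using assms by (metis (lifting))
qed

lemma stage_rel_branch_ok: assumes "stage_rel S g X d (X d)" shows "branch_ok X d"
  unfolding branch_ok_def
proof
  assume "islim d"
  then have "stage_ok d (below (Tree X) d) (declared_below g X d) (decode_nodes (below (Tree X) d) ` S d)
       (decode_pairs (below (Tree X) d) (g d)) (branches X d)" using assms unfolding stage_rel_def by blast
  then show "\<forall>s. (\<forall>b<d. cut (upto_map d (X d s)) b \<in> Tree X) \<and> wsummable (upto_map d (X d s))"
    unfolding stage_ok_def below_def by blast
qed

text \<open>Well-founded choice along \<open><\<close>. The earlier stages supply the assumptions of
  the locale \<open>stage\<close>: correct branches below \<open>d\<close>, and declared pairs that
  split.\<close>

lemma ex_stages:
  assumes "\<And>d. countable (S d)"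
  shows "\<exists>X. \<forall>d. stage_rel S g X d (X d)"
proof (rule dependent_wf_choice[of "{(a, b). a < b}" "stage_rel S g"])
  show "wf {(a :: omega1, b). a < b}" by (rule wf)
  fix X Y :: "omega1 \<Rightarrow> bool \<Rightarrow> omega1 \<Rightarrow> nat" and d r
  assume "\<And>z. (z, d) \<in> {(a, b). a < b} \<Longrightarrow> X z = Y z"
  then have "\<And>b. b < d \<Longrightarrow> X b = Y b" by simp
  then show "stage_rel S g X d r = stage_rel S g Y d r"
    unfolding stage_rel_def using below_cong[of d X Y] declared_below_cong[of d X Y g] by simp
next
  fix d and X :: "omega1 \<Rightarrow> bool \<Rightarrow> omega1 \<Rightarrow> nat"
  assume "\<And>y. (y, d) \<in> {(a, b). a < b} \<Longrightarrow> stage_rel S g X y (X y)"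
  then have st: "\<And>b. b < d \<Longrightarrow> stage_rel S g X b (X b)" by simp
  show "\<exists>r. stage_rel S g X d r"
  proof (cases "islim d")
    case True
    have "split_pair p" if p: "p \<in> declared_below g X d" for p
    proof -
      obtain b where b: "p = branches X b" "b < d" "islim b" using p unfolding declared_below_def declared_def by blast
      then show ?thesis using st[OF b(2)] unfolding stage_rel_def stage_ok_def by blast
    qed
    then interpret stage X d "declared_below g X d"
      by unfold_locales (use True stage_rel_branch_ok st in blast)+
    show ?thesis using stage_exists assms unfolding stage_rel_def by simp
  qed (simp add: stage_rel_def)
qed

text \<open>\<open>S\<close> guesses single sets of nodes, correctly on a club; \<open>g\<close>
  guesses coded sequences of sets of pairs, for which one correct level in a given club
  suffices.\<close>

locale diamond_tree =
  fixes S :: "omega1 \<Rightarrow> (omega1 \<times> nat) set set" and g :: "omega1 \<Rightarrow> (omega1 \<times> nat) set"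
    and X :: "omega1 \<Rightarrow> bool \<Rightarrow> omega1 \<Rightarrow> nat"
  assumes guess_star: "\<And>Y. \<exists>C. club C \<and> (\<forall>a\<in>C. Y \<inter> {..<a} \<times> UNIV \<in> S a)"
    and guess: "\<And>Y C. club C \<Longrightarrow> \<exists>a\<in>C. Y \<inter> {..<a} \<times> UNIV = g a"
    and stages: "\<And>d. stage_rel S g X d (X d)"
begin

abbreviation "T \<equiv> Tree X"

lemma branch_ok_all: "branch_ok X d" using stage_rel_branch_ok stages .

lemma T_summable: "t \<in> T \<Longrightarrow> wsummable t" using Tree_wsummable branch_ok_all by blast

lemma stage_at:
  "islim d \<Longrightarrow> stage_ok d (below T d) (declared_below g X d) (decode_nodes (below T d) ` S d) (decode_pairs (below T d) (g d)) (branches X d)"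
  using stages[of d] unfolding stage_rel_def by blast

lemma countable_level: "countable (level T a)" by (rule Tree_countable_level)

lemma level_below: "b < d \<Longrightarrow> level (below T d) b = level T b"
  unfolding level_def below_def using lev_eq by auto

lemma to_nat_level_inj:
  "u \<in> T \<Longrightarrow> v \<in> T \<Longrightarrow> lev u = lev v \<Longrightarrow>
   to_nat_on (level T (lev u)) u = to_nat_on (level T (lev u)) v \<longleftrightarrow> u = v"
  using inj_on_to_nat_on[OF countable_level] unfolding inj_on_def by (auto simp: level_eq_lev)

text \<open>On \<open>C1\<close> the set \<open>A\<close> below \<open>d\<close> is among the
  guesses, so the stage at \<open>d\<close> decides it relative to nodes below \<open>d\<close>. On
  \<open>C2\<close> an extension in \<open>A\<close> violating the weight bound would reflect to one
  below \<open>d\<close>, so the decision holds in the whole tree.\<close>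

lemma decided_on_club:
  assumes "A \<subseteq> T"
  shows "\<exists>C. club C \<and> (\<forall>v\<in>T. lev v \<in> C \<longrightarrow> islim (lev v) \<and> decided (lev v) T A v)"
proof -
  let ?code = "\<lambda>v. (lev v, to_nat_on (level T (lev v)) v)"
  obtain C1 where C1: "club C1" "\<And>a. a \<in> C1 \<Longrightarrow> (?code ` A) \<inter> {..<a} \<times> UNIV \<in> S a"
    using guess_star[of "?code ` A"] by blast
  have "countable (level T b \<times> (UNIV :: rat set))" for b using countable_level by simp
  then obtain C2 where C2: "club C2" "\<And>d. d \<in> C2 \<Longrightarrow> islim d"
    "\<And>d b i. d \<in> C2 \<Longrightarrow> b < d \<Longrightarrow> i \<in> level T b \<times> (UNIV :: rat set) \<Longrightarrow>
      \<exists>a. (\<exists>w\<in>A. lev w = a \<and> fst i \<subset>\<^sub>m w \<and> weight w < weight (fst i) + of_rat (snd i)) \<Longrightarrow>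
      \<exists>a<d. (\<exists>w\<in>A. lev w = a \<and> fst i \<subset>\<^sub>m w \<and> weight w < weight (fst i) + of_rat (snd i))"
    using club_reflect[of "\<lambda>b. level T b \<times> (UNIV :: rat set)"
        "\<lambda>i a. \<exists>w\<in>A. lev w = a \<and> fst i \<subset>\<^sub>m w \<and> weight w < weight (fst i) + of_rat (snd i)"] by (smt (verit))
  have "islim (lev v) \<and> decided (lev v) T A v" if v: "v \<in> T" and C: "lev v \<in> C1 \<inter> C2" for v
  proof -
    define d where "d = lev v"
    have lim: "islim d" using C2(2) C unfolding d_def by blast
    let ?T = "below T d"
    let ?Y = "(?code ` A) \<inter> {..<d} \<times> UNIV"
    have A': "w \<in> decode_nodes ?T ?Y \<longleftrightarrow> w \<in> A" if "w \<in> T" "lev w < d" for w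
    proof -
      have "w \<in> decode_nodes ?T ?Y \<longleftrightarrow> ?code w \<in> ?code ` A"
        using that level_below[OF that(2)] unfolding decode_nodes_def below_def by auto
      also have "\<dots> \<longleftrightarrow> w \<in> A"
        using to_nat_level_inj that(1) assms by (auto simp: subset_iff)
      finally show ?thesis .
    qed
    \<comment> \<open>The node is a graft onto a chosen branch, hence covered by the stage at
      \<open>d\<close>.\<close>
    obtain s b where sb: "b < d" "v = upto_map d (X d s) ++ cut v b"
      using Tree_level_lim[OF v] lim unfolding d_def by blast
    have "cut v b \<in> ?T" unfolding below_def using Tree_cut[OF v] lev_cut[OF v] sb(1) d_def by simp
    moreover have "decode_nodes ?T ?Y \<in> decode_nodes ?T ` S d" using C1(2) C unfolding d_def by blast
    ultimately have "decided d ?T (decode_nodes ?T ?Y) (upto_map d (X d s) ++ cut v b)"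
      using stage_at[OF lim] unfolding stage_ok_def by blast
    then have "decided d ?T (decode_nodes ?T ?Y) v" using sb(2) by simp
    then consider "\<forall>b<d. \<exists>x. b < x \<and> x < d \<and> cut v x \<in> decode_nodes ?T ?Y"
      | b e where "b < d" "0 < e" "weight v < weight (cut v b) + e"
          "\<forall>w\<in>decode_nodes ?T ?Y \<inter> ?T. cut v b \<subset>\<^sub>m w \<longrightarrow> weight (cut v b) + e \<le> weight w"
      unfolding decided_def by blast
    then have "decided d T A v"
    proof cases
      case 1
      have "cut v x \<in> A" if "x < d" "cut v x \<in> decode_nodes ?T ?Y" for x
        using A'[OF Tree_cut[OF v]] lev_cut[OF v] that d_def by simp
      then show ?thesis using 1 unfolding decided_def by blast
    next
      case (2 b e)
      have "weight (cut v b) + e \<le> weight w" if w: "w \<in> A" "cut v b \<subset>\<^sub>m w" for w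
      proof (rule ccontr)
        assume "\<not> weight (cut v b) + e \<le> weight w"
        then have "weight w - weight (cut v b) < e" by simp
        \<comment> \<open>Rational bounds keep the family of reflected statements countable.\<close>
        then obtain q :: rat where q: "weight w - weight (cut v b) < of_rat q" "of_rat q < e"
          using of_rat_dense by blast
        have "lev (cut v b) = b" using lev_cut[OF v] 2(1) d_def by simp
        then have "(cut v b, q) \<in> level T b \<times> UNIV" using Tree_cut[OF v] by (simp add: level_eq_lev)
        then obtain w' where w': "lev w' < d" "w' \<in> A" "cut v b \<subset>\<^sub>m w'" "weight w' < weight (cut v b) + of_rat q"
          using C2(3)[OF _ 2(1), of "(cut v b, q)"] C w q(1) unfolding d_def by fastforce
        have "w' \<in> decode_nodes ?T ?Y \<inter> ?T" using A' w' assms unfolding below_def by blast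
        then show False using 2(4) w'(3,4) q(2) by fastforce
      qed
      then show ?thesis using 2 unfolding decided_def by blast
    qed
    then show ?thesis using lim d_def by simp
  qed
  then show ?thesis using club_Int[OF C1(1) C2(1)] by blast
qed

section \<open>Declared pairs and the common point\<close>

definition label :: "omega1 \<Rightarrow> nat" where
  "label d = (LEAST n. outside d (decode_pairs (below T d) (g d) n) (branches X d))"

definition declared_pairs :: "nat \<Rightarrow> npair set" where
  "declared_pairs n = {branches X d | d. declared g X d \<and> n \<le> label d}"

lemma branch_in_T: "islim d \<Longrightarrow> branches X d s \<in> T"
  using branch_ok_Tree[OF branch_ok_all] by blast

lemma lev_branch: "lev (branches X d s) = d" by (rule lev_eq) simp

text \<open>The stage at \<open>b\<close> kept all proper cuts of its pair off the pairs declared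
  earlier.\<close>

lemma declared_antichain:
  assumes "declared g X a" "declared g X b" "\<And>s. branches X a s \<subseteq>\<^sub>m branches X b s"
  shows "a = b"
proof (rule ccontr)
  assume "a \<noteq> b"
  have "{..<a} \<subseteq> {..<b}" using map_le_implies_dom_le[OF assms(3)] by simp
  then have ab: "a < b" using \<open>a \<noteq> b\<close> by auto
  have "branches X a = pcut (branches X b) a" using map_le_eq_cut[OF assms(3)] by (intro ext) simp
  moreover have "pcut (branches X b) a \<notin> declared_below g X b"
    using stage_at[of b] ab assms(2) unfolding stage_ok_def declared_def by blast
  ultimately show False using ab assms(1) unfolding declared_below_def by auto
qed

lemma pair_code_inj:
  assumes "\<And>s. p s \<in> T" "\<And>s. p' s \<in> T" "\<And>s. lev (p s) = a" "\<And>s. lev (p' s) = a'"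
    "pair_code T n p = pair_code T n' p'"
  shows "p = p' \<and> n = n'"
proof -
  have a: "a = a'" and n: "n = n'"
    and eq: "\<And>s. to_nat_on (level T a) (p s) = to_nat_on (level T a) (p' s)"
    using assms(3-5) unfolding pair_code_def Let_def by (auto split: bool.split) (metis (full_types))
  have "p s = p' s" for s using to_nat_level_inj[OF assms(1,2), of s s] assms(3,4) a eq by simp
  then show ?thesis using n by blast
qed

lemma countable_bool_funs:
  assumes "countable L" shows "countable {p :: bool \<Rightarrow> 'a. \<forall>s. p s \<in> L}"
proof -
  have "{p. \<forall>s. p s \<in> L} \<subseteq> (\<lambda>(x, y) s. if s then x else y) ` (L \<times> L)"
  proof
    fix p :: "bool \<Rightarrow> 'a" assume "p \<in> {p. \<forall>s. p s \<in> L}"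
    then show "p \<in> (\<lambda>(x, y) s. if s then x else y) ` (L \<times> L)"
      by (intro image_eqI[of _ _ "(p True, p False)"]) auto
  qed
  then show ?thesis using assms by (meson countable_SIGMA countable_image countable_subset)
qed

text \<open>Proper cuts were kept off earlier declared pairs by the stage, and a cut at
  \<open>d\<close> or beyond is the undeclared pair itself. Hence this pair is an admissible
  extension of its own cuts.\<close>

lemma avoids_branches:
  assumes "islim d" "\<not> declared g X d"
  shows "avoids {branches X b | b. declared g X b} (branches X d)"
  unfolding avoids_def
proof (intro allI notI)
  fix x assume "pcut (branches X d) x \<in> {branches X b | b. declared g X b}"
  then obtain b where b: "declared g X b" "pcut (branches X d) x = branches X b" by blast
  have "dom (cut (branches X d True) x) = {..<b}" using fun_cong[OF b(2), of True] by simp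
  then have "{..<min d x} = {..<b}" using dom_cut[OF dom_upto_map] by metis
  then have min: "min d x = b" by simp
  show False
  proof (cases "x < d")
    case True
    then have "b = x" using min by simp
    moreover have "pcut (branches X d) x \<notin> declared_below g X d"
      using stage_at[OF assms(1)] True unfolding stage_ok_def by blast
    ultimately show False using b True unfolding declared_below_def by auto
  next
    case False
    then have "b = d" using min by (simp add: not_less min_absorb1)
    then show False using b(1) assms(2) by simp
  qed
qed

text \<open>Take a level \<open>d\<close> where the code of the sequence \<open>G\<close> is guessed
  and counterexamples to capturing reflect. A declared pair with label \<open>n\<close> lies in
  \<open>G n\<close>, so by \<open>op\<close> its late cuts do too, against \<open>outside\<close>.
  For an undeclared pair every \<open>G n\<close> is captured below \<open>d\<close>; were the pair
  outside \<open>G n\<close>, it would reflect to a pair below \<open>d\<close> contradicting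
  this.\<close>

lemma common_point:
  assumes G: "\<And>n. declared_pairs n \<subseteq> G n"
    and op: "\<And>n d. islim d \<Longrightarrow> branches X d \<in> G n \<Longrightarrow>
      \<exists>b<d. \<forall>x. b < x \<longrightarrow> x < d \<longrightarrow> pcut (branches X d) x \<in> G n"
  shows "\<exists>d. islim d \<and> (\<forall>n. branches X d \<in> G n)"
proof -
  define E where "E = {branches X b | b. declared g X b}"
  define Y where "Y = {pair_code T n p | n p. p \<in> G n \<and> (\<forall>s. p s \<in> T) \<and> (\<exists>a. \<forall>s. lev (p s) = a)}"
  define I where "I b = {p :: npair. \<forall>s. p s \<in> level T b} \<times> (UNIV :: (nat \<times> rat) set)" for b
  \<comment> \<open>\<open>Q (p, n, q) a\<close> says that level \<open>a\<close> carries a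
    counterexample to \<open>p\<close> capturing \<open>G n\<close> with budget
    \<open>q\<close>.\<close>
  define Q where "Q = (\<lambda>(p, n, q) a. \<exists>p'. (\<forall>s. p' s \<in> T \<and> lev (p' s) = a \<and> p s \<subset>\<^sub>m p' s \<and>
    weight (p' s) < weight (p s) + of_rat q) \<and> avoids E p' \<and> p' \<notin> G n)"
  have Q_iff: "Q (p, n, q) a \<longleftrightarrow> (\<exists>p'. (\<forall>s. p' s \<in> T \<and> lev (p' s) = a \<and> p s \<subset>\<^sub>m p' s \<and>
    weight (p' s) < weight (p s) + of_rat q) \<and> avoids E p' \<and> p' \<notin> G n)" for p n q a
    unfolding Q_def by simp
  have "countable (I b)" for b unfolding I_def
    using countable_bool_funs[OF countable_level] by (intro countable_SIGMA) auto
  then have "\<exists>C. club C \<and> (\<forall>d\<in>C. islim d \<and> (\<forall>b<d. \<forall>i\<in>I b. (\<exists>a. Q i a) \<longrightarrow> (\<exists>a<d. Q i a)))"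
    by (rule club_reflect)
  then obtain C where C: "club C" "\<forall>d\<in>C. islim d \<and> (\<forall>b<d. \<forall>i\<in>I b. (\<exists>a. Q i a) \<longrightarrow> (\<exists>a<d. Q i a))"
    by (elim exE conjE)
  obtain d where d: "d \<in> C" "Y \<inter> {..<d} \<times> UNIV = g d" using guess[OF C(1), of Y] by blast
  have lim: "islim d" and refl: "\<And>b i. b < d \<Longrightarrow> i \<in> I b \<Longrightarrow> \<exists>a. Q i a \<Longrightarrow> \<exists>a<d. Q i a"
    using C(2) d(1) by blast+
  let ?T = "below T d"
  let ?B = "branches X d"
  let ?G = "decode_pairs ?T (g d)"
  have G': "p \<in> ?G n \<longleftrightarrow> p \<in> G n" if p: "\<And>s. p s \<in> T" "\<And>s. lev (p s) = x" "x < d" for p x n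
  proof -
    have "pair_code ?T n p = pair_code T n p"
      unfolding pair_code_def Let_def using p(2,3) level_below by simp
    moreover have "pair_code T n p \<in> {..<d} \<times> UNIV"
      unfolding pair_code_def Let_def using p(2,3) by simp
    ultimately have "p \<in> ?G n \<longleftrightarrow> pair_code T n p \<in> Y"
      unfolding decode_pairs_def d(2)[symmetric] by simp
    also have "\<dots> \<longleftrightarrow> p \<in> G n"
    proof
      assume "pair_code T n p \<in> Y"
      then obtain n' p' a' where *: "p' \<in> G n'" "\<And>s. p' s \<in> T" "\<And>s. lev (p' s) = a'"
        "pair_code T n p = pair_code T n' p'" unfolding Y_def by blast
      then show "p \<in> G n" using pair_code_inj[OF p(1) *(2) p(2) *(3,4)] by simp
    next
      assume "p \<in> G n"
      then show "pair_code T n p \<in> Y" unfolding Y_def using p(1,2) by blast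
    qed
    finally show ?thesis .
  qed
  have cutB: "cut (?B s) x \<in> T" "lev (cut (?B s) x) = x" if "x < d" for s x
    using Tree_cut[OF branch_in_T[OF lim]] lev_cut[OF branch_in_T[OF lim], of s x] lev_branch that by auto
  have ok: "\<And>n. outside d (?G n) ?B \<or>
       (\<exists>b<d. \<exists>e>0. (\<forall>s. weight (?B s) < weight (cut (?B s) b) + e) \<and> captured ?T (declared_below g X d) (?G n) (pcut ?B b) e)"
    using stage_at[OF lim] unfolding stage_ok_def by blast
  show ?thesis
  proof (cases "declared g X d")
    case True
    define n where "n = label d"
    have out: "outside d (?G n) ?B"
      using True unfolding n_def label_def declared_def by (metis (mono_tags, lifting) LeastI_ex)
    have "?B \<in> G n" using G[of n] True unfolding declared_pairs_def n_def by blast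
    then obtain b where b: "b < d" "\<And>x. b < x \<Longrightarrow> x < d \<Longrightarrow> pcut ?B x \<in> G n" using op[OF lim] by blast
    obtain x where "b < x" "x < d" "pcut ?B x \<notin> ?G n" using out b(1) unfolding outside_def by blast
    then show ?thesis using b(2) G'[of "pcut ?B x" x n] cutB by simp
  next
    case False
    have "?B \<in> G n" for n
    proof (rule ccontr)
      assume nG: "?B \<notin> G n"
      have "\<not> outside d (?G n) ?B" using False lim unfolding declared_def by blast
      then obtain b e where b: "b < d" "\<And>s. weight (?B s) < weight (cut (?B s) b) + e"
        "captured ?T (declared_below g X d) (?G n) (pcut ?B b) e" using ok[of n] by blast
      \<comment> \<open>The maximum yields one rational budget \<open>q\<close> good for both
        members.\<close>
      have "max (weight (?B True) - weight (cut (?B True) b)) (weight (?B False) - weight (cut (?B False) b)) < e"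
        using b(2)[of True] b(2)[of False] by simp
      then obtain q :: rat where q: "max (weight (?B True) - weight (cut (?B True) b)) (weight (?B False) - weight (cut (?B False) b)) < of_rat q"
        "of_rat q < e" using of_rat_dense by blast
      have cB: "weight (?B s) < weight (cut (?B s) b) + of_rat q" for s using q(1) by (cases s) auto
      have "cut (?B s) b \<subset>\<^sub>m ?B s" for s
        using cut_map_le[of "?B s" b] cutB(2)[OF b(1), of s] lev_branch[of d s] b(1)
        unfolding strict_map_le_def by force
      \<comment> \<open>The branches themselves form a counterexample on level
        \<open>d\<close>.\<close>
      then have "Q (pcut ?B b, n, q) d"
        unfolding Q_iff using nG avoids_branches[OF lim False] branch_in_T[OF lim] lev_branch[of d] cB
        unfolding E_def by (intro exI[of _ ?B]) simp
      moreover have "(pcut ?B b, n, q) \<in> I b"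
        unfolding I_def using cutB[OF b(1)] by (simp add: level_eq_lev)
      ultimately obtain a where a: "a < d" "Q (pcut ?B b, n, q) a" using refl[OF b(1)] by blast
      then obtain p' where p': "\<And>s. p' s \<in> T" "\<And>s. lev (p' s) = a" "\<And>s. pcut ?B b s \<subset>\<^sub>m p' s"
        "\<And>s. weight (p' s) < weight (pcut ?B b s) + of_rat q" "avoids E p'" "p' \<notin> G n"
        unfolding Q_iff by blast
      have "avoids (declared_below g X d) p'" using p'(5) unfolding avoids_def E_def declared_below_def by blast
      moreover have "p' s \<in> ?T" for s unfolding below_def using p'(1,2) a(1) by simp
      moreover have "weight (p' s) < weight (pcut ?B b s) + e" for s using p'(4)[of s] q(2) by simp
      ultimately have "p' \<in> ?G n" using b(3) p'(2,3) unfolding captured_def by blast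
      then show False using G'[OF p'(1,2) a(1)] p'(6) by simp
    qed
    then show ?thesis using lim by blast
  qed
qed

end

section \<open>The interval topology\<close>

text \<open>Complements of closed sets become countable unions of open sets with closed hulls
  inside. This gives the \<open>G_delta\<close> property at once, and normality by the usual
  alternating subtraction of hulls.\<close>

lemma perfectly_normal_criterion:
  assumes "\<And>G. openin X G \<Longrightarrow> \<exists>\<P>. countable \<P> \<and> G = (\<Union>P\<in>\<P>. fst P) \<and>
    (\<forall>P\<in>\<P>. openin X (fst P) \<and> closedin X (snd P) \<and> fst P \<subseteq> snd P \<and> snd P \<subseteq> G)"
  shows "perfectly_normal_space X"
proof -
  have seq: "\<exists>U F :: nat \<Rightarrow> 'a set. (\<forall>n. openin X (U n) \<and> closedin X (F n) \<and> U n \<subseteq> F n \<and> F n \<subseteq> G) \<and> G = (\<Union>n. U n)"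
    if G: "openin X G" for G
  proof -
    obtain \<P> where P: "countable \<P>" "G = (\<Union>P\<in>\<P>. fst P)"
      "\<forall>P\<in>\<P>. openin X (fst P) \<and> closedin X (snd P) \<and> fst P \<subseteq> snd P \<and> snd P \<subseteq> G"
      using assms[OF G] by (elim exE conjE)
    \<comment> \<open>The extra empty pair makes the family nonempty, so that it can be
      enumerated.\<close>
    let ?Q = "insert ({}, {}) \<P>"
    have r: "range (from_nat_into ?Q) = ?Q" using P(1) by (intro range_from_nat_into) auto
    have "\<forall>P\<in>?Q. openin X (fst P) \<and> closedin X (snd P) \<and> fst P \<subseteq> snd P \<and> snd P \<subseteq> G"
      using P(3) by simp
    then have "openin X (fst (from_nat_into ?Q n)) \<and> closedin X (snd (from_nat_into ?Q n)) \<and>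
      fst (from_nat_into ?Q n) \<subseteq> snd (from_nat_into ?Q n) \<and> snd (from_nat_into ?Q n) \<subseteq> G" for n
      using from_nat_into[of ?Q n] by blast
    moreover have "G = (\<Union>n. fst (from_nat_into ?Q n))"
    proof -
      have "(\<Union>n. fst (from_nat_into ?Q n)) = \<Union> (fst ` range (from_nat_into ?Q))" by (simp add: image_image)
      also have "\<dots> = G" unfolding r using P(2) by simp
      finally show ?thesis by simp
    qed
    ultimately show ?thesis
      by (intro exI[of _ "\<lambda>n. fst (from_nat_into ?Q n)"] exI[of _ "\<lambda>n. snd (from_nat_into ?Q n)"]) simp
  qed
  have "normal_space X" unfolding normal_space_def
  proof (intro allI impI)
    fix H K assume HK: "closedin X H \<and> closedin X K \<and> disjnt H K"
    have "openin X (topspace X - K)" using HK by blast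
    from seq[OF this] obtain U :: "nat \<Rightarrow> 'a set" where "\<exists>F. (\<forall>n. openin X (U n) \<and> closedin X (F n) \<and> U n \<subseteq> F n \<and> F n \<subseteq> topspace X - K) \<and> topspace X - K = (\<Union>n. U n)" ..
    then obtain F where UF: "(\<forall>n. openin X (U n) \<and> closedin X (F n) \<and> U n \<subseteq> F n \<and> F n \<subseteq> topspace X - K) \<and> topspace X - K = (\<Union>n. U n)" ..
    then have U_eq: "topspace X - K = (\<Union>n. U n)" ..
    from UF have U: "openin X (U n)" "closedin X (F n)" "U n \<subseteq> F n" "F n \<subseteq> topspace X - K" for n
      by blast+
    have "openin X (topspace X - H)" using HK by blast
    from seq[OF this] obtain U' :: "nat \<Rightarrow> 'a set" where "\<exists>F'. (\<forall>n. openin X (U' n) \<and> closedin X (F' n) \<and> U' n \<subseteq> F' n \<and> F' n \<subseteq> topspace X - H) \<and> topspace X - H = (\<Union>n. U' n)" ..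
    then obtain F' where U'F: "(\<forall>n. openin X (U' n) \<and> closedin X (F' n) \<and> U' n \<subseteq> F' n \<and> F' n \<subseteq> topspace X - H) \<and> topspace X - H = (\<Union>n. U' n)" ..
    then have U'_eq: "topspace X - H = (\<Union>n. U' n)" ..
    from U'F have U': "openin X (U' n)" "closedin X (F' n)" "U' n \<subseteq> F' n" "F' n \<subseteq> topspace X - H" for n
      by blast+
    \<comment> \<open>Removing the first hulls of the other family makes \<open>P\<close> and
      \<open>Q\<close> disjoint: whichever of two indices is smaller, its hull was removed at the
      larger one.\<close>
    define P where "P = (\<Union>n. U n - (\<Union>m\<in>{..n}. F' m))"
    define Q where "Q = (\<Union>n. U' n - (\<Union>m\<in>{..n}. F m))"
    have "openin X P" unfolding P_def using U(1) U'(2)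
      by (intro openin_Union) (auto intro!: openin_diff closedin_Union)
    moreover have "openin X Q" unfolding Q_def using U'(1) U(2)
      by (intro openin_Union) (auto intro!: openin_diff closedin_Union)
    moreover have "H \<subseteq> P"
    proof
      fix x assume x: "x \<in> H"
      then have "x \<in> topspace X - K" using HK closedin_subset by (auto simp: disjnt_iff)
      then obtain n where "x \<in> U n" using U_eq by blast
      moreover have "x \<notin> F' m" for m using U'(4) x by blast
      ultimately show "x \<in> P" unfolding P_def by blast
    qed
    moreover have "K \<subseteq> Q"
    proof
      fix x assume x: "x \<in> K"
      then have "x \<in> topspace X - H" using HK closedin_subset by (auto simp: disjnt_iff)
      then obtain n where "x \<in> U' n" using U'_eq by blast
      moreover have "x \<notin> F m" for m using U(4) x by blast
      ultimately show "x \<in> Q" unfolding Q_def by blast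
    qed
    moreover have "disjnt P Q"
    proof -
      have "x \<notin> Q" if xP: "x \<in> P" for x
      proof
        assume "x \<in> Q"
        then obtain k where k: "x \<in> U' k" "\<And>m. m \<le> k \<Longrightarrow> x \<notin> F m" unfolding Q_def by blast
        obtain n where n: "x \<in> U n" "\<And>m. m \<le> n \<Longrightarrow> x \<notin> F' m" using xP unfolding P_def by blast
        show False
        proof (cases "k \<le> n")
          case True
          show False using n(2)[OF True] k(1) U'(3)[of k] by (meson subsetD)
        next
          case False
          then have "x \<notin> F n" using k(2) by simp
          then show False using n(1) U(3)[of n] by (meson subsetD)
        qed
      qed
      then show ?thesis unfolding disjnt_iff by meson
    qed
    ultimately show "\<exists>U V. openin X U \<and> openin X V \<and> H \<subseteq> U \<and> K \<subseteq> V \<and> disjnt U V" by blast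
  qed
  moreover have "gdelta_in X K" if K: "closedin X K" for K
  proof -
    have "openin X (topspace X - K)" using K by blast
    from seq[OF this] obtain U :: "nat \<Rightarrow> 'a set" where "\<exists>F. (\<forall>n. openin X (U n) \<and> closedin X (F n) \<and> U n \<subseteq> F n \<and> F n \<subseteq> topspace X - K) \<and> topspace X - K = (\<Union>n. U n)" ..
    then obtain F where UF: "(\<forall>n. openin X (U n) \<and> closedin X (F n) \<and> U n \<subseteq> F n \<and> F n \<subseteq> topspace X - K) \<and> topspace X - K = (\<Union>n. U n)" ..
    then have U_eq: "topspace X - K = (\<Union>n. U n)" ..
    from UF have U: "closedin X (F n)" "U n \<subseteq> F n" "F n \<subseteq> topspace X - K" for n
      by blast+
    have "(\<Union>n. U n) \<subseteq> (\<Union>n. F n)" using U(2) by (intro UN_mono) auto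
    then have "topspace X - K = (\<Union>n. F n)" unfolding U_eq[symmetric] using U(3) by (intro equalityI UN_least)
    moreover have "fsigma_in X (\<Union>n. F n)"
      by (intro fsigma_in_Union) (auto intro: closed_imp_fsigma_in U(1))
    ultimately show ?thesis using closedin_subset[OF K] by (simp add: gdelta_in_fsigma_in)
  qed
  ultimately show ?thesis unfolding perfectly_normal_space_def by blast
qed

context diamond_tree
begin

abbreviation "\<tau> \<equiv> tree_topology T"

lemma seq_tree_T: "seq_tree T"
  unfolding seq_tree_def countable_seqs_def
proof (intro conjI exI[of _ "UNIV :: nat set"] ballI)
  show "T \<subseteq> {t. (\<exists>\<alpha>. dom t = {..<\<alpha>}) \<and> ran t \<subseteq> UNIV}" using Tree_dom by blast
qed (use Tree_cut in auto)

lemma T_nonempty: "T \<noteq> {}" using Tree_empty by blast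

lemma topspace_\<tau>: "topspace \<tau> = T"
  using topspace_tree_topology[OF seq_tree_T T_nonempty] .

lemma strict_lev: "u \<in> T \<Longrightarrow> v \<in> T \<Longrightarrow> u \<subset>\<^sub>m v \<Longrightarrow> lev u < lev v"
  using map_le_implies_dom_le[of u v] map_le_dom_eq[of u v] Tree_dom[of u X] Tree_dom[of v X]
  unfolding strict_map_le_def by (metis lessThan_subset_iff order_le_less)

lemma cut_lev: "v \<in> T \<Longrightarrow> x \<le> lev v \<Longrightarrow> lev (cut v x) = x"
  using lev_cut[of v X x] by (simp add: min_absorb2)

lemma cut_full: "v \<in> T \<Longrightarrow> cut v (lev v) = v"
  using cut_self[OF Tree_dom] by blast

lemma cut_strict: "v \<in> T \<Longrightarrow> b < lev v \<Longrightarrow> cut v b \<subset>\<^sub>m v"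
  unfolding strict_map_le_def using cut_map_le cut_lev[of v b] by (metis less_imp_le less_irrefl)

lemma map_le_cut: "u \<in> T \<Longrightarrow> u \<subseteq>\<^sub>m v \<Longrightarrow> u = cut v (lev u)"
  using map_le_eq_cut Tree_dom by blast

lemma map_le_lev: "u \<in> T \<Longrightarrow> v \<in> T \<Longrightarrow> u \<subseteq>\<^sub>m v \<Longrightarrow> lev u \<le> lev v"
  using map_le_implies_dom_le[of u v] Tree_dom[of u X] Tree_dom[of v X] by (metis lessThan_subset_iff)

lemma nonempty_lev: "v \<in> T \<Longrightarrow> v \<noteq> Map.empty \<Longrightarrow> \<exists>b. b < lev v"
  using Tree_dom[of v X] by (metis dom_eq_empty_conv lessThan_iff ex_in_conv)

lemma lev_nonempty: "b < lev v \<Longrightarrow> v \<in> T \<Longrightarrow> v \<noteq> Map.empty"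
  using Tree_dom[of v X] by auto

text \<open>Basic neighbourhoods of a nonempty node are segments of its own cuts, so openness is
  tested along each branch separately; the root is isolated.\<close>

lemma openin_\<tau>:
  "openin \<tau> U \<longleftrightarrow> U \<subseteq> T \<and>
    (\<forall>z\<in>U. z \<noteq> Map.empty \<longrightarrow> (\<exists>b<lev z. \<forall>x. b < x \<longrightarrow> x \<le> lev z \<longrightarrow> cut z x \<in> U))"
proof
  assume U: "openin \<tau> U"
  then have UT: "U \<subseteq> T" using openin_subset topspace_\<tau> by metis
  obtain \<B> where B: "\<B> \<subseteq> tree_basis T" "U = \<Union>\<B>"
    using U openin_tree_topology[OF seq_tree_T T_nonempty] by blast
  have "\<exists>b<lev z. \<forall>x. b < x \<longrightarrow> x \<le> lev z \<longrightarrow> cut z x \<in> U" if z: "z \<in> U" "z \<noteq> Map.empty" for z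
  proof -
    obtain W where W: "W \<in> \<B>" "z \<in> W" using z(1) B(2) by blast
    then have "W \<noteq> {Map.empty}" using z(2) by blast
    then obtain u v where uv: "W = tree_interval T u v" "u \<in> T" "v \<in> T"
      using B(1) W(1) unfolding tree_basis_def by blast
    have zz: "z \<in> T" "u \<subset>\<^sub>m z" "z \<subseteq>\<^sub>m v" using W(2) uv(1) unfolding tree_interval_def by auto
    have uz: "u = cut z (lev u)" using map_le_cut[OF uv(2)] zz(2) unfolding strict_map_le_def by blast
    have "cut z x \<in> U" if x: "lev u < x" "x \<le> lev z" for x
    proof -
      have "u \<subseteq>\<^sub>m cut z x" using uz cut_mono[of "lev u" x z] x(1) by simp
      moreover have "u \<noteq> cut z x" using cut_lev[OF zz(1) x(2)] x(1) by auto
      moreover have "cut z x \<subseteq>\<^sub>m v" using cut_map_le zz(3) map_le_trans by blast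
      ultimately have "cut z x \<in> W"
        unfolding uv(1) tree_interval_def strict_map_le_def using Tree_cut[OF zz(1)] by blast
      then show ?thesis using W(1) B(2) by blast
    qed
    then show ?thesis using strict_lev[OF uv(2) zz(1,2)] by blast
  qed
  then show "U \<subseteq> T \<and> (\<forall>z\<in>U. z \<noteq> Map.empty \<longrightarrow> (\<exists>b<lev z. \<forall>x. b < x \<longrightarrow> x \<le> lev z \<longrightarrow> cut z x \<in> U))"
    using UT by blast
next
  assume U: "U \<subseteq> T \<and> (\<forall>z\<in>U. z \<noteq> Map.empty \<longrightarrow> (\<exists>b<lev z. \<forall>x. b < x \<longrightarrow> x \<le> lev z \<longrightarrow> cut z x \<in> U))"
  have "\<exists>W\<in>tree_basis T. z \<in> W \<and> W \<subseteq> U" if z: "z \<in> U" for z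
  proof (cases "z = Map.empty")
    case True
    then show ?thesis using z unfolding tree_basis_def by blast
  next
    case False
    then obtain b where b: "b < lev z" "\<And>x. b < x \<Longrightarrow> x \<le> lev z \<Longrightarrow> cut z x \<in> U" using U z by blast
    have zT: "z \<in> T" using U z by blast
    have "tree_interval T (cut z b) z \<in> tree_basis T"
      unfolding tree_basis_def using Tree_cut[OF zT] zT cut_strict[OF zT b(1)] by blast
    moreover have "z \<in> tree_interval T (cut z b) z"
      unfolding tree_interval_def using zT cut_strict[OF zT b(1)] by simp
    moreover have "tree_interval T (cut z b) z \<subseteq> U"
    proof
      fix w assume "w \<in> tree_interval T (cut z b) z"
      then have w: "w \<in> T" "cut z b \<subset>\<^sub>m w" "w \<subseteq>\<^sub>m z" unfolding tree_interval_def by auto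
      have "b < lev w" using strict_lev[OF Tree_cut[OF zT] w(1,2)] cut_lev[OF zT] b(1) by simp
      then show "w \<in> U" using b(2) map_le_lev[OF w(1) zT w(3)] map_le_cut[OF w(1,3)] by metis
    qed
    ultimately show ?thesis by blast
  qed
  then have "U = \<Union> {W \<in> tree_basis T. W \<subseteq> U}" by blast
  then show "openin \<tau> U"
    unfolding openin_tree_topology[OF seq_tree_T T_nonempty] by (metis (no_types, lifting) mem_Collect_eq subsetI)
qed

lemma closedin_\<tau>I:
  assumes "F \<subseteq> T" "\<And>z. z \<in> T \<Longrightarrow> z \<notin> F \<Longrightarrow> z \<noteq> Map.empty \<Longrightarrow>
    \<exists>b<lev z. \<forall>x. b < x \<longrightarrow> x \<le> lev z \<longrightarrow> cut z x \<notin> F"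
  shows "closedin \<tau> F"
  unfolding closedin_def topspace_\<tau> openin_\<tau> using assms Tree_cut by (metis DiffD1 DiffD2 DiffI Diff_subset)

lemma weight_cut_gt:
  assumes "z \<in> T" "z \<noteq> Map.empty" "q < weight z"
  shows "\<exists>b<lev z. \<forall>x. b < x \<longrightarrow> x \<le> lev z \<longrightarrow> q < weight (cut z x)"
proof -
  obtain b where b: "b < lev z" "\<And>w b'. cut z b \<subset>\<^sub>m w \<Longrightarrow> w \<subseteq>\<^sub>m z \<Longrightarrow> dom w = {..<b'} \<Longrightarrow> q < weight w"
    using weight_lower_semicontinuous[OF T_summable[OF assms(1)] Tree_dom[OF assms(1)] _ assms(3)]
      nonempty_lev[OF assms(1,2)] by blast
  have "q < weight (cut z x)" if "b < x" "x \<le> lev z" for x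
  proof (rule b(2)[OF _ cut_map_le])
    show "dom (cut z x) = {..<x}" using Tree_dom[OF Tree_cut[OF assms(1)]] cut_lev[OF assms(1) that(2)] by metis
    have "cut z b \<noteq> cut z x" using cut_lev[OF assms(1)] that b(1) by (metis less_imp_le less_irrefl)
    then show "cut z b \<subset>\<^sub>m cut z x" unfolding strict_map_le_def using cut_mono[of b x z] that(1) by simp
  qed
  then show ?thesis using b(1) by blast
qed

end

section \<open>Perfect normality and the square\<close>

text \<open>The supremum of the part of \<open>C\<close> below \<open>a\<close> belongs to
  \<open>C\<close> by closure, and differs from \<open>a\<close> because \<open>a\<close> does
  not.\<close>

lemma club_last_below:
  assumes "club C" "a \<notin> C" "\<exists>b\<in>C. b < a"
  shows "\<exists>s\<in>C. s < a \<and> (\<forall>b\<in>C. b < a \<longrightarrow> b \<le> s)"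
proof -
  define s where "s = (LEAST s. \<forall>b\<in>C. b < a \<longrightarrow> b \<le> s)"
  have "\<forall>b\<in>C. b < a \<longrightarrow> b \<le> a" by auto
  then have ub: "\<forall>b\<in>C. b < a \<longrightarrow> b \<le> s" and sa: "s \<le> a"
    unfolding s_def by (rule LeastI, rule Least_le)
  have "s \<in> C"
  proof (rule ccontr)
    assume n: "s \<notin> C"
    obtain b where b: "b \<in> C" "b < a" using assms(3) by blast
    have ltb: "b < s" if "b \<in> C" "b < a" for b using ub that n by (metis order_le_less)
    have "\<exists>b\<in>C. x < b \<and> b < s" if "x < s" for x
      using not_less_Least[OF that[unfolded s_def]] ltb by (auto simp: not_le)
    moreover have "{..<s} \<noteq> {}" using ltb[OF b] by blast
    ultimately have "s \<in> C" using assms(1) unfolding club_def by blast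
    then show False using n by simp
  qed
  then show ?thesis using ub sa assms(2) by (metis order_le_less)
qed

context diamond_tree
begin

lemma clopen_empty_seq: "closedin \<tau> {Map.empty}" "openin \<tau> {Map.empty}"
proof -
  show "openin \<tau> {Map.empty}" unfolding openin_\<tau> using Tree_empty by simp
  show "closedin \<tau> {Map.empty}"
  proof (rule closedin_\<tau>I)
    fix z assume z: "z \<in> T" "z \<noteq> Map.empty"
    obtain b where b: "b < lev z" using nonempty_lev[OF z] by blast
    have "cut z x \<noteq> Map.empty" if "b < x" "x \<le> lev z" for x
      using lev_nonempty[of b "cut z x"] cut_lev[OF z(1) that(2)] that(1) Tree_cut[OF z(1)] by simp
    then show "\<exists>b<lev z. \<forall>x. b < x \<longrightarrow> x \<le> lev z \<longrightarrow> cut z x \<notin> {Map.empty}" using b by blast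
  qed (simp add: Tree_empty)
qed

text \<open>An open set \<open>G\<close> is covered by countably many slices at a club \<open>C\<close> of levels and by countably
  many gap pieces elsewhere. The rational \<open>q\<close> separates the weight at the bottom of a gap of \<open>C\<close>
  from the weights on the chosen segment; as weights increase, segments of one piece that lie in
  different gaps then never lie on a common branch, so the piece is closed.\<close>

definition slice :: "node set \<Rightarrow> real \<Rightarrow> (real \<Rightarrow> bool) \<Rightarrow> node set" where
  "slice G q P = {z \<in> T. \<exists>u\<in>T. u \<subset>\<^sub>m z \<and> P (weight z) \<and> (\<forall>w\<in>T. u \<subset>\<^sub>m w \<longrightarrow> weight w < q \<longrightarrow> w \<in> G)}"

lemma openin_slice: "openin \<tau> (slice G q (\<lambda>x. x < r))"
  unfolding openin_\<tau>
proof (intro conjI ballI impI)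
  show "slice G q (\<lambda>x. x < r) \<subseteq> T" unfolding slice_def by blast
  fix z assume "z \<in> slice G q (\<lambda>x. x < r)"
  then obtain u where z: "z \<in> T" "u \<in> T" "u \<subset>\<^sub>m z" "weight z < r"
    "\<forall>w\<in>T. u \<subset>\<^sub>m w \<longrightarrow> weight w < q \<longrightarrow> w \<in> G" unfolding slice_def by blast
  have uz: "u = cut z (lev u)" using map_le_cut[OF z(2)] z(3) unfolding strict_map_le_def by blast
  have "cut z x \<in> slice G q (\<lambda>x. x < r)" if x: "lev u < x" "x \<le> lev z" for x
  proof -
    have "u \<subseteq>\<^sub>m cut z x" using uz cut_mono[of "lev u" x z] x(1) by simp
    moreover have "u \<noteq> cut z x" using cut_lev[OF z(1) x(2)] x(1) by auto
    moreover have "weight (cut z x) < r" using weight_mono[OF T_summable[OF z(1)] cut_map_le[of z x]] z(4) by simp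
    ultimately show ?thesis
      unfolding slice_def strict_map_le_def using Tree_cut[OF z(1)] z(2,5) unfolding strict_map_le_def by blast
  qed
  then show "\<exists>b<lev z. \<forall>x. b < x \<longrightarrow> x \<le> lev z \<longrightarrow> cut z x \<in> slice G q (\<lambda>x. x < r)"
    using strict_lev[OF z(2,1,3)] by blast
qed

text \<open>Suppose \<open>z\<close> is not in the slice. If its weight exceeds \<open>r\<close>, so
  do the weights of its late cuts. Otherwise no cut of \<open>z\<close> is in the slice, since the
  node \<open>u\<close> witnessing this would witness it for \<open>z\<close>.\<close>

lemma closedin_slice: "closedin \<tau> (slice G q (\<lambda>x. x \<le> r))"
proof (rule closedin_\<tau>I)
  show "slice G q (\<lambda>x. x \<le> r) \<subseteq> T" unfolding slice_def by blast
  fix z assume z: "z \<in> T" "z \<notin> slice G q (\<lambda>x. x \<le> r)" "z \<noteq> Map.empty"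
  show "\<exists>b<lev z. \<forall>x. b < x \<longrightarrow> x \<le> lev z \<longrightarrow> cut z x \<notin> slice G q (\<lambda>x. x \<le> r)"
  proof (cases "weight z \<le> r")
    case False
    then obtain b where b: "b < lev z" "\<forall>x. b < x \<longrightarrow> x \<le> lev z \<longrightarrow> r < weight (cut z x)"
      using weight_cut_gt[OF z(1,3), of r] by auto
    then have "\<forall>x. b < x \<longrightarrow> x \<le> lev z \<longrightarrow> cut z x \<notin> slice G q (\<lambda>x. x \<le> r)"
      unfolding slice_def by (auto simp: not_le)
    then show ?thesis using b(1) by blast
  next
    case True
    have "cut z x \<notin> slice G q (\<lambda>x. x \<le> r)" for x
    proof
      assume "cut z x \<in> slice G q (\<lambda>x. x \<le> r)"
      then obtain u where u: "u \<in> T" "u \<subset>\<^sub>m cut z x" "\<forall>w\<in>T. u \<subset>\<^sub>m w \<longrightarrow> weight w < q \<longrightarrow> w \<in> G"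
        unfolding slice_def by blast
      have "u \<subset>\<^sub>m z" using u(2) cut_map_le[of z x] unfolding strict_map_le_def
        by (metis map_le_antisym map_le_trans)
      then have "z \<in> slice G q (\<lambda>x. x \<le> r)" unfolding slice_def using z(1) u(1,3) True by blast
      then show False using z(2) by simp
    qed
    then show ?thesis using nonempty_lev[OF z(1,3)] by blast
  qed
qed

lemma slice_subset: "r < q \<Longrightarrow> slice G q (\<lambda>x. x \<le> r) \<subseteq> G"
  unfolding slice_def by fastforce

section \<open>Pieces in the gaps of a club\<close>

definition gap :: "omega1 set \<Rightarrow> node \<Rightarrow> node set" where
  "gap C v = {w \<in> T. C \<inter> {..<lev w} = C \<inter> {..<lev v}}"

definition gap_segment :: "omega1 set \<Rightarrow> node set \<Rightarrow> real \<Rightarrow> node \<Rightarrow> omega1 \<Rightarrow> bool" where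
  "gap_segment C G q v a \<longleftrightarrow> a < lev v \<and>
     (\<forall>x. a < x \<longrightarrow> x \<le> lev v \<longrightarrow> cut v x \<in> G \<and> q < weight (cut v x) \<and> x \<notin> C)"

text \<open>The nodes of one gap are countable in number, so the index \<open>n\<close> singles out
  at most one node per gap.\<close>

definition gap_nodes :: "omega1 set \<Rightarrow> node set \<Rightarrow> real \<Rightarrow> nat \<Rightarrow> node set" where
  "gap_nodes C G q n = {v \<in> T. (\<exists>a. gap_segment C G q v a) \<and>
     (\<forall>b\<in>C. b < lev v \<longrightarrow> weight (cut v b) < q) \<and> to_nat_on (gap C v) v = n}"

definition gap_piece :: "omega1 set \<Rightarrow> node set \<Rightarrow> real \<Rightarrow> nat \<Rightarrow> node set" where
  "gap_piece C G q n = {cut v x | v x. v \<in> gap_nodes C G q n \<and>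
     (SOME a. gap_segment C G q v a) < x \<and> x \<le> lev v}"

text \<open>The next element of \<open>C\<close> above \<open>lev v\<close> bounds the levels of all
  nodes in the gap.\<close>

lemma countable_gap: assumes "club C" shows "countable (gap C v)"
proof -
  obtain e where e: "e \<in> C" "lev v < e" using assms unfolding club_def by blast
  have "gap C v \<subseteq> (\<Union>a\<in>{..e}. level T a)"
  proof
    fix w assume w: "w \<in> gap C v"
    have "lev w \<le> e"
    proof (rule ccontr)
      assume "\<not> lev w \<le> e"
      then have "e \<in> C \<inter> {..<lev w}" using e(1) by simp
      moreover have "C \<inter> {..<lev w} = C \<inter> {..<lev v}" using w unfolding gap_def by blast
      ultimately have "e \<in> C \<inter> {..<lev v}" by (simp only:)
      then show False using e(2) by (meson IntD2 lessThan_iff less_asym)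
    qed
    then show "w \<in> (\<Union>a\<in>{..e}. level T a)" using w unfolding gap_def by (auto simp: level_eq_lev)
  qed
  moreover have "countable (\<Union>a\<in>{..e}. level T a)"
    using countable_atMost_omega1 countable_level by blast
  ultimately show ?thesis by (rule countable_subset)
qed

lemma gap_segment_some: "v \<in> gap_nodes C G q n \<Longrightarrow> gap_segment C G q v (SOME a. gap_segment C G q v a)"
  unfolding gap_nodes_def by (auto intro: someI_ex)

lemma gap_piece_subset: "gap_piece C G q n \<subseteq> G \<inter> T"
proof
  fix z assume "z \<in> gap_piece C G q n"
  then obtain v x where v: "z = cut v x" "v \<in> gap_nodes C G q n"
    "(SOME a. gap_segment C G q v a) < x" "x \<le> lev v" unfolding gap_piece_def by blast
  then have "z \<in> G" using gap_segment_some[OF v(2)] unfolding gap_segment_def by blast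
  moreover have "z \<in> T" using v(1,2) Tree_cut unfolding gap_nodes_def by blast
  ultimately show "z \<in> G \<inter> T" by simp
qed

lemma openin_gap_piece: "openin \<tau> (gap_piece C G q n)"
  unfolding openin_\<tau>
proof (intro conjI ballI impI)
  show "gap_piece C G q n \<subseteq> T" using gap_piece_subset by blast
  fix z assume "z \<in> gap_piece C G q n"
  then obtain v x where v: "z = cut v x" "v \<in> gap_nodes C G q n"
    "(SOME a. gap_segment C G q v a) < x" "x \<le> lev v" unfolding gap_piece_def by blast
  have lz: "lev z = x" using v(1,2,4) cut_lev unfolding gap_nodes_def by blast
  have "cut z y \<in> gap_piece C G q n" if y: "(SOME a. gap_segment C G q v a) < y" "y \<le> x" for y
  proof -
    have "cut z y = cut v y" unfolding v(1) cut_cut using y(2) by (simp add: min_absorb2)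
    then show ?thesis unfolding gap_piece_def using v(2,4) y order_trans by blast
  qed
  then show "\<exists>b<lev z. \<forall>x. b < x \<longrightarrow> x \<le> lev z \<longrightarrow> cut z x \<in> gap_piece C G q n"
    using v(3) lz by blast
qed

text \<open>All cuts of \<open>z\<close> in the piece from \<open>x0\<close> on come from a single
  node \<open>v\<close>. So \<open>z\<close>, lying outside the piece, either branches off from
  \<open>v\<close> or extends it, and from then on its cuts avoid the piece.\<close>

lemma closedin_gap_piece: assumes C: "club C" shows "closedin \<tau> (gap_piece C G q n)"
proof (rule closedin_\<tau>I)
  let ?N = "gap_piece C G q n"
  show "?N \<subseteq> T" using gap_piece_subset by blast
  fix z assume z: "z \<in> T" "z \<notin> ?N" "z \<noteq> Map.empty"
  have seg: "\<exists>v. v \<in> gap_nodes C G q n \<and> (SOME a. gap_segment C G q v a) < x \<and> x \<le> lev v \<and>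
      cut z x = cut v x \<and> C \<inter> {..<lev v} = C \<inter> {..<x} \<and> q < weight (cut z x) \<and> v \<in> T \<and>
      (\<forall>b\<in>C. b < lev v \<longrightarrow> weight (cut v b) < q)"
    if x: "x \<le> lev z" "cut z x \<in> ?N" for x
  proof -
    obtain v y where v: "cut z x = cut v y" "v \<in> gap_nodes C G q n"
      "(SOME a. gap_segment C G q v a) < y" "y \<le> lev v" using x(2) unfolding gap_piece_def by blast
    have vT: "v \<in> T" using v(2) unfolding gap_nodes_def by blast
    have yx: "y = x" using v(1) cut_lev[OF z(1) x(1)] cut_lev[OF vT v(4)] by simp
    define a0 where "a0 = (SOME a. gap_segment C G q v a)"
    have s: "gap_segment C G q v a0" unfolding a0_def using gap_segment_some[OF v(2)] .
    have ay: "a0 < y" unfolding a0_def using v(3) .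
    have low: "b < x" if "b \<in> C" "b < lev v" for b
    proof (rule ccontr)
      assume "\<not> b < x"
      then have "a0 < b" using ay yx by simp
      then show False using s that unfolding gap_segment_def by (meson less_imp_le)
    qed
    have "C \<inter> {..<lev v} = C \<inter> {..<x}"
    proof (rule set_eqI)
      fix b
      have "b < lev v" if "b < x" using that v(4) yx by simp
      then show "b \<in> C \<inter> {..<lev v} \<longleftrightarrow> b \<in> C \<inter> {..<x}" using low[of b] by auto
    qed
    moreover have "q < weight (cut z x)" unfolding v(1) using s ay v(4) unfolding gap_segment_def by blast
    moreover have "\<forall>b\<in>C. b < lev v \<longrightarrow> weight (cut v b) < q" using v(2) unfolding gap_nodes_def by blast
    ultimately show ?thesis using v yx vT by (intro exI[of _ v] conjI) simp_all
  qed
  show "\<exists>b<lev z. \<forall>x. b < x \<longrightarrow> x \<le> lev z \<longrightarrow> cut z x \<notin> ?N"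
  proof (cases "\<exists>x\<le>lev z. cut z x \<in> ?N")
    case False
    then show ?thesis using nonempty_lev[OF z(1,3)] by blast
  next
    case True
    then obtain x0 where x0: "x0 \<le> lev z" "cut z x0 \<in> ?N" by blast
    obtain v where v: "v \<in> gap_nodes C G q n" "(SOME a. gap_segment C G q v a) < x0" "x0 \<le> lev v"
      "cut z x0 = cut v x0" "C \<inter> {..<lev v} = C \<inter> {..<x0}" "q < weight (cut z x0)" "v \<in> T"
      using seg[OF x0] by (elim exE conjE) (rule that)
    have key: "x \<le> lev v \<and> cut z x = cut v x" if x: "x0 \<le> x" "x \<le> lev z" "cut z x \<in> ?N" for x
    proof -
      obtain v' where v': "v' \<in> gap_nodes C G q n" "x \<le> lev v'" "cut z x = cut v' x"
        "C \<inter> {..<lev v'} = C \<inter> {..<x}" "v' \<in> T" "\<forall>b\<in>C. b < lev v' \<longrightarrow> weight (cut v' b) < q"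
        using seg[OF x(2,3)] by (elim exE conjE) (rule that)
      \<comment> \<open>An element \<open>b\<close> of \<open>C\<close> between \<open>x0\<close>
        and \<open>x\<close> would give \<open>cut z b\<close> weight below \<open>q\<close>, while
        its initial part \<open>cut z x0\<close> already weighs more. Hence \<open>v'\<close> and
        \<open>v\<close> share a gap and an index, and are equal.\<close>
      have low: "b < x0" if b: "b \<in> C" "b < x" for b
      proof (rule ccontr)
        assume "\<not> b < x0"
        then have "cut z x0 \<subseteq>\<^sub>m cut z b" by (intro cut_mono) simp
        then have "weight (cut z x0) \<le> weight (cut z b)" using weight_mono T_summable Tree_cut[OF z(1)] by blast
        moreover have "cut z b = cut v' b"
          using arg_cong[OF v'(3), of "\<lambda>t. cut t b"] b(2) unfolding cut_cut by (simp add: min_absorb2)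
        moreover have "weight (cut v' b) < q" using v'(6) b v'(2) by (meson less_le_trans)
        ultimately show False using v(6) by simp
      qed
      have "C \<inter> {..<x} = C \<inter> {..<x0}"
      proof (rule set_eqI)
        fix b
        have "b < x" if "b < x0" using that x(1) by simp
        then show "b \<in> C \<inter> {..<x} \<longleftrightarrow> b \<in> C \<inter> {..<x0}" using low[of b] by auto
      qed
      then have eq: "C \<inter> {..<lev v'} = C \<inter> {..<lev v}" using v(5) v'(4) by simp
      then have gv: "gap C v' = gap C v" unfolding gap_def by simp
      have "v' \<in> gap C v" "v \<in> gap C v" using eq v'(5) v(7) unfolding gap_def by simp_all
      moreover have "to_nat_on (gap C v) v' = to_nat_on (gap C v) v"
        using v(1) v'(1) gv unfolding gap_nodes_def by auto
      ultimately have "v' = v" using inj_on_to_nat_on[OF countable_gap[OF C]] unfolding inj_on_def by blast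
      then show ?thesis using v'(2,3) by simp
    qed
    have x0z: "x0 < lev z"
    proof (rule ccontr)
      assume "\<not> x0 < lev z"
      then have "x0 = lev z" using x0(1) by simp
      then show False using x0(2) cut_full[OF z(1)] z(2) by simp
    qed
    show ?thesis
    proof (cases "lev z \<le> lev v")
      case True
      have "z \<noteq> cut v (lev z)"
      proof
        assume "z = cut v (lev z)"
        then have "z \<in> ?N" unfolding gap_piece_def using v(1,2) True x0z less_trans by blast
        then show False using z(2) by simp
      qed
      \<comment> \<open>A coordinate where \<open>z\<close> departs from \<open>v\<close>; cuts
        containing it are no longer cuts of \<open>v\<close>.\<close>
      then obtain y where y: "z y \<noteq> cut v (lev z) y" by blast
      have "y < lev z"
      proof (rule ccontr)
        assume "\<not> y < lev z"
        then have "y \<notin> dom z" using Tree_dom[OF z(1)] by simp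
        then show False using y \<open>\<not> y < lev z\<close> by (simp add: domIff)
      qed
      have "cut z x \<notin> ?N" if x: "max y x0 < x" "x \<le> lev z" for x
      proof
        assume "cut z x \<in> ?N"
        then have "cut z x = cut v x" using key[of x] x by (simp add: less_imp_le)
        then have "cut z x y = cut v x y" by simp
        then show False using y x \<open>y < lev z\<close> by simp
      qed
      then show ?thesis using \<open>y < lev z\<close> x0z by (intro exI[of _ "max y x0"]) simp
    next
      case False
      have "cut z x \<notin> ?N" if x: "max (lev v) x0 < x" "x \<le> lev z" for x
        using key[of x] x by (auto simp: less_imp_le not_le)
      then show ?thesis using False x0z by (intro exI[of _ "max (lev v) x0"]) simp
    qed
  qed
qed

text \<open>Rational parameters leave countably many pieces: the root, slices for nodes on levels in
  \<open>C\<close>, and gap pieces for the others.\<close>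

lemma countable_closed_refinement:
  assumes G: "openin \<tau> G"
  shows "\<exists>\<P>. countable \<P> \<and> G = (\<Union>P\<in>\<P>. fst P) \<and>
    (\<forall>P\<in>\<P>. openin \<tau> (fst P) \<and> closedin \<tau> (snd P) \<and> fst P \<subseteq> snd P \<and> snd P \<subseteq> G)"
proof -
  have GT: "G \<subseteq> T" using G unfolding openin_\<tau> by blast
  obtain C where C: "club C" "\<And>v. v \<in> T \<Longrightarrow> lev v \<in> C \<Longrightarrow> islim (lev v) \<and> decided (lev v) T (T - G) v"
    using decided_on_club[of "T - G"] by blast
  define P0 :: "(node set \<times> node set) set" where "P0 = {P. P = ({Map.empty}, {Map.empty}) \<and> Map.empty \<in> G}"
  define P1 where "P1 = (\<lambda>(q, r). (slice G (of_rat q) (\<lambda>x. x < of_rat r), slice G (of_rat q) (\<lambda>x. x \<le> of_rat r))) `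
    {(q, r). r < q}"
  define P2 where "P2 = (\<lambda>(q, n). (gap_piece C G (of_rat q) n, gap_piece C G (of_rat q) n)) ` UNIV"
  have P: "openin \<tau> (fst P) \<and> closedin \<tau> (snd P) \<and> fst P \<subseteq> snd P \<and> snd P \<subseteq> G" if "P \<in> P0 \<union> P1 \<union> P2" for P
  proof -
    consider "P \<in> P0" | "P \<in> P1" | "P \<in> P2" using \<open>P \<in> P0 \<union> P1 \<union> P2\<close> by blast
    then show ?thesis
    proof cases
      case 1
      then show ?thesis unfolding P0_def using clopen_empty_seq by auto
    next
      case 2
      then obtain q r where "P = (slice G (of_rat q) (\<lambda>x. x < of_rat r), slice G (of_rat q) (\<lambda>x. x \<le> of_rat r))" "r < q"
        unfolding P1_def by auto
      moreover have "slice G (of_rat q) (\<lambda>x. x < of_rat r) \<subseteq> slice G (of_rat q) (\<lambda>x. x \<le> of_rat r)"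
        unfolding slice_def using less_imp_le by blast
      ultimately show ?thesis using openin_slice closedin_slice slice_subset[of "of_rat r" "of_rat q" G]
        by (simp add: of_rat_less)
    next
      case 3
      then obtain q n where "P = (gap_piece C G (of_rat q) n, gap_piece C G (of_rat q) n)"
        unfolding P2_def by auto
      moreover have "gap_piece C G (of_rat q) n \<subseteq> G" using gap_piece_subset[of C G "of_rat q" n] by blast
      ultimately show ?thesis using openin_gap_piece closedin_gap_piece[OF C(1)] by simp
    qed
  qed
  have "countable P0"
    by (rule countable_subset[of _ "{({Map.empty}, {Map.empty})}"]) (auto simp: P0_def)
  then have "countable (P0 \<union> P1 \<union> P2)"
    unfolding P1_def P2_def by (intro countable_Un countable_image countableI_type)
  moreover have "G = (\<Union>P\<in>P0 \<union> P1 \<union> P2. fst P)"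
  proof (intro equalityI subsetI)
    fix z assume z: "z \<in> G"
    then have zT: "z \<in> T" using GT by blast
    consider "z = Map.empty" | "z \<noteq> Map.empty" "lev z \<in> C" | "z \<noteq> Map.empty" "lev z \<notin> C" by blast
    then show "z \<in> (\<Union>P\<in>P0 \<union> P1 \<union> P2. fst P)"
    proof cases
      case 1
      then have "({Map.empty}, {Map.empty}) \<in> P0" unfolding P0_def using z by simp
      then show ?thesis using 1 by force
    next
      case 2
      obtain b where b: "b < lev z" "\<And>x. b < x \<Longrightarrow> x \<le> lev z \<Longrightarrow> cut z x \<in> G"
        using G z 2(1) unfolding openin_\<tau> by blast
      \<comment> \<open>Openness of \<open>G\<close> excludes members of the complement cofinally
        below \<open>z\<close>, so the other alternative of \<open>decided\<close> holds.\<close>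
      have "\<not> (\<forall>b<lev z. \<exists>x. b < x \<and> x < lev z \<and> cut z x \<in> T - G)" using b by (meson DiffD2 less_imp_le)
      then obtain a e where a: "a < lev z" "0 < e" "weight z < weight (cut z a) + e"
        "\<forall>w\<in>(T - G) \<inter> T. cut z a \<subset>\<^sub>m w \<longrightarrow> weight (cut z a) + e \<le> weight w"
        using C(2)[OF zT 2(2)] unfolding decided_def by blast
      \<comment> \<open>Two rationals are needed: \<open>r\<close> bounds the weights in the slice,
        and \<open>q\<close> above it leaves room for the closed hull inside
        \<open>G\<close>.\<close>
      obtain r :: rat where r: "weight z < of_rat r" "of_rat r < weight (cut z a) + e" using of_rat_dense[OF a(3)] by blast
      obtain q :: rat where q: "(of_rat r :: real) < of_rat q" "of_rat q < weight (cut z a) + e" using of_rat_dense[OF r(2)] by blast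
      have "\<forall>w\<in>T. cut z a \<subset>\<^sub>m w \<longrightarrow> weight w < of_rat q \<longrightarrow> w \<in> G" using a(4) q(2) by fastforce
      then have "z \<in> slice G (of_rat q) (\<lambda>x. x < of_rat r)"
        unfolding slice_def using zT Tree_cut[OF zT] cut_strict[OF zT a(1)] r(1) by blast
      moreover have "(slice G (of_rat q) (\<lambda>x. x < of_rat r), slice G (of_rat q) (\<lambda>x. x \<le> of_rat r)) \<in> P1"
        unfolding P1_def using q(1) by (intro image_eqI[of _ _ "(q, r)"]) (auto simp: of_rat_less)
      ultimately show ?thesis by force
    next
      case 3
      obtain b where b: "b < lev z" "\<And>x. b < x \<Longrightarrow> x \<le> lev z \<Longrightarrow> cut z x \<in> G"
        using G z 3(1) unfolding openin_\<tau> by blast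
      \<comment> \<open>Here \<open>s\<close> is the last element of \<open>C\<close> below
        \<open>z\<close>, and \<open>q\<close> separates the weight there from that of
        \<open>z\<close>; without such an element any rational below the weight of \<open>z\<close>
        serves.\<close>
      have "\<exists>s<lev z. \<exists>q::rat. of_rat q < weight z \<and> (\<forall>b\<in>C. b < lev z \<longrightarrow> b \<le> s \<and> weight (cut z b) < of_rat q)"
      proof (cases "\<exists>b\<in>C. b < lev z")
        case True
        then obtain s where s: "s < lev z" "\<forall>b\<in>C. b < lev z \<longrightarrow> b \<le> s"
          using club_last_below[OF C(1) 3(2)] by blast
        obtain q :: rat where q: "weight (cut z s) < of_rat q" "of_rat q < weight z"
          using of_rat_dense[OF weight_strict[OF T_summable[OF zT] cut_strict[OF zT s(1)]]] by blast
        have "weight (cut z b) < of_rat q" if "b \<in> C" "b < lev z" for b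
          using weight_mono[OF T_summable[OF Tree_cut[OF zT, of s]] cut_mono[of b s z]] s(2) that q(1) by fastforce
        then show ?thesis using s q(2) by blast
      next
        case False
        obtain q :: rat where "weight z - 1 < of_rat q" "of_rat q < weight z" using of_rat_dense[of "weight z - 1" "weight z"] by auto
        then show ?thesis using False b(1) by blast
      qed
      then obtain s and q :: rat where s: "s < lev z" "of_rat q < weight z"
        "\<forall>b\<in>C. b < lev z \<longrightarrow> b \<le> s \<and> weight (cut z b) < of_rat q" by blast
      obtain b' where b': "b' < lev z" "\<forall>x. b' < x \<longrightarrow> x \<le> lev z \<longrightarrow> of_rat q < weight (cut z x)"
        using weight_cut_gt[OF zT 3(1) s(2)] by blast
      define a where "a = max s (max b b')"
      have "gap_segment C G (of_rat q) z a" unfolding gap_segment_def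
      proof (intro conjI allI impI)
        show "a < lev z" unfolding a_def using s(1) b(1) b'(1) by simp
        fix x assume x: "a < x" "x \<le> lev z"
        then show "cut z x \<in> G" "of_rat q < weight (cut z x)" using b(2) b'(2) unfolding a_def by simp_all
        show "x \<notin> C"
        proof
          assume "x \<in> C"
          then have "x < lev z" using 3(2) x(2) by (metis order_le_less)
          then have "x \<le> s" using s(3) \<open>x \<in> C\<close> by blast
          then show False using x(1) unfolding a_def by (meson leD max_less_iff_conj)
        qed
      qed
      then have v: "z \<in> gap_nodes C G (of_rat q) (to_nat_on (gap C z) z)"
        unfolding gap_nodes_def using zT s(3) by blast
      have in_seg: "(SOME a. gap_segment C G (of_rat q) z a) < lev z"
        using gap_segment_some[OF v] unfolding gap_segment_def by blast
      have "z \<in> gap_piece C G (of_rat q) (to_nat_on (gap C z) z)"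
        unfolding gap_piece_def
        by (intro CollectI exI[of _ z] exI[of _ "lev z"] conjI v in_seg cut_full[OF zT, symmetric] order_refl)
      moreover have "(gap_piece C G (of_rat q) (to_nat_on (gap C z) z), gap_piece C G (of_rat q) (to_nat_on (gap C z) z)) \<in> P2"
        unfolding P2_def by (intro image_eqI[of _ _ "(q, to_nat_on (gap C z) z)"]) auto
      ultimately show ?thesis by force
    qed
  next
    fix z assume "z \<in> (\<Union>P\<in>P0 \<union> P1 \<union> P2. fst P)"
    then obtain P where "P \<in> P0 \<union> P1 \<union> P2" "z \<in> fst P" by (rule UN_E)
    then show "z \<in> G" using P[of P] by (meson subsetD)
  qed
  moreover have "\<forall>P\<in>P0 \<union> P1 \<union> P2. openin \<tau> (fst P) \<and> closedin \<tau> (snd P) \<and> fst P \<subseteq> snd P \<and> snd P \<subseteq> G"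
    using P by (rule ballI)
  ultimately show ?thesis by (intro exI[of _ "P0 \<union> P1 \<union> P2"] conjI)
qed

lemma perfectly_normal_\<tau>: "perfectly_normal_space \<tau>"
  using countable_closed_refinement by (rule perfectly_normal_criterion)

text \<open>A member \<open>v\<close> of an antichain on a decided level has no proper cut in the
  antichain, and \<open>v\<close> itself is an extension of \<open>cut v b\<close> lighter than the
  bound in the other alternative.\<close>

lemma almost_Souslin_T: "almost_Souslin T"
  unfolding almost_Souslin_def
proof (intro allI impI notI)
  fix A assume A: "A \<subseteq> T" "tree_antichain A" and st: "stationary {\<alpha>. \<exists>x\<in>A. dom x = {..<\<alpha>}}"
  obtain C where C: "club C" "\<And>v. v \<in> T \<Longrightarrow> lev v \<in> C \<Longrightarrow> islim (lev v) \<and> decided (lev v) T A v"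
    using decided_on_club[OF A(1)] by blast
  obtain v where v: "v \<in> A" "lev v \<in> C" using st C(1) lev_eq unfolding stationary_def by blast
  have vT: "v \<in> T" using v(1) A(1) by blast
  have "cut v x \<notin> A" if "x < lev v" for x
    using A(2) v(1) cut_strict[OF vT that] unfolding tree_antichain_def strict_map_le_def by blast
  moreover have "\<exists>b. b < lev v" using C(2)[OF vT v(2)] unfolding islim_def by blast
  ultimately obtain b e where b: "b < lev v" "weight v < weight (cut v b) + e"
      "\<forall>w\<in>A \<inter> T. cut v b \<subset>\<^sub>m w \<longrightarrow> weight (cut v b) + e \<le> weight w"
    using C(2)[OF vT v(2)] unfolding decided_def by blast
  have "weight (cut v b) + e \<le> weight v" using b(3) v(1) vT cut_strict[OF vT b(1)] by blast
  then show False using b(2) by simp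
qed

lemma real_embeddable_T: "real_embeddable T"
  unfolding real_embeddable_def using weight_strict T_summable by blast

lemma aleph1_tree_T: "aleph1_tree T"
  unfolding aleph1_tree_def
proof (intro conjI allI seq_tree_T countable_level)
  fix a
  obtain z :: omega1 where z: "{..<z} = {}" using ex_zero_omega1 by blast
  have "lev Map.empty = z" by (rule lev_eq) (simp add: z)
  moreover have "z \<le> a" using z by (metis empty_iff lessThan_iff not_less)
  ultimately obtain v where "v \<in> T" "lev v = a"
    using Tree_extend[OF Tree_empty, of a X 1] branch_ok_all by auto
  then show "level T a \<noteq> {}" by (auto simp: level_eq_lev)
qed

section \<open>The square is not countably metacompact\<close>

definition declared_products :: "nat \<Rightarrow> (node \<times> node) set" where
  "declared_products n = (\<lambda>p. (p True, p False)) ` declared_pairs n"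

lemma down_open:
  assumes "z \<in> T" shows "openin \<tau> {w \<in> T. w \<subseteq>\<^sub>m z}" "openin \<tau> {w \<in> T. w \<subseteq>\<^sub>m z \<and> b < lev w}"
proof -
  have le: "cut w x \<subseteq>\<^sub>m z" if "w \<subseteq>\<^sub>m z" for w x using that cut_map_le map_le_trans by blast
  show "openin \<tau> {w \<in> T. w \<subseteq>\<^sub>m z}"
    unfolding openin_\<tau> using nonempty_lev Tree_cut le by simp
  show "openin \<tau> {w \<in> T. w \<subseteq>\<^sub>m z \<and> b < lev w}"
    unfolding openin_\<tau> 
  proof (intro conjI ballI impI)
    fix w assume w: "w \<in> {w \<in> T. w \<subseteq>\<^sub>m z \<and> b < lev w}"
    then have "cut w x \<in> {w \<in> T. w \<subseteq>\<^sub>m z \<and> b < lev w}" if "b < x" "x \<le> lev w" for x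
      using that Tree_cut le cut_lev by simp
    then show "\<exists>a<lev w. \<forall>x. a < x \<longrightarrow> x \<le> lev w \<longrightarrow> cut w x \<in> {w \<in> T. w \<subseteq>\<^sub>m z \<and> b < lev w}"
      using w by blast
  qed blast
qed

text \<open>Two declared pairs below a common pair \<open>z\<close> are comparable in both
  coordinates, hence equal by the antichain property.\<close>

lemma declared_pairs_unique:
  assumes "p \<in> declared_pairs n" "p' \<in> declared_pairs n" "\<And>s. p s \<subseteq>\<^sub>m z s" "\<And>s. p' s \<subseteq>\<^sub>m z s"
  shows "p = p'"
proof -
  obtain d d' where d: "p = branches X d" "declared g X d" "p' = branches X d'" "declared g X d'"
    using assms(1,2) unfolding declared_pairs_def by blast
  have "d = d'"
  proof (cases "d \<le> d'")
    case True
    then have "branches X d s \<subseteq>\<^sub>m branches X d' s" for s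
      using map_le_dom_subset_eq[OF assms(3,4), of s] d by simp
    then show ?thesis using declared_antichain[OF d(2,4)] by blast
  next
    case False
    then have "branches X d' s \<subseteq>\<^sub>m branches X d s" for s
      using map_le_dom_subset_eq[OF assms(4,3), of s] d by simp
    then show ?thesis using declared_antichain[OF d(4,2)] by blast
  qed
  then show ?thesis using d by simp
qed

lemma declared_pairs_in_T: "p \<in> declared_pairs n \<Longrightarrow> p s \<in> T"
  unfolding declared_pairs_def using branch_in_T unfolding declared_def by blast

text \<open>The rectangle of predecessors of \<open>z\<close> contains at most one declared pair
  \<open>p\<close>. If \<open>p\<close> is not \<open>z\<close>, it lies strictly below in some
  coordinate and is removed by raising the lower end there.\<close>

lemma openin_declared_products_compl: "openin (prod_topology \<tau> \<tau>) (T \<times> T - declared_products n)"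
  unfolding openin_prod_topology_alt
proof (intro allI impI)
  fix a b assume ab: "(a, b) \<in> T \<times> T - declared_products n"
  define z where "z = (\<lambda>s. if s then a else b)"
  have zT: "z s \<in> T" for s using ab unfolding z_def by simp
  have rect: "\<exists>U V. openin \<tau> U \<and> openin \<tau> V \<and> a \<in> U \<and> b \<in> V \<and> U \<times> V \<subseteq> T \<times> T - declared_products n"
    if N: "\<And>s. openin \<tau> (N s)" "\<And>s. z s \<in> N s" "\<And>p. p \<in> declared_pairs n \<Longrightarrow> \<exists>s. p s \<notin> N s" for N
  proof (rule exI[of _ "N True"], rule exI[of _ "N False"], intro conjI N(1))
    show "a \<in> N True" "b \<in> N False" using N(2)[of True] N(2)[of False] unfolding z_def by simp_all
    have "N s \<subseteq> T" for s using N(1)[of s] unfolding openin_\<tau> by blast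
    moreover have "p \<in> declared_pairs n \<Longrightarrow> \<not> (p True \<in> N True \<and> p False \<in> N False)" for p
      using N(3)[of p] by (metis (full_types))
    ultimately show "N True \<times> N False \<subseteq> T \<times> T - declared_products n" unfolding declared_products_def by blast
  qed
  show "\<exists>U V. openin \<tau> U \<and> openin \<tau> V \<and> a \<in> U \<and> b \<in> V \<and> U \<times> V \<subseteq> T \<times> T - declared_products n"
  proof (cases "\<exists>p\<in>declared_pairs n. \<forall>s. p s \<subseteq>\<^sub>m z s")
    case False
    show ?thesis
      by (rule rect[of "\<lambda>s. {w \<in> T. w \<subseteq>\<^sub>m z s}"]) (use False zT down_open in auto)
  next
    case True
    then obtain p where p: "p \<in> declared_pairs n" "\<And>s. p s \<subseteq>\<^sub>m z s" by blast
    have "p \<noteq> z"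
    proof
      assume "p = z"
      then have "(a, b) \<in> declared_products n" using p(1) unfolding declared_products_def z_def by (intro image_eqI[of _ _ p]) auto
      then show False using ab by blast
    qed
    then obtain s0 where s0: "p s0 \<noteq> z s0" by blast
    then have lev_less: "lev (p s0) < lev (z s0)"
      using strict_lev[OF declared_pairs_in_T[OF p(1)] zT] p(2) unfolding strict_map_le_def by blast
    show ?thesis
    proof (rule rect[of "\<lambda>s. if s = s0 then {w \<in> T. w \<subseteq>\<^sub>m z s \<and> lev (p s0) < lev w} else {w \<in> T. w \<subseteq>\<^sub>m z s}"])
      fix p' assume p': "p' \<in> declared_pairs n"
      show "\<exists>s. p' s \<notin> (if s = s0 then {w \<in> T. w \<subseteq>\<^sub>m z s \<and> lev (p s0) < lev w} else {w \<in> T. w \<subseteq>\<^sub>m z s})"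
      proof (rule ccontr)
        assume "\<not> ?thesis"
        then have in_N: "p' s \<in> (if s = s0 then {w \<in> T. w \<subseteq>\<^sub>m z s \<and> lev (p s0) < lev w} else {w \<in> T. w \<subseteq>\<^sub>m z s})" for s
          by blast
        have "p' s \<subseteq>\<^sub>m z s" for s using in_N[of s] by (auto split: if_splits)
        then have "p = p'" using declared_pairs_unique[OF p(1) p' p(2)] by blast
        then show False using in_N[of s0] by simp
      qed
    qed (use zT lev_less down_open in auto)
  qed
qed

text \<open>The complements \<open>U n\<close> form an increasing open cover. For a point-finite
  refinement, the union of members not inside \<open>U n\<close> is open and contains the
  \<open>n\<close>-th closed set. A point in all these unions would lie in members fitting into no
  common \<open>U M\<close>, against point-finiteness.\<close>

lemma not_countably_metacompact: "\<not> countably_metacompact_space (prod_topology \<tau> \<tau>)"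
proof
  let ?P = "prod_topology \<tau> \<tau>"
  assume cmc: "countably_metacompact_space ?P"
  define U where "U n = T \<times> T - declared_products n" for n
  have top: "topspace ?P = T \<times> T" by (simp add: topspace_\<tau>)
  have Umono: "U m \<subseteq> U n" if "m \<le> n" for m n
    unfolding U_def declared_products_def declared_pairs_def using that by fastforce
  have cover: "x \<in> (\<Union>n. U n)" if "x \<in> T \<times> T" for x
  proof (rule ccontr)
    \<comment> \<open>A point of all the closed sets would have unbounded labels, but its level
      determines its label.\<close>
    assume "x \<notin> (\<Union>n. U n)"
    then have all: "x \<in> declared_products n" for n using that unfolding U_def by blast
    have ex: "\<exists>d. n \<le> label d \<and> x = (branches X d True, branches X d False)" for n
      using all[of n] unfolding declared_products_def declared_pairs_def by auto
    obtain d where d: "x = (branches X d True, branches X d False)" using ex by blast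
    obtain d' where d': "Suc (label d) \<le> label d'" "x = (branches X d' True, branches X d' False)" using ex by blast
    have "branches X d True = branches X d' True" using d d'(2) by simp
    then have "d = d'" using lev_branch by metis
    then show False using d'(1) by simp
  qed
  have "openin ?P (U n)" for n unfolding U_def by (rule openin_declared_products_compl)
  moreover have "\<Union> (range U) = T \<times> T" using cover unfolding U_def by blast
  ultimately have cov: "open_cover ?P (range U)" unfolding open_cover_def top by simp
  have "countable (range U) \<and> open_cover ?P (range U)" using cov by simp
  then have "\<exists>\<V>. open_cover ?P \<V> \<and> (\<forall>V\<in>\<V>. \<exists>W\<in>range U. V \<subseteq> W) \<and>
    (\<forall>x\<in>topspace ?P. finite {V \<in> \<V>. x \<in> V})"
    by (rule cmc[unfolded countably_metacompact_space_def, THEN spec, THEN mp])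
  then obtain \<V> where V: "open_cover ?P \<V>" "\<forall>V\<in>\<V>. \<exists>W\<in>range U. V \<subseteq> W"
    "\<forall>x\<in>topspace ?P. finite {V \<in> \<V>. x \<in> V}" by (elim exE conjE) (rule that)
  define G where "G n = {p :: npair. \<exists>V\<in>\<V>. (p True, p False) \<in> V \<and> \<not> V \<subseteq> U n}" for n
  have "\<exists>d. islim d \<and> (\<forall>n. branches X d \<in> G n)"
  proof (rule common_point)
    show "declared_pairs n \<subseteq> G n" for n
    proof
      fix p assume p: "p \<in> declared_pairs n"
      have "(p True, p False) \<in> T \<times> T" using declared_pairs_in_T[OF p] by simp
      then obtain V where "V \<in> \<V>" "(p True, p False) \<in> V" using V(1) unfolding open_cover_def top by blast
      moreover have "(p True, p False) \<notin> U n" unfolding U_def declared_products_def using p by blast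
      ultimately show "p \<in> G n" unfolding G_def by blast
    qed
    fix n d assume d: "islim d" "branches X d \<in> G n"
    then obtain V where v: "V \<in> \<V>" "(branches X d True, branches X d False) \<in> V" "\<not> V \<subseteq> U n"
      unfolding G_def by blast
    then have "openin ?P V" using V(1) unfolding open_cover_def by blast
    then obtain A B where AB: "openin \<tau> A" "openin \<tau> B" "branches X d True \<in> A" "branches X d False \<in> B" "A \<times> B \<subseteq> V"
      using v(2) unfolding openin_prod_topology_alt by meson
    obtain y where "y < d" using d(1) unfolding islim_def by blast
    then have ne: "branches X d s \<noteq> Map.empty" for s
      using lev_nonempty[of y "branches X d s"] branch_in_T[OF d(1)] lev_branch[of d s] by simp
    obtain b1 where b1: "b1 < d" "\<And>x. b1 < x \<Longrightarrow> x \<le> d \<Longrightarrow> cut (branches X d True) x \<in> A"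
      using AB(1,3) ne[of True] lev_branch[of d True] unfolding openin_\<tau> by metis
    obtain b2 where b2: "b2 < d" "\<And>x. b2 < x \<Longrightarrow> x \<le> d \<Longrightarrow> cut (branches X d False) x \<in> B"
      using AB(2,4) ne[of False] lev_branch[of d False] unfolding openin_\<tau> by metis
    have "pcut (branches X d) x \<in> G n" if x: "max b1 b2 < x" "x < d" for x
    proof -
      have "(pcut (branches X d) x True, pcut (branches X d) x False) \<in> V"
        using b1(2)[of x] b2(2)[of x] x AB(5) by (auto simp: less_imp_le)
      then show ?thesis unfolding G_def using v(1,3) by blast
    qed
    then show "\<exists>b<d. \<forall>x. b < x \<longrightarrow> x < d \<longrightarrow> pcut (branches X d) x \<in> G n"
      using b1(1) b2(1) by (intro exI[of _ "max b1 b2"]) simp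
  qed
  then obtain d where d: "islim d" "\<And>n. branches X d \<in> G n" by blast
  define x where "x = (branches X d True, branches X d False)"
  have "x \<in> topspace ?P" unfolding top x_def using branch_in_T[OF d(1)] by simp
  then have fin: "finite {V \<in> \<V>. x \<in> V}" using V(3) by blast
  have "\<exists>m. V \<subseteq> U m" if "V \<in> \<V>" for V using V(2) that by blast
  then obtain m where m: "\<And>V. V \<in> \<V> \<Longrightarrow> V \<subseteq> U (m V)" by metis
  \<comment> \<open>By point-finiteness one index serves all members of the refinement that contain
    \<open>x\<close>.\<close>
  define M where "M = Max (insert 0 (m ` {V \<in> \<V>. x \<in> V}))"
  obtain V where v: "V \<in> \<V>" "x \<in> V" "\<not> V \<subseteq> U M" using d(2)[of M] unfolding G_def x_def by blast
  have "m V \<le> M" unfolding M_def using fin v(1,2) by (intro Max_ge) auto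
  then show False using Umono m[OF v(1)] v(3) by blast
qed

end

theorem theorem2p19:
  assumes "diamond_star"
  shows "\<exists>T :: (omega1 \<rightharpoonup> nat) set.
           aleph1_tree T \<and> real_embeddable T \<and> almost_Souslin T \<and>
           perfectly_normal_space (tree_topology T) \<and>
           \<not> countably_metacompact_space (prod_topology (tree_topology T) (tree_topology T))"
proof -
  from diamond_star_times_nat[OF assms] obtain S :: "omega1 \<Rightarrow> (omega1 \<times> nat) set set"
    where S: "(\<forall>a. countable (S a)) \<and> (\<forall>Y. \<exists>C. club C \<and> (\<forall>a\<in>C. Y \<inter> {..<a} \<times> UNIV \<in> S a))" ..
  from diamond_from_diamond_star[OF assms] obtain g :: "omega1 \<Rightarrow> (omega1 \<times> nat) set"
    where g: "\<forall>Y C. club C \<longrightarrow> (\<exists>a\<in>C. Y \<inter> {..<a} \<times> UNIV = g a)" ..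
  have "\<And>a. countable (S a)" using S by simp
  then have "\<exists>X. \<forall>d. stage_rel S g X d (X d)" by (rule ex_stages)
  then obtain X where X: "\<forall>d. stage_rel S g X d (X d)" ..
  interpret diamond_tree S g X
    by unfold_locales (use S g X in simp_all)
  show ?thesis
    using aleph1_tree_T real_embeddable_T almost_Souslin_T perfectly_normal_\<tau> not_countably_metacompact by blast
qed

end
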